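(* Let $E$ be a second countable locally compact Hausdorff space, equipped with a non-negative regular Borel measure $\mu$. Let $\Pi$ be a determinantal point process on $E$ with kernel $K$ and background measure $\mu$, and for a Borel set $A\subset E$ let $N(A)$ denote the number of points of $\Pi$ in $A$. Then, for every finite collection of disjoint Borel sets $A_1,\dots,A_n\subset E$ and integers $m_1,\dots,m_n$, we have $$\mathbb{P}\left(\bigcap_{i=1}^n\{N(A_i)\le m_i\}\right)\le\prod_{i=1}^n\mathbb{P}\left(N(A_i)\le m_i\right).$$ In particular, the random variables $N(A)$ and $N(B)$ are negatively associated for any two disjoint Borel sets $A$ and $B$.
   Context: A point process (random locally finite point configuration) on $E$ is determinantal with background measure $\mu$ and kernel $K:E\times E\to\mathbb{C}$ if for every $n\ge1$ its $n$-point intensity function with respect to $\mu^{\otimes n}$ is $\rho_n(x_1,\dots,x_n)=\det\left(K(x_i,x_j)\right)_{i,j=1}^n$. The kernel is Hermitian, and the integral operator it induces on $L^2(\mu)$ is locally trace class and a non-negative contraction. Two non-negative random variables $X$ and $Y$ are called negatively associated if for any real numbers $r$ and $s$ one has $\mathbb{P}(X>r,\,Y>s)\le\mathbb{P}(X>r)\,\mathbb{P}(Y>s)$; this is equivalent to $\mathbb{P}(X\le r,\,Y\le s)\le\mathbb{P}(X\le r)\,\mathbb{P}(Y\le s)$ for all real $r,s$. *)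

theory Defs
  imports "HOL-Probability.Probability" "Jordan_Normal_Form.Determinant"
begin

subsection \<open>Regular Borel measures\<close>

text \<open>A Borel measure is called regular if it is finite on compact sets, outer regular on Borel
  sets and inner regular on open sets.\<close>

definition regular_borel_measure :: "'a::t2_space measure \<Rightarrow> bool" where
  "regular_borel_measure \<mu> \<longleftrightarrow>
     sets \<mu> = sets borel \<and>
     (\<forall>C. compact C \<longrightarrow> emeasure \<mu> C < \<infinity>) \<and>
     (\<forall>A\<in>sets borel. emeasure \<mu> A = (INF U\<in>{U. open U \<and> A \<subseteq> U}. emeasure \<mu> U)) \<and>
     (\<forall>U. open U \<longrightarrow> emeasure \<mu> U = (SUP C\<in>{C. compact C \<and> C \<subseteq> U}. emeasure \<mu> C))"


subsection \<open>Operators on complex square-integrable functions\<close>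

text \<open>Elements of $L^2$ are represented by functions, and operators act on representatives;
  operator identities hold almost everywhere only.\<close>

definition L2 :: "'a measure \<Rightarrow> ('a \<Rightarrow> complex) set" where
  "L2 \<mu> = {f \<in> borel_measurable \<mu>. integrable \<mu> (\<lambda>x. (cmod (f x))\<^sup>2)}"

definition L2_inner :: "'a measure \<Rightarrow> ('a \<Rightarrow> complex) \<Rightarrow> ('a \<Rightarrow> complex) \<Rightarrow> complex" where
  "L2_inner \<mu> f g = (\<integral>x. f x * cnj (g x) \<partial>\<mu>)"

definition L2_norm :: "'a measure \<Rightarrow> ('a \<Rightarrow> complex) \<Rightarrow> real" where
  "L2_norm \<mu> f = sqrt (\<integral>x. (cmod (f x))\<^sup>2 \<partial>\<mu>)"

text \<open>Linearity and boundedness imply that the operator respects equality almost everywhere.\<close>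

definition bounded_operator ::
    "'a measure \<Rightarrow> (('a \<Rightarrow> complex) \<Rightarrow> ('a \<Rightarrow> complex)) \<Rightarrow> bool" where
  "bounded_operator \<mu> T \<longleftrightarrow>
     (\<forall>f\<in>L2 \<mu>. T f \<in> L2 \<mu>) \<and>
     (\<forall>f\<in>L2 \<mu>. \<forall>g\<in>L2 \<mu>. \<forall>a b. AE x in \<mu>. T (\<lambda>y. a * f y + b * g y) x = a * T f x + b * T g x) \<and>
     (\<exists>C. \<forall>f\<in>L2 \<mu>. L2_norm \<mu> (T f) \<le> C * L2_norm \<mu> f)"

definition contraction ::
    "'a measure \<Rightarrow> (('a \<Rightarrow> complex) \<Rightarrow> ('a \<Rightarrow> complex)) \<Rightarrow> bool" where
  "contraction \<mu> T \<longleftrightarrow> bounded_operator \<mu> T \<and> (\<forall>f\<in>L2 \<mu>. L2_norm \<mu> (T f) \<le> L2_norm \<mu> f)"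

definition nonneg_operator ::
    "'a measure \<Rightarrow> (('a \<Rightarrow> complex) \<Rightarrow> ('a \<Rightarrow> complex)) \<Rightarrow> bool" where
  "nonneg_operator \<mu> T \<longleftrightarrow> bounded_operator \<mu> T \<and> (\<forall>f\<in>L2 \<mu>. L2_inner \<mu> (T f) f \<in> \<real>\<^sub>\<ge>\<^sub>0)"

text \<open>$S = |T|$: the operator $S$ is non-negative and $S^* S = T^* T$.\<close>

definition is_absolute_value ::
    "'a measure \<Rightarrow> (('a \<Rightarrow> complex) \<Rightarrow> ('a \<Rightarrow> complex)) \<Rightarrow> (('a \<Rightarrow> complex) \<Rightarrow> ('a \<Rightarrow> complex)) \<Rightarrow> bool"
  where
  "is_absolute_value \<mu> T S \<longleftrightarrow>
     nonneg_operator \<mu> S \<and>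
     (\<forall>f\<in>L2 \<mu>. \<forall>g\<in>L2 \<mu>. L2_inner \<mu> (S f) (S g) = L2_inner \<mu> (T f) (T g))"

definition orthonormal_basis :: "'a measure \<Rightarrow> ('a \<Rightarrow> complex) set \<Rightarrow> bool" where
  "orthonormal_basis \<mu> B \<longleftrightarrow>
     B \<subseteq> L2 \<mu> \<and>
     (\<forall>e\<in>B. \<forall>e'\<in>B. L2_inner \<mu> e e' = (if e = e' then 1 else 0)) \<and>
     (\<forall>f\<in>L2 \<mu>. (\<forall>e\<in>B. L2_inner \<mu> f e = 0) \<longrightarrow> (AE x in \<mu>. f x = 0))"

definition trace_class ::
    "'a measure \<Rightarrow> (('a \<Rightarrow> complex) \<Rightarrow> ('a \<Rightarrow> complex)) \<Rightarrow> bool" where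
  "trace_class \<mu> T \<longleftrightarrow>
     bounded_operator \<mu> T \<and>
     (\<exists>S B. is_absolute_value \<mu> T S \<and> orthonormal_basis \<mu> B \<and>
        (\<lambda>e. L2_inner \<mu> (S e) e) summable_on B)"

definition integral_operator ::
    "'a measure \<Rightarrow> ('a \<Rightarrow> 'a \<Rightarrow> complex) \<Rightarrow> ('a \<Rightarrow> complex) \<Rightarrow> ('a \<Rightarrow> complex)" where
  "integral_operator \<mu> K f = (\<lambda>x. \<integral>y. K x y * f y \<partial>\<mu>)"

text \<open>The integral of a non-integrable function is 0 by convention in the library, so convergence of
  the integrals defining the operator has to be required explicitly.\<close>

definition induces_operator :: "'a measure \<Rightarrow> ('a \<Rightarrow> 'a \<Rightarrow> complex) \<Rightarrow> bool" where
  "induces_operator \<mu> K \<longleftrightarrow>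
     (\<lambda>(x, y). K x y) \<in> borel_measurable (\<mu> \<Otimes>\<^sub>M \<mu>) \<and>
     (\<forall>f\<in>L2 \<mu>. AE x in \<mu>. integrable \<mu> (\<lambda>y. K x y * f y)) \<and>
     bounded_operator \<mu> (integral_operator \<mu> K)"

text \<open>The compression of the operator to a compact set $D$ has the kernel
  $1_D(x) K(x,y) 1_D(y)$.\<close>

definition locally_trace_class ::
    "'a::topological_space measure \<Rightarrow> ('a \<Rightarrow> 'a \<Rightarrow> complex) \<Rightarrow> bool" where
  "locally_trace_class \<mu> K \<longleftrightarrow>
     (\<forall>D. compact D \<longrightarrow>
        trace_class \<mu> (integral_operator \<mu> (\<lambda>x y. indicator D x * K x y * indicator D y)))"

definition hermitian_kernel :: "('a \<Rightarrow> 'a \<Rightarrow> complex) \<Rightarrow> bool" where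
  "hermitian_kernel K \<longleftrightarrow> (\<forall>x y. K y x = cnj (K x y))"


subsection \<open>Point processes\<close>

text \<open>A configuration is given by its multiplicity function \<open>c\<close>, so that multiple points are allowed.
  The pairs \<open>(x, k)\<close> with \<open>k < c x\<close> are the individual points at the location \<open>x\<close>.\<close>

definition points :: "('a \<Rightarrow> nat) \<Rightarrow> ('a \<times> nat) set" where
  "points c = {(x, k). k < c x}"

definition num_points :: "('a \<Rightarrow> nat) \<Rightarrow> 'a set \<Rightarrow> ennreal" where
  "num_points c A = emeasure (count_space UNIV) {p \<in> points c. fst p \<in> A}"

definition locally_finite_config :: "('a::topological_space \<Rightarrow> nat) \<Rightarrow> bool" where
  "locally_finite_config c \<longleftrightarrow> (\<forall>C. compact C \<longrightarrow> num_points c C < \<infinity>)"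

definition point_process :: "'w measure \<Rightarrow> ('w \<Rightarrow> 'a::topological_space \<Rightarrow> nat) \<Rightarrow> bool" where
  "point_process M \<Xi> \<longleftrightarrow>
     prob_space M \<and>
     (\<forall>\<omega>\<in>space M. locally_finite_config (\<Xi> \<omega>)) \<and>
     (\<forall>A\<in>sets borel. (\<lambda>\<omega>. num_points (\<Xi> \<omega>) A) \<in> borel_measurable M)"

text \<open>The number of ordered \<open>n\<close>-tuples of distinct points of a configuration
  whose tuple of locations lies in \<open>B\<close>.\<close>

definition num_tuples :: "nat \<Rightarrow> ('a \<Rightarrow> nat) \<Rightarrow> (nat \<Rightarrow> 'a) set \<Rightarrow> ennreal" where
  "num_tuples n c B =
     emeasure (count_space UNIV)
       {t \<in> {..<n} \<rightarrow>\<^sub>E points c. inj_on t {..<n} \<and> (\<lambda>i\<in>{..<n}. fst (t i)) \<in> B}"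

text \<open>The function \<open>\<rho>\<close> is a density of the \<open>n\<close>-th factorial moment measure.\<close>

definition is_intensity ::
    "'w measure \<Rightarrow> ('w \<Rightarrow> 'a \<Rightarrow> nat) \<Rightarrow> 'a measure \<Rightarrow> nat \<Rightarrow> ((nat \<Rightarrow> 'a) \<Rightarrow> real) \<Rightarrow> bool" where
  "is_intensity M \<Xi> \<mu> n \<rho> \<longleftrightarrow>
     \<rho> \<in> borel_measurable (\<Pi>\<^sub>M i\<in>{..<n}. \<mu>) \<and>
     (\<forall>x\<in>space (\<Pi>\<^sub>M i\<in>{..<n}. \<mu>). 0 \<le> \<rho> x) \<and>
     (\<forall>B\<in>sets (\<Pi>\<^sub>M i\<in>{..<n}. \<mu>).
        (\<integral>\<^sup>+\<omega>. num_tuples n (\<Xi> \<omega>) B \<partial>M) = (\<integral>\<^sup>+x\<in>B. ennreal (\<rho> x) \<partial>(\<Pi>\<^sub>M i\<in>{..<n}. \<mu>)))"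

text \<open>Intensity functions are only determined almost everywhere. The identity below also says that
  the determinants are real and non-negative almost everywhere.\<close>

definition determinantal ::
    "'w measure \<Rightarrow> ('w \<Rightarrow> 'a::topological_space \<Rightarrow> nat) \<Rightarrow> 'a measure \<Rightarrow> ('a \<Rightarrow> 'a \<Rightarrow> complex) \<Rightarrow> bool"
  where
  "determinantal M \<Xi> \<mu> K \<longleftrightarrow>
     point_process M \<Xi> \<and>
     (\<forall>n\<ge>1. \<exists>\<rho>. is_intensity M \<Xi> \<mu> n \<rho> \<and>
        (AE x in (\<Pi>\<^sub>M i\<in>{..<n}. \<mu>).
           complex_of_real (\<rho> x) = Determinant.det (Matrix.mat n n (\<lambda>(i, j). K (x i) (x j)))))"


subsection \<open>Negative association\<close>

text \<open>Thresholds are compared in the extended reals: \<open>ennreal\<close> would identify all negative thresholds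
  with 0.\<close>

definition negatively_associated :: "'w measure \<Rightarrow> ('w \<Rightarrow> ennreal) \<Rightarrow> ('w \<Rightarrow> ennreal) \<Rightarrow> bool" where
  "negatively_associated M X Y \<longleftrightarrow>
     (\<forall>r s :: real.
        measure M {\<omega> \<in> space M. enn2ereal (X \<omega>) > ereal r \<and> enn2ereal (Y \<omega>) > ereal s}
        \<le> measure M {\<omega> \<in> space M. enn2ereal (X \<omega>) > ereal r}
           * measure M {\<omega> \<in> space M. enn2ereal (Y \<omega>) > ereal s})"

end

theory Submission
  imports Defs
begin

text \<open>On a bounded set where \<open>K(x,x) \<le> k\<close> the law of the counts is a series in the factorial moments
  \<open>\<integral> det (K(x\<^sub>i,x\<^sub>j))\<close>, which passes to the limit under domination by Hadamard's bound. So the inequality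
  may be proved for step kernels, and these are limits of finite Hermitian matrices \<open>0 \<le> Q \<le> 1\<close>: split
  every cell of the step kernel into \<open>L\<close> points and let \<open>L\<close> tend to infinity. A matrix \<open>0 \<le> Q \<le> 1\<close> is a
  corner of a projection matrix, and the determinantal process of a projection is negatively
  associated by the argument of Feder and Mihail, because its total number of points is constant.
  Compact sets and the sets \<open>K(x,x) \<le> k\<close> exhaust the space.\<close>

subsection \<open>Principal minors and projection kernels\<close>

text \<open>The obstacle is the diagonal. An operator determines its kernel only up to null sets of
  the product space, and the diagonal may be one, while the intensity for n = 1 is K(x,x). Averaging
  K over cells therefore yields a matrix between 0 and 1 whose diagonal need not come from the
  averages of K(x,x). The latter are at least as large, because the intensity for n = 2 is
  non-negative; putting them in keeps the matrix non-negative but may push it above 1. Splitting a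
  cell into L points divides the excess by L, and a scalar factor that tends to 1 absorbs the rest.
  On finite sets the work is done with projections, because conditioning on the presence or the
  absence of a point maps projections to projections, so that an induction on the number of points
  can run. Moment sequences rather than laws are carried through the limits: the bound C^n on the
  factorial moments, with C the trace, and the bound 2^n on alternating sums make every series
  dominated by that of exp (2 C).\<close>

definition pminor :: "('i \<Rightarrow> 'i \<Rightarrow> 'a::comm_ring_1) \<Rightarrow> 'i list \<Rightarrow> 'a" where
  "pminor Q xs = Determinant.det (Matrix.mat (length xs) (length xs) (\<lambda>(i, j). Q (xs ! i) (xs ! j)))"

lemma pminor_cong:
  assumes "\<And>i j. i \<in> set xs \<Longrightarrow> j \<in> set xs \<Longrightarrow> Q i j = Q' i j"
  shows "pminor Q xs = pminor Q' xs"
  unfolding pminor_def using assms by (intro arg_cong[of _ _ Determinant.det] eq_matI) auto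

lemma pminor_Nil [simp]: "pminor Q [] = 1"
  by (simp add: pminor_def det_dim_zero)

text \<open>A simultaneous permutation of rows and columns contributes its sign twice. Lists serve
  as index sets so that adjoining a point is a Cons and no order on the index type has to be fixed;
  this lemma makes the choice of the list immaterial.\<close>

lemma pminor_perm:
  fixes Q :: "'i \<Rightarrow> 'i \<Rightarrow> 'a::idom"
  assumes "mset xs = mset ys"
  shows "pminor Q xs = pminor Q ys"
proof -
  define n where "n = length ys"
  obtain p where p: "p permutes {..<n}" and pl: "permute_list p ys = xs"
    using mset_eq_permutation[OF assms] unfolding n_def by auto
  have len: "length xs = n" using assms mset_eq_length n_def by blast
  have p0: "p permutes {0..<n}" using p by (simp add: lessThan_atLeast0)
  have xs: "xs ! i = ys ! p i" if "i < n" for i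
    using permute_list_nth[of p ys i] p pl that by (simp add: n_def)
  define A where "A = Matrix.mat n n (\<lambda>(i, j). Q (ys ! i) (ys ! j))"
  define B where "B = Matrix.mat n n (\<lambda>(i, j). A $$ (p i, j))"
  have A: "A \<in> carrier_mat n n" and B: "B \<in> carrier_mat n n" by (auto simp: A_def B_def)
  have pin: "p i < n" if "i < n" for i using permutes_in_image[OF p0, of i] that by simp
  \<comment> \<open>Permuting the rows of the transpose permutes the columns of
    \<open>B\<close>.\<close>
  define C where "C = Matrix.mat n n (\<lambda>(i, j). (transpose_mat B) $$ (p i, j))"
  have BT: "transpose_mat B \<in> carrier_mat n n" using B by simp
  have "Determinant.det B = signof p * Determinant.det A"
    unfolding B_def by (rule det_permute_rows[OF A p0])
  moreover have "Determinant.det C = signof p * Determinant.det B"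
    unfolding C_def using det_permute_rows[OF BT p0] det_transpose[OF B] by simp
  moreover have "transpose_mat C = Matrix.mat (length xs) (length xs) (\<lambda>(i, j). Q (xs ! i) (xs ! j))"
    using pin by (intro eq_matI) (auto simp: C_def B_def A_def xs len)
  moreover have "C \<in> carrier_mat n n" by (simp add: C_def)
  moreover have "signof p * signof p = (1::'a)"
    by (metis (mono_tags) signof_pm_one mult_1 mult_minus_left mult_minus_right minus_minus insertE singletonD)
  ultimately show ?thesis
    unfolding pminor_def using det_transpose[of C n] by (simp add: A_def n_def mult.assoc[symmetric])
qed

lemma pminor_Cons_block:
  "pminor Q (e # xs) = Determinant.det (four_block_mat (Matrix.mat 1 1 (\<lambda>_. Q e e))
      (Matrix.mat 1 (length xs) (\<lambda>(i, j). Q e (xs ! j)))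
      (Matrix.mat (length xs) 1 (\<lambda>(i, j). Q (xs ! i) e))
      (Matrix.mat (length xs) (length xs) (\<lambda>(i, j). Q (xs ! i) (xs ! j))))"
  unfolding pminor_def
  by (intro arg_cong[of _ _ Determinant.det] eq_matI) (auto simp: nth_Cons' )

text \<open>Block elimination: the matrix is a unit lower triangular block matrix times an upper
  triangular one whose diagonal blocks are the pivot and its Schur complement.\<close>

lemma pminor_schur:
  fixes Q :: "'i \<Rightarrow> 'i \<Rightarrow> 'a::field"
  assumes "Q e e \<noteq> 0"
  shows "pminor Q (e # xs) = Q e e * pminor (\<lambda>i j. Q i j - Q i e * Q e j / Q e e) xs"
proof -
  let ?n = "length xs"
  let ?q = "Q e e"
  define L where "L = four_block_mat (1\<^sub>m 1) (0\<^sub>m 1 ?n) (Matrix.mat ?n 1 (\<lambda>(i, j). Q (xs ! i) e / ?q)) (1\<^sub>m ?n)"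
  define U where "U = four_block_mat (Matrix.mat 1 1 (\<lambda>_. ?q)) (Matrix.mat 1 ?n (\<lambda>(i, j). Q e (xs ! j)))
     (0\<^sub>m ?n 1) (Matrix.mat ?n ?n (\<lambda>(i, j). Q (xs ! i) (xs ! j) - Q (xs ! i) e * Q e (xs ! j) / ?q))"
  have "Determinant.det (L * U) = Determinant.det L * Determinant.det U"
    by (rule det_mult[of _ "1 + ?n"]) (auto simp: L_def U_def)
  also have "Determinant.det L = 1"
    unfolding L_def by (subst det_four_block_mat_upper_right_zero[of _ 1 _ ?n]) auto
  also have "Determinant.det U = ?q * pminor (\<lambda>i j. Q i j - Q i e * Q e j / ?q) xs"
    unfolding U_def pminor_def
    by (subst det_four_block_mat_lower_left_zero[of _ 1 _ ?n]) (auto simp: det_single)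
  also have "L * U = four_block_mat (Matrix.mat 1 1 (\<lambda>_. Q e e))
      (Matrix.mat 1 (length xs) (\<lambda>(i, j). Q e (xs ! j)))
      (Matrix.mat (length xs) 1 (\<lambda>(i, j). Q (xs ! i) e))
      (Matrix.mat (length xs) (length xs) (\<lambda>(i, j). Q (xs ! i) (xs ! j)))"
    unfolding L_def U_def
    apply (subst mult_four_block_mat[of _ 1 1 _ ?n _ ?n _ _ 1 _ ?n])
    using assms by (auto simp: scalar_prod_def field_simps intro!: cong_four_block_mat eq_matI)
  finally show ?thesis by (simp add: pminor_Cons_block)
qed

text \<open>The determinant is affine in its corner entry: in the expansion along the first row only
  that entry changes, and the cofactors do not involve it. For c = 1 the right side is, up to sign,
  the probability that the points \<open>xs\<close> are present and \<open>e\<close> is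
  absent.\<close>

lemma pminor_corner:
  fixes Q :: "'i \<Rightarrow> 'i \<Rightarrow> 'a::comm_ring_1"
  assumes "e \<notin> set xs"
  shows "pminor (\<lambda>i j. if i = e \<and> j = e then Q e e - c else Q i j) (e # xs) = pminor Q (e # xs) - c * pminor Q xs"
proof -
  let ?n = "length (e # xs)"
  let ?Q = "\<lambda>i j. if i = e \<and> j = e then Q e e - c else Q i j"
  define A where "A = Matrix.mat ?n ?n (\<lambda>(i, j). Q ((e # xs) ! i) ((e # xs) ! j))"
  define B where "B = Matrix.mat ?n ?n (\<lambda>(i, j). ?Q ((e # xs) ! i) ((e # xs) ! j))"
  have A: "A \<in> carrier_mat ?n ?n" and B: "B \<in> carrier_mat ?n ?n" by (auto simp: A_def B_def)
  have ne: "xs ! i \<noteq> e" if "i < length xs" for i using assms that by auto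
  have del: "mat_delete B 0 j = mat_delete A 0 j" for j
    using ne by (intro eq_matI) (auto simp: mat_delete_def A_def B_def)
  have cof: "cofactor B 0 j = cofactor A 0 j" for j by (simp add: cofactor_def del)
  have "mat_delete A 0 0 = Matrix.mat (length xs) (length xs) (\<lambda>(i, j). Q (xs ! i) (xs ! j))"
    by (intro eq_matI) (auto simp: mat_delete_def A_def)
  hence c0: "cofactor A 0 0 = pminor Q xs" by (simp add: cofactor_def pminor_def)
  have entry: "B $$ (0, j) = A $$ (0, j) - (if j = 0 then c else 0)" if "j < ?n" for j
    using that ne by (cases j) (auto simp: A_def B_def)
  have "pminor ?Q (e # xs) = (\<Sum>j<?n. B $$ (0, j) * cofactor B 0 j)"
    unfolding pminor_def B_def[symmetric] by (rule laplace_expansion_row[OF B]) simp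
  also have "\<dots> = (\<Sum>j<?n. A $$ (0, j) * cofactor A 0 j - (if j = 0 then c * pminor Q xs else 0))"
    by (intro sum.cong refl) (auto simp: entry cof c0 algebra_simps)
  also have "\<dots> = (\<Sum>j<?n. A $$ (0, j) * cofactor A 0 j) - c * pminor Q xs"
    by (subst sum_subtractf) (simp add: sum.delta)
  also have "(\<Sum>j<?n. A $$ (0, j) * cofactor A 0 j) = pminor Q (e # xs)"
    unfolding pminor_def A_def[symmetric] by (rule laplace_expansion_row[OF A, symmetric]) simp
  finally show ?thesis .
qed

lemma pminor_zero_row:
  fixes Q :: "'i \<Rightarrow> 'i \<Rightarrow> 'a::comm_ring_1"
  assumes "\<And>j. j \<in> set (e # xs) \<Longrightarrow> Q e j = 0"
  shows "pminor Q (e # xs) = 0"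
proof -
  let ?n = "length (e # xs)"
  have "pminor Q (e # xs) = (\<Sum>j<?n. Matrix.mat ?n ?n (\<lambda>(i, j). Q ((e # xs) ! i) ((e # xs) ! j)) $$ (0, j)
     * cofactor (Matrix.mat ?n ?n (\<lambda>(i, j). Q ((e # xs) ! i) ((e # xs) ! j))) 0 j)"
    unfolding pminor_def by (rule laplace_expansion_row) auto
  also have "\<dots> = 0"
    by (intro sum.neutral) (use assms nth_mem[of _ "e # xs"] in auto)
  finally show ?thesis .
qed

lemma pminor_one: "pminor Q [e] = Q e e"
  unfolding pminor_def by (subst det_single) auto

lemma pminor_two: "pminor Q [e, f] = Q e e * Q f f - Q e f * Q f e"
  unfolding pminor_def by (subst laplace_expansion_row[of _ 2 0])
   (auto simp: numeral_2_eq_2 cofactor_def det_single mat_delete_def)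

section \<open>Projection kernels and conditioning on a single point\<close>

definition proj_kernel :: "'i set \<Rightarrow> ('i \<Rightarrow> 'i \<Rightarrow> complex) \<Rightarrow> bool" where
  "proj_kernel E Q \<longleftrightarrow> (\<forall>i\<in>E. \<forall>j\<in>E. Q j i = cnj (Q i j)) \<and>
     (\<forall>i\<in>E. \<forall>j\<in>E. (\<Sum>k\<in>E. Q i k * Q k j) = Q i j)"

text \<open>Kernel of the remaining points given the presence of \<open>e\<close>: its minor at
  \<open>xs\<close> is that of \<open>Q\<close> at \<open>e # xs\<close> divided by
  \<open>Q e e\<close>.\<close>

definition schur :: "('i \<Rightarrow> 'i \<Rightarrow> complex) \<Rightarrow> 'i \<Rightarrow> 'i \<Rightarrow> 'i \<Rightarrow> complex" where
  "schur Q e = (\<lambda>i j. Q i j - Q i e * Q e j / Q e e)"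

definition compl_kernel :: "('i \<Rightarrow> 'i \<Rightarrow> complex) \<Rightarrow> 'i \<Rightarrow> 'i \<Rightarrow> complex" where
  "compl_kernel Q = (\<lambda>i j. of_bool (i = j) - Q i j)"

text \<open>A probability law on the subsets of \<open>E\<close>: the empty list forces total mass
  1, and the other lists prescribe the inclusion probabilities.\<close>

definition dpp :: "'i set \<Rightarrow> ('i \<Rightarrow> 'i \<Rightarrow> complex) \<Rightarrow> ('i set \<Rightarrow> real) \<Rightarrow> bool" where
  "dpp E Q p \<longleftrightarrow> (\<forall>S\<subseteq>E. 0 \<le> p S) \<and>
     (\<forall>xs. distinct xs \<longrightarrow> set xs \<subseteq> E \<longrightarrow>
        complex_of_real (\<Sum>S | S \<subseteq> E \<and> set xs \<subseteq> S. p S) = pminor Q xs)"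

lemma proj_kernelD:
  assumes "proj_kernel E Q" "i \<in> E" "j \<in> E"
  shows "Q j i = cnj (Q i j)" "(\<Sum>k\<in>E. Q i k * Q k j) = Q i j"
  using assms unfolding proj_kernel_def by blast+

lemma proj_kernel_compl:
  assumes "finite E" "proj_kernel E Q"
  shows "proj_kernel E (compl_kernel Q)"
  unfolding proj_kernel_def
proof (intro conjI ballI)
  fix i j assume ij: "i \<in> E" "j \<in> E"
  show "compl_kernel Q j i = cnj (compl_kernel Q i j)"
    using proj_kernelD(1)[OF assms(2) ij] by (simp add: compl_kernel_def)
  have "(\<Sum>k\<in>E. compl_kernel Q i k * compl_kernel Q k j)
      = (\<Sum>k\<in>E. (if k = i then of_bool (k = j) else 0) - (if k = i then Q k j else 0)
           - (if k = j then Q i k else 0) + Q i k * Q k j)"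
    by (intro sum.cong refl) (auto simp: compl_kernel_def algebra_simps)
  also have "\<dots> = of_bool (i = j) - Q i j"
    using ij assms(1) proj_kernelD(2)[OF assms(2) ij] by (simp add: sum.distrib sum_subtractf)
  finally show "(\<Sum>k\<in>E. compl_kernel Q i k * compl_kernel Q k j) = compl_kernel Q i j"
    by (simp add: compl_kernel_def)
qed

text \<open>Column \<open>e\<close> of \<open>Q\<close> lies in the range of the projection and has
  squared norm \<open>Q e e\<close>, so the subtracted rank-one matrix is the projection onto its
  span. The difference projects onto the orthogonal complement of that column within the range; its
  row and column at \<open>e\<close> vanish, so restricting to \<open>F\<close> loses
  nothing.\<close>

lemma proj_kernel_schur:
  assumes "finite F" "e \<notin> F" "proj_kernel (insert e F) Q" "Q e e \<noteq> 0"
  shows "proj_kernel F (schur Q e)"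
  unfolding proj_kernel_def
proof (intro conjI ballI)
  fix i j assume ij: "i \<in> F" "j \<in> F"
  note h = proj_kernelD(1)[OF assms(3)] and s = proj_kernelD(2)[OF assms(3)]
  have "cnj (Q e e) = Q e e" using h[of e e] by simp
  thus "schur Q e j i = cnj (schur Q e i j)"
    using ij h[of i j] h[of i e] h[of e j] by (simp add: schur_def mult.commute)
  let ?q = "Q e e"
  have S: "(\<Sum>k\<in>F. Q a k * Q k b) = Q a b - Q a e * Q e b" if "a \<in> insert e F" "b \<in> insert e F" for a b
    using s[OF that] assms(1,2) by (simp add: algebra_simps)
  have "(\<Sum>k\<in>F. schur Q e i k * schur Q e k j)
     = (\<Sum>k\<in>F. Q i k * Q k j) - (\<Sum>k\<in>F. Q i k * Q k e) * Q e j / ?q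
       - Q i e / ?q * (\<Sum>k\<in>F. Q e k * Q k j) + Q i e * Q e j / ?q / ?q * (\<Sum>k\<in>F. Q e k * Q k e)"
    unfolding schur_def sum_distrib_left sum_distrib_right sum_divide_distrib sum_subtractf[symmetric] sum.distrib[symmetric]
    by (intro sum.cong refl) (simp add: algebra_simps add_divide_distrib diff_divide_distrib)
  also have "\<dots> = schur Q e i j"
  proof -
    have 1: "(\<Sum>k\<in>F. Q i k * Q k j) = Q i j - Q i e * Q e j"
      "(\<Sum>k\<in>F. Q i k * Q k e) = Q i e - Q i e * ?q"
      "(\<Sum>k\<in>F. Q e k * Q k j) = Q e j - ?q * Q e j"
      "(\<Sum>k\<in>F. Q e k * Q k e) = ?q - ?q * ?q"
      using ij by (auto intro!: S)
    show ?thesis unfolding 1 schur_def using assms(4) by (simp add: field_simps)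
  qed
  finally show "(\<Sum>k\<in>F. schur Q e i k * schur Q e k j) = schur Q e i j" .
qed

text \<open>Since \<open>1 - Q\<close> is the kernel of the complementary point set, conditioning on the absence of a
  point is conditioning on its presence there.\<close>

definition schur_out :: "('i \<Rightarrow> 'i \<Rightarrow> complex) \<Rightarrow> 'i \<Rightarrow> 'i \<Rightarrow> 'i \<Rightarrow> complex" where
  "schur_out Q e = compl_kernel (schur (compl_kernel Q) e)"

lemma proj_kernel_schur_out:
  assumes "finite F" "e \<notin> F" "proj_kernel (insert e F) Q" "Q e e \<noteq> 1"
  shows "proj_kernel F (schur_out Q e)"
  unfolding schur_out_def using assms
  by (intro proj_kernel_compl proj_kernel_schur) (auto simp: compl_kernel_def)

lemma schur_out_eq:
  assumes "i \<noteq> e" "j \<noteq> e"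
  shows "schur_out Q e i j = Q i j + Q i e * Q e j / (1 - Q e e)"
  using assms by (simp add: schur_out_def schur_def compl_kernel_def)

lemma pminor_schur':
  assumes "Q e e \<noteq> 0"
  shows "pminor Q (e # xs) = Q e e * pminor (schur Q e) xs"
  unfolding schur_def by (rule pminor_schur[where Q = Q and e = e, OF assms])

text \<open>By \<open>pminor_corner\<close> the left side is minus a minor whose corner entry is
  \<open>Q e e - 1\<close>; eliminating with this pivot produces \<open>schur_out\<close> on the
  other indices.\<close>

lemma pminor_schur_out:
  assumes "e \<notin> set xs" "Q e e \<noteq> 1"
  shows "pminor Q xs - pminor Q (e # xs) = (1 - Q e e) * pminor (schur_out Q e) xs"
proof -
  let ?Q = "\<lambda>i j. if i = e \<and> j = e then Q e e - 1 else Q i j"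
  have "pminor Q (e # xs) - pminor Q xs = pminor ?Q (e # xs)"
    using pminor_corner[OF assms(1), of Q 1] by simp
  also have "\<dots> = ?Q e e * pminor (schur ?Q e) xs" using assms by (intro pminor_schur') auto
  also have "pminor (schur ?Q e) xs = pminor (schur_out Q e) xs"
  proof (rule pminor_cong)
    fix i j assume "i \<in> set xs" "j \<in> set xs"
    hence "i \<noteq> e" "j \<noteq> e" using assms by auto
    thus "schur ?Q e i j = schur_out Q e i j" using assms(2)
      by (simp add: schur_out_eq schur_def divide_simps) (simp add: algebra_simps)
  qed
  finally show ?thesis by (simp add: algebra_simps)
qed

lemma proj_kernel_diag:
  assumes "finite E" "proj_kernel E Q" "e \<in> E"
  shows "Q e e = complex_of_real (\<Sum>f\<in>E. (cmod (Q e f))\<^sup>2)"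
proof -
  have "Q e e = (\<Sum>f\<in>E. Q e f * Q f e)" using proj_kernelD(2)[OF assms(2,3,3)] by simp
  also have "\<dots> = (\<Sum>f\<in>E. complex_of_real ((cmod (Q e f))\<^sup>2))"
    by (intro sum.cong refl) (metis assms(2,3) complex_norm_square proj_kernelD(1))
  finally show ?thesis by simp
qed

lemma proj_kernel_diag_bounds:
  assumes "finite E" "proj_kernel E Q" "e \<in> E"
  shows "0 \<le> Re (Q e e)" "Re (Q e e) \<le> 1" "complex_of_real (Re (Q e e)) = Q e e"
proof -
  let ?q = "\<Sum>f\<in>E. (cmod (Q e f))\<^sup>2"
  have q: "Q e e = complex_of_real ?q" using proj_kernel_diag[OF assms] .
  have q0: "0 \<le> ?q" by (intro sum_nonneg) auto
  have "(cmod (Q e e))\<^sup>2 \<le> ?q" using assms by (intro member_le_sum) auto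
  moreover have "cmod (Q e e) = ?q" by (metis abs_of_nonneg norm_of_real q q0)
  ultimately have "?q * ?q \<le> ?q" by (simp add: power2_eq_square)
  hence "?q \<le> 1" using q0 by (cases "?q = 0") (simp_all add: mult_le_cancel_right1 del: sum_nonneg_eq_0_iff)
  thus "0 \<le> Re (Q e e)" "Re (Q e e) \<le> 1" "complex_of_real (Re (Q e e)) = Q e e"
    using q q0 by (simp_all add: q)
qed

lemma proj_kernel_diag_zero:
  assumes "finite E" "proj_kernel E Q" "e \<in> E" "Q e e = 0" "f \<in> E"
  shows "Q e f = 0"
proof -
  have "(\<Sum>f\<in>E. (cmod (Q e f))\<^sup>2) = 0"
    using proj_kernel_diag[OF assms(1-3)] assms(4) of_real_eq_0_iff by metis
  thus ?thesis using assms by (subst (asm) sum_nonneg_eq_0_iff) auto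
qed

section \<open>Determinantal laws on a finite set: conditioning and existence\<close>

lemma sum_Pow_insert:
  fixes p :: "'i set \<Rightarrow> real"
  assumes "finite F" "e \<notin> F"
  shows "(\<Sum>S | S \<subseteq> insert e F \<and> P S. p S) =
     (\<Sum>S | S \<subseteq> F \<and> P (insert e S). p (insert e S)) + (\<Sum>S | S \<subseteq> F \<and> P S. p S)"
proof -
  have fin: "finite {S. S \<subseteq> F \<and> R S}" for R using assms(1) by simp
  have split: "{S. S \<subseteq> insert e F \<and> P S} = insert e ` {S. S \<subseteq> F \<and> P (insert e S)} \<union> {S. S \<subseteq> F \<and> P S}"
    (is "?L = ?A \<union> ?B")
  proof (rule Set.set_eqI, rule iffI)
    fix S assume S: "S \<in> ?L"
    show "S \<in> ?A \<union> ?B"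
    proof (cases "e \<in> S")
      case True
      hence "S = insert e (S - {e})" by auto
      thus ?thesis using S by (auto intro!: image_eqI[of _ _ "S - {e}"])
    next
      case False thus ?thesis using S by auto
    qed
  qed auto
  have "?A \<inter> ?B = {}" using assms(2) by auto
  moreover have "inj_on (insert e) {S. S \<subseteq> F \<and> P (insert e S)}"
    using assms(2) by (intro inj_onI) (auto simp: insert_ident)
  ultimately show ?thesis
    unfolding split by (subst sum.union_disjoint) (auto simp: fin sum.reindex)
qed

lemma dpp_nonneg: "dpp E Q p \<Longrightarrow> S \<subseteq> E \<Longrightarrow> 0 \<le> p S"
  unfolding dpp_def by blast

lemma dpp_sum:
  "dpp E Q p \<Longrightarrow> distinct xs \<Longrightarrow> set xs \<subseteq> E \<Longrightarrow>
    complex_of_real (\<Sum>S | S \<subseteq> E \<and> set xs \<subseteq> S. p S) = pminor Q xs"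
  unfolding dpp_def by blast

text \<open>The sets that contain \<open>e\<close> and \<open>xs\<close> have total weight
  \<open>pminor Q (e # xs)\<close>, which \<open>pminor_schur'\<close> factors; dividing by the
  probability \<open>q\<close> of \<open>e\<close> normalises.\<close>

lemma dpp_in:
  assumes "finite F" "e \<notin> F" "dpp (insert e F) Q p" "Q e e = complex_of_real q" "q > 0"
  shows "dpp F (schur Q e) (\<lambda>S. p (insert e S) / q)"
  unfolding dpp_def
proof (intro conjI allI impI)
  fix S assume "S \<subseteq> F"
  hence "insert e S \<subseteq> insert e F" by auto
  thus "0 \<le> p (insert e S) / q"
    using assms(5) dpp_nonneg[OF assms(3), of "insert e S"] by simp
next
  fix xs assume xs: "distinct xs" "set xs \<subseteq> F"
  have "complex_of_real (\<Sum>S | S \<subseteq> insert e F \<and> set (e # xs) \<subseteq> S. p S) = pminor Q (e # xs)"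
    using assms(2) xs by (intro dpp_sum[OF assms(3)]) auto
  moreover have "{S. S \<subseteq> F \<and> set (e # xs) \<subseteq> insert e S} = {S. S \<subseteq> F \<and> set xs \<subseteq> S}"
    using assms(2) xs(2) by auto
  moreover have "{S. S \<subseteq> F \<and> set (e # xs) \<subseteq> S} = {}" using assms(2) by auto
  ultimately have "complex_of_real (\<Sum>S | S \<subseteq> F \<and> set xs \<subseteq> S. p (insert e S)) = pminor Q (e # xs)"
    unfolding sum_Pow_insert[OF assms(1,2), where P = "\<lambda>S. set (e # xs) \<subseteq> S" and p = p]
    by (simp only: sum.empty add_0_right)
  also have "\<dots> = q * pminor (schur Q e) xs" using pminor_schur'[of Q e xs] assms(4,5) by simp
  finally show "complex_of_real (\<Sum>S | S \<subseteq> F \<and> set xs \<subseteq> S. p (insert e S) / q) = pminor (schur Q e) xs"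
    using assms(5) by (simp add: sum_divide_distrib[symmetric] divide_simps mult.commute)
qed

text \<open>The sets with \<open>xs\<close> but without \<open>e\<close> are obtained by subtracting
  those that contain \<open>e # xs\<close>, and \<open>pminor_schur_out\<close> factors this
  difference of minors.\<close>

lemma dpp_out:
  assumes "finite F" "e \<notin> F" "dpp (insert e F) Q p" "Q e e = complex_of_real q" "q < 1"
  shows "dpp F (schur_out Q e) (\<lambda>S. p S / (1 - q))"
  unfolding dpp_def
proof (intro conjI allI impI)
  fix S assume "S \<subseteq> F"
  hence "S \<subseteq> insert e F" by auto
  thus "0 \<le> p S / (1 - q)"
    using assms(5) dpp_nonneg[OF assms(3), of S] by simp
next
  fix xs assume xs: "distinct xs" "set xs \<subseteq> F"
  have e: "e \<notin> set xs" using assms(2) xs by auto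
  have 1: "complex_of_real (\<Sum>S | S \<subseteq> insert e F \<and> set (e # xs) \<subseteq> S. p S) = pminor Q (e # xs)"
    using assms(2) xs by (intro dpp_sum[OF assms(3)]) auto
  have 2: "complex_of_real (\<Sum>S | S \<subseteq> insert e F \<and> set xs \<subseteq> S. p S) = pminor Q xs"
    using xs by (intro dpp_sum[OF assms(3)]) auto
  have "{S. S \<subseteq> F \<and> set (e # xs) \<subseteq> insert e S} = {S. S \<subseteq> F \<and> set xs \<subseteq> S}"
     "{S. S \<subseteq> F \<and> set xs \<subseteq> insert e S} = {S. S \<subseteq> F \<and> set xs \<subseteq> S}"
     "{S. S \<subseteq> F \<and> set (e # xs) \<subseteq> S} = {}"
    using assms(2) xs(2) by auto
  hence "(\<Sum>S | S \<subseteq> F \<and> set xs \<subseteq> S. p S) = (\<Sum>S | S \<subseteq> insert e F \<and> set xs \<subseteq> S. p S)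
     - (\<Sum>S | S \<subseteq> insert e F \<and> set (e # xs) \<subseteq> S. p S)"
    unfolding sum_Pow_insert[OF assms(1,2), where P = "\<lambda>S. set (e # xs) \<subseteq> S" and p = p]
      sum_Pow_insert[OF assms(1,2), where P = "\<lambda>S. set xs \<subseteq> S" and p = p]
    by (simp only: sum.empty)
  hence "complex_of_real (\<Sum>S | S \<subseteq> F \<and> set xs \<subseteq> S. p S) = pminor Q xs - pminor Q (e # xs)"
    using 1 2 by simp
  also have "\<dots> = (1 - complex_of_real q) * pminor (schur_out Q e) xs"
    using pminor_schur_out[OF e, of Q] assms(4,5) by simp
  finally show "complex_of_real (\<Sum>S | S \<subseteq> F \<and> set xs \<subseteq> S. p S / (1 - q)) = pminor (schur_out Q e) xs"
    using assms(5) by (simp add: sum_divide_distrib[symmetric] divide_simps mult.commute)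
qed

text \<open>The law is built point by point: \<open>e\<close> is put in with probability
  \<open>Q e e\<close>, and the rest is drawn from the law of the matching conditional kernel.
  Projection kernels are closed under both conditionings, so the induction goes through.\<close>

lemma dpp_exists:
  assumes "finite E" "proj_kernel E Q"
  shows "\<exists>p. dpp E Q p"
  using assms
proof (induction E arbitrary: Q rule: finite_induct)
  case empty
  have "dpp {} Q (\<lambda>_. 1)" by (auto simp: dpp_def)
  thus ?case by blast
next
  case (insert e F)
  define q where "q = Re (Q e e)"
  have q: "0 \<le> q" "q \<le> 1" "Q e e = complex_of_real q"
    using proj_kernel_diag_bounds[OF _ insert.prems, of e] insert.hyps by (auto simp: q_def)
  \<comment> \<open>For q = 0 there is no conditional law; \<open>p1\<close> is then arbitrary, and
    the factor q in \<open>p\<close> removes it. The same holds for \<open>p2\<close> when q =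
    1.\<close>
  have "\<exists>p1. q \<noteq> 0 \<longrightarrow> dpp F (schur Q e) p1"
    using insert.IH[of "schur Q e"] proj_kernel_schur[OF insert.hyps insert.prems] q by auto
  then obtain p1 where p1: "q \<noteq> 0 \<longrightarrow> dpp F (schur Q e) p1" by blast
  have "\<exists>p2. q \<noteq> 1 \<longrightarrow> dpp F (schur_out Q e) p2"
    using insert.IH[of "schur_out Q e"] proj_kernel_schur_out[OF insert.hyps insert.prems] q by auto
  then obtain p2 where p2: "q \<noteq> 1 \<longrightarrow> dpp F (schur_out Q e) p2" by blast
  define p where "p S = (if e \<in> S then q * p1 (S - {e}) else (1 - q) * p2 S)" for S
  have pin: "p (Set.insert e S) = q * p1 S" and pout: "p S = (1 - q) * p2 S" if "S \<subseteq> F" for S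
  proof -
    have "e \<notin> S" using that insert.hyps(2) by auto
    thus "p (Set.insert e S) = q * p1 S" "p S = (1 - q) * p2 S" by (auto simp: p_def)
  qed
  have 1: "complex_of_real (q * (\<Sum>S | S \<subseteq> F \<and> set xs \<subseteq> S. p1 S)) = pminor Q (e # xs)"
    if xs: "distinct xs" "set xs \<subseteq> F" for xs
  proof (cases "q = 0")
    case True
    have "pminor Q (e # xs) = 0"
      using proj_kernel_diag_zero[OF _ insert.prems, of e] insert.hyps True q xs
      by (intro pminor_zero_row) auto
    thus ?thesis using True by simp
  next
    case False
    thus ?thesis using p1 xs pminor_schur'[of Q e xs] q(3) by (simp add: dpp_def)
  qed
  have 2: "complex_of_real ((1 - q) * (\<Sum>S | S \<subseteq> F \<and> set xs \<subseteq> S. p2 S)) = pminor Q xs - pminor Q (e # xs)"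
    if xs: "distinct xs" "set xs \<subseteq> F" for xs
  proof (cases "q = 1")
    case True
    have e: "e \<notin> set xs" using xs insert.hyps by auto
    \<comment> \<open>An almost sure point has a vanishing row in the complementary projection, so
      the difference of the minors is the determinant of a matrix with a zero row.\<close>
    have z: "compl_kernel Q e j = 0" if "j \<in> Set.insert e F" for j
      using proj_kernel_diag_zero[OF _ proj_kernel_compl[OF _ insert.prems], of e j] insert.hyps True q that
      by (simp add: compl_kernel_def)
    have "pminor Q (e # xs) - pminor Q xs = pminor (\<lambda>i j. if i = e \<and> j = e then Q e e - 1 else Q i j) (e # xs)"
      using pminor_corner[OF e, of Q 1] by simp
    also have "\<dots> = 0" using z q True xs e by (intro pminor_zero_row) (force simp: compl_kernel_def)
    finally show ?thesis using True by simp
  next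
    case False
    have e: "e \<notin> set xs" using xs insert.hyps by auto
    thus ?thesis using p2 xs pminor_schur_out[OF e, of Q] q(3) False by (simp add: dpp_def)
  qed
  have "dpp (Set.insert e F) Q p"
    unfolding dpp_def
  proof (intro conjI allI impI)
    fix S assume "S \<subseteq> Set.insert e F"
    hence "S - {e} \<subseteq> F" "e \<notin> S \<Longrightarrow> S \<subseteq> F" by auto
    thus "0 \<le> p S"
      using p1 p2 q by (cases "q = 0"; cases "q = 1") (auto simp: p_def dpp_def intro!: mult_nonneg_nonneg)
  next
    fix xs assume xs: "distinct xs" "set xs \<subseteq> Set.insert e F"
    show "complex_of_real (\<Sum>S | S \<subseteq> Set.insert e F \<and> set xs \<subseteq> S. p S) = pminor Q xs"
    proof (cases "e \<in> set xs")
      case True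
      define ys where "ys = remove1 e xs"
      have ys: "distinct ys" "set ys \<subseteq> F" "mset xs = mset (e # ys)"
        using xs True by (auto simp: ys_def)
      have "set xs = Set.insert e (set ys)" using ys(3) by (metis list.set(2) set_mset_mset)
      hence *: "{S. S \<subseteq> F \<and> set xs \<subseteq> Set.insert e S} = {S. S \<subseteq> F \<and> set ys \<subseteq> S}"
        "{S. S \<subseteq> F \<and> set xs \<subseteq> S} = {}"
        using insert.hyps(2) ys(2) by auto
      have "(\<Sum>S | S \<subseteq> Set.insert e F \<and> set xs \<subseteq> S. p S) = (\<Sum>S | S \<subseteq> F \<and> set ys \<subseteq> S. q * p1 S)"
        unfolding sum_Pow_insert[OF insert.hyps(1,2)] * by (auto simp: pin intro!: sum.cong)
      also have "complex_of_real \<dots> = pminor Q (e # ys)"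
        using 1[OF ys(1,2)] by (simp add: sum_distrib_left)
      finally show ?thesis using pminor_perm[OF ys(3), of Q] by simp
    next
      case False
      hence xs': "set xs \<subseteq> F" using xs by auto
      have *: "{S. S \<subseteq> F \<and> set xs \<subseteq> Set.insert e S} = {S. S \<subseteq> F \<and> set xs \<subseteq> S}"
        using insert.hyps(2) xs' by auto
      have "(\<Sum>S | S \<subseteq> Set.insert e F \<and> set xs \<subseteq> S. p S) =
          q * (\<Sum>S | S \<subseteq> F \<and> set xs \<subseteq> S. p1 S) + (1 - q) * (\<Sum>S | S \<subseteq> F \<and> set xs \<subseteq> S. p2 S)"
        unfolding sum_Pow_insert[OF insert.hyps(1,2)] * sum_distrib_left
        by (intro arg_cong2[of _ _ _ _ "(+)"] sum.cong refl) (auto simp: pin pout)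
      thus ?thesis using 1[OF xs(1) xs'] 2[OF xs(1) xs'] by simp
    qed
  qed
  thus ?case by blast
qed

subsection \<open>Negative association for projection kernels\<close>

definition expect :: "'i set \<Rightarrow> ('i set \<Rightarrow> real) \<Rightarrow> ('i set \<Rightarrow> real) \<Rightarrow> real" where
  "expect E p g = (\<Sum>S\<in>Pow E. p S * g S)"

definition increasing_on :: "'i set \<Rightarrow> ('i set \<Rightarrow> real) \<Rightarrow> bool" where
  "increasing_on E g \<longleftrightarrow> (\<forall>S T. S \<subseteq> T \<longrightarrow> T \<subseteq> E \<longrightarrow> g S \<le> g T)"

lemma increasing_onD: "increasing_on E g \<Longrightarrow> S \<subseteq> T \<Longrightarrow> T \<subseteq> E \<Longrightarrow> g S \<le> g T"
  unfolding increasing_on_def by blast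

lemma increasing_on_subset: "increasing_on E g \<Longrightarrow> F \<subseteq> E \<Longrightarrow> increasing_on F g"
  unfolding increasing_on_def by (meson order_trans)

lemma expect_insert:
  assumes "finite F" "e \<notin> F"
  shows "expect (insert e F) p g = expect F (\<lambda>S. p (insert e S)) (\<lambda>S. g (insert e S)) + expect F p g"
  using sum_Pow_insert[OF assms, where P = "\<lambda>_. True" and p = "\<lambda>S. p S * g S"]
  unfolding expect_def Pow_def by simp

lemma expect_cong: "(\<And>S. S \<subseteq> E \<Longrightarrow> p S = p' S) \<Longrightarrow> (\<And>S. S \<subseteq> E \<Longrightarrow> g S = g' S) \<Longrightarrow> expect E p g = expect E p' g'"
  unfolding expect_def by (intro sum.cong) auto

lemma expect_zero: "(\<And>S. S \<subseteq> E \<Longrightarrow> g S = 0) \<Longrightarrow> expect E p g = 0"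
  unfolding expect_def by (intro sum.neutral) auto

lemma expect_divide: "expect E (\<lambda>S. p S / c) g = expect E p g / c"
  unfolding expect_def by (simp add: sum_divide_distrib)

lemma expect_add: "expect E p (\<lambda>S. g S + h S) = expect E p g + expect E p h"
  unfolding expect_def by (simp add: algebra_simps sum.distrib)

lemma expect_cmult: "expect E p (\<lambda>S. c * g S) = c * expect E p g"
  unfolding expect_def by (simp add: algebra_simps sum_distrib_left)

lemma expect_sum: "finite I \<Longrightarrow> expect E p (\<lambda>S. \<Sum>i\<in>I. g i S) = (\<Sum>i\<in>I. expect E p (g i))"
  unfolding expect_def sum_distrib_left by (rule sum.swap)

lemma dpp_expect:
  assumes "finite E" "dpp E Q p" "distinct xs" "set xs \<subseteq> E"
  shows "complex_of_real (expect E p (\<lambda>S. of_bool (set xs \<subseteq> S))) = pminor Q xs"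
proof -
  have "expect E p (\<lambda>S. of_bool (set xs \<subseteq> S)) = (\<Sum>S\<in>Pow E. if set xs \<subseteq> S then p S else 0)"
    unfolding expect_def by (intro sum.cong) auto
  also have "\<dots> = (\<Sum>S | S \<subseteq> E \<and> set xs \<subseteq> S. p S)"
    using assms(1) by (subst sum.inter_filter[symmetric]) (auto simp: Pow_def)
  finally show ?thesis using dpp_sum[OF assms(2-4)] by simp
qed

lemma expect_zero_weight:
  assumes "finite E" "\<And>S. S \<subseteq> E \<Longrightarrow> 0 \<le> p S" "expect E p (\<lambda>_. 1) = 0"
  shows "expect E p g = 0"
proof -
  have "\<forall>S\<in>Pow E. p S = 0"
    using assms by (subst sum_nonneg_eq_0_iff[symmetric]) (auto simp: expect_def)
  thus ?thesis unfolding expect_def by simp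
qed

lemma dpp_total:
  assumes "finite E" "dpp E Q p"
  shows "expect E p (\<lambda>_. 1) = 1"
  using dpp_expect[OF assms, of "[]"] by simp

lemma dpp_single:
  assumes "finite E" "dpp E Q p" "e \<in> E"
  shows "complex_of_real (expect E p (\<lambda>S. of_bool (e \<in> S))) = Q e e"
  using dpp_expect[OF assms(1,2), of "[e]"] assms(3) by (simp add: pminor_one)

lemma dpp_pair:
  assumes "finite E" "dpp E Q p" "proj_kernel E Q" "e \<in> E" "f \<in> E" "e \<noteq> f"
  shows "expect E p (\<lambda>S. of_bool (e \<in> S) * of_bool (f \<in> S)) =
    expect E p (\<lambda>S. of_bool (e \<in> S)) * expect E p (\<lambda>S. of_bool (f \<in> S)) - (cmod (Q e f))\<^sup>2"
proof -
  have "complex_of_real (expect E p (\<lambda>S. of_bool (e \<in> S) * of_bool (f \<in> S))) = pminor Q [e, f]"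
    using dpp_expect[OF assms(1,2), of "[e, f]"] assms(4-6) by (simp add: of_bool_conj)
  also have "\<dots> = Q e e * Q f f - Q e f * Q f e" by (rule pminor_two)
  also have "Q f e = cnj (Q e f)" using assms proj_kernelD(1) by metis
  also have "Q e f * cnj (Q e f) = complex_of_real ((cmod (Q e f))\<^sup>2)" by (metis complex_norm_square)
  also have "Q e e * Q f f - complex_of_real ((cmod (Q e f))\<^sup>2) = complex_of_real
     (expect E p (\<lambda>S. of_bool (e \<in> S)) * expect E p (\<lambda>S. of_bool (f \<in> S)) - (cmod (Q e f))\<^sup>2)"
    using dpp_single[OF assms(1,2,4)] dpp_single[OF assms(1,2,5)] by simp
  finally show ?thesis using of_real_eq_iff by blast
qed

text \<open>A projection process has a constant number of points, since the variance of this number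
  is the trace of \<open>Q - Q\<^sup>2\<close>.\<close>

lemma proj_dpp_sum_cov:
  assumes "finite E" "dpp E Q p" "proj_kernel E Q"
  shows "(\<Sum>f\<in>E. expect E p (\<lambda>S. of_bool (f \<in> S) * g S)
     - expect E p (\<lambda>S. of_bool (f \<in> S)) * expect E p g) = 0"
proof -
  define P where "P f = expect E p (\<lambda>S. of_bool (f \<in> S))" for f
  define r where "r = (\<Sum>f\<in>E. P f)"
  define c where "c S = (\<Sum>f\<in>E. of_bool (f \<in> S) :: real)" for S
  have Q: "complex_of_real (P f) = Q f f" if "f \<in> E" for f
    unfolding P_def by (rule dpp_single[OF assms(1,2) that])
  \<comment> \<open>By \<open>dpp_pair\<close> the covariance of \<open>e\<close> with another point
    \<open>f\<close> is minus the squared modulus of \<open>Q e f\<close>. These squares, including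
    the one at \<open>e\<close>, add up to \<open>Q e e\<close>, so the negative covariances cancel
    the variance of \<open>e\<close>.\<close>
  have row: "(\<Sum>f\<in>E. expect E p (\<lambda>S. of_bool (e \<in> S) * of_bool (f \<in> S))) = P e * r" if e: "e \<in> E" for e
  proof -
    have "P e = (\<Sum>f\<in>E. (cmod (Q e f))\<^sup>2)"
      using proj_kernel_diag[OF assms(1,3) e] Q[OF e] of_real_eq_iff by metis
    also have "\<dots> = (cmod (Q e e))\<^sup>2 + (\<Sum>f\<in>E - {e}. (cmod (Q e f))\<^sup>2)"
      using assms(1) e by (simp add: sum.remove)
    also have "(cmod (Q e e))\<^sup>2 = P e * P e" using Q[OF e, symmetric] by (simp add: power2_eq_square)
    finally have 1: "P e = P e * P e + (\<Sum>f\<in>E - {e}. (cmod (Q e f))\<^sup>2)" .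
    have "(\<Sum>f\<in>E. expect E p (\<lambda>S. of_bool (e \<in> S) * of_bool (f \<in> S)))
       = P e + (\<Sum>f\<in>E - {e}. expect E p (\<lambda>S. of_bool (e \<in> S) * of_bool (f \<in> S)))"
      using assms(1) e by (subst sum.remove[of E e]) (auto simp: P_def of_bool_conj[symmetric])
    also have "(\<Sum>f\<in>E - {e}. expect E p (\<lambda>S. of_bool (e \<in> S) * of_bool (f \<in> S)))
       = (\<Sum>f\<in>E - {e}. P e * P f - (cmod (Q e f))\<^sup>2)"
      unfolding P_def using e by (intro sum.cong refl dpp_pair[OF assms]) auto
    also have "\<dots> = P e * (\<Sum>f\<in>E - {e}. P f) - (\<Sum>f\<in>E - {e}. (cmod (Q e f))\<^sup>2)"
      by (simp add: sum_subtractf sum_distrib_left)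
    also have "(\<Sum>f\<in>E - {e}. P f) = r - P e" unfolding r_def using assms(1) e by (simp add: sum.remove)
    finally show ?thesis using 1 by (simp add: algebra_simps)
  qed
  have Ec: "expect E p c = r" unfolding c_def r_def P_def by (rule expect_sum[OF assms(1)])
  have "expect E p (\<lambda>S. c S * c S) = (\<Sum>e\<in>E. \<Sum>f\<in>E. expect E p (\<lambda>S. of_bool (e \<in> S) * of_bool (f \<in> S)))"
    unfolding c_def sum_product by (simp only: expect_sum[OF assms(1)])
  also have "\<dots> = r * r" by (simp add: row r_def sum_distrib_right cong: sum.cong)
  finally have Ecc: "expect E p (\<lambda>S. c S * c S) = r * r" .
  \<comment> \<open>A vanishing variance forces \<open>c S = r\<close> on every set of positive
    weight, so the constant may replace \<open>c\<close> in the expectation with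
    \<open>g\<close>.\<close>
  have "expect E p (\<lambda>S. (c S - r)\<^sup>2) = expect E p (\<lambda>S. c S * c S + ((- 2 * r) * c S + (r * r) * 1))"
    by (intro expect_cong refl) (simp add: power2_eq_square algebra_simps)
  also have "\<dots> = 0"
    unfolding expect_add expect_cmult Ecc Ec dpp_total[OF assms(1,2)] by simp
  finally have "(\<Sum>S\<in>Pow E. p S * (c S - r)\<^sup>2) = 0" unfolding expect_def .
  hence z: "\<forall>S\<in>Pow E. p S * (c S - r)\<^sup>2 = 0"
    using assms(1) dpp_nonneg[OF assms(2)] by (subst (asm) sum_nonneg_eq_0_iff) auto
  have "(\<Sum>f\<in>E. expect E p (\<lambda>S. of_bool (f \<in> S) * g S)) = expect E p (\<lambda>S. c S * g S)"
    unfolding c_def sum_distrib_right by (rule expect_sum[OF assms(1), symmetric])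
  also have "\<dots> = expect E p (\<lambda>S. r * g S)"
    unfolding expect_def using z by (intro sum.cong refl) auto
  also have "\<dots> = r * expect E p g" by (rule expect_cmult)
  finally show ?thesis by (simp add: sum_subtractf sum_distrib_right[symmetric] r_def P_def)
qed

lemma rescale_product_le:
  fixes c :: real
  assumes "0 < c" "x / c \<le> y / c * (z / c)"
  shows "c * x \<le> y * z"
  using assms by (simp add: field_simps)

text \<open>In the application a, b, c, d are the probabilities that the random set meets a pair of
  points e, f in {e, f}, {e}, {f}, {}, and the X integrate \<open>g\<close> over these events. The
  hypotheses say that e and f are negatively correlated, that e lowers the mean of \<open>g\<close>
  both with f and without f, and that f raises it in the presence of e; the conclusion is that e
  lowers the mean of \<open>g\<close>.\<close>

lemma four_cell_inequality:
  fixes a b c d :: real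
  assumes "0 < a" "0 \<le> b" "0 \<le> c" "0 \<le> d" "a + b + c + d = 1" "a \<le> (a + b) * (a + c)"
    and "c * Xa \<le> a * Xc" "d * Xb \<le> b * Xd" "a * Xb \<le> b * Xa"
    and "b = 0 \<Longrightarrow> Xb = 0" "d = 0 \<Longrightarrow> Xd = 0"
  shows "Xa + Xb \<le> (a + b) * (Xa + Xb + Xc + Xd)"
proof -
  have "a * 1 \<le> (a + b) * (a + c)" using assms by simp
  \<comment> \<open>Since the weights add up to 1, the hypothesis on \<open>a\<close> expands to
    this two-by-two determinant inequality.\<close>
  hence ad: "a * d \<le> b * c" unfolding assms(5)[symmetric] by (simp add: algebra_simps)
  have goal: "(c + d) * (Xa + Xb) \<le> (a + b) * (Xc + Xd) \<Longrightarrow> ?thesis"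
  proof -
    assume h: "(c + d) * (Xa + Xb) \<le> (a + b) * (Xc + Xd)"
    have "Xa + Xb = (a + b + c + d) * (Xa + Xb)" using assms(5) by simp
    also have "\<dots> \<le> (a + b) * (Xa + Xb + Xc + Xd)" using h by (simp add: algebra_simps)
    finally show ?thesis .
  qed
  show ?thesis
  proof (rule goal, cases "b = 0")
    case True
    hence "a * d \<le> 0" using ad by simp
    hence "d = 0" using assms(1,4) by (simp add: mult_le_0_iff)
    thus "(c + d) * (Xa + Xb) \<le> (a + b) * (Xc + Xd)" using True assms by simp
  next
    case False
    hence b: "b > 0" using assms by simp
    \<comment> \<open>Adding the two inequalities below leaves exactly this product as the surplus
      over the claim.\<close>
    have "0 \<le> (b * c - a * d) * (b * Xa - a * Xb)" using ad assms by simp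
    moreover have "(a + b) * b * (c * Xa) \<le> (a + b) * b * (a * Xc)"
      using assms b by (intro mult_left_mono) auto
    moreover have "(a + b) * a * (d * Xb) \<le> (a + b) * a * (b * Xd)"
      using assms b by (intro mult_left_mono) auto
    ultimately have "(a * b) * ((c + d) * (Xa + Xb)) \<le> (a * b) * ((a + b) * (Xc + Xd))"
      by (simp add: algebra_simps)
    thus "(c + d) * (Xa + Xb) \<le> (a + b) * (Xc + Xd)"
      using assms(1) b by (simp add: mult_le_cancel_left)
  qed
qed

text \<open>Given the presence of \<open>e\<close>, the covariances of \<open>g\<close> with the remaining points sum up to 0, so some
  point \<open>f\<close> has a non-negative one. By induction the claim holds given \<open>f\<close> and given its absence, and
  the four cells cut out by \<open>e\<close> and \<open>f\<close> recombine (Feder and Mihail).\<close>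

lemma proj_dpp_neg_cov:
  assumes "finite E" "dpp E Q p" "proj_kernel E Q" "increasing_on E g" "e \<in> E"
    and "\<And>S. S \<subseteq> E \<Longrightarrow> g S = g (S - {e})"
  shows "expect E p (\<lambda>S. of_bool (e \<in> S) * g S) \<le> expect E p (\<lambda>S. of_bool (e \<in> S)) * expect E p g"
  using assms
proof (induction "card E" arbitrary: E Q p g rule: less_induct)
  case less
  define F where "F = E - {e}"
  have F: "finite F" "e \<notin> F" "E = insert e F" using less.prems by (auto simp: F_def)
  define q where "q = expect E p (\<lambda>S. of_bool (e \<in> S))"
  have q: "complex_of_real q = Q e e" unfolding q_def by (rule dpp_single[OF less.prems(1,2,5)])
  define pe where "pe S = p (insert e S)" for S
  have gF: "g (insert e S) = g S" if "S \<subseteq> F" for S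
  proof -
    have "insert e S \<subseteq> E" "insert e S - {e} = S" using that F(2,3) by auto
    thus ?thesis using less.prems(6)[of "insert e S"] by simp
  qed
  have nn: "0 \<le> p S" if "S \<subseteq> E" for S using dpp_nonneg[OF less.prems(2) that] .
  have notin: "e \<notin> S" if "S \<subseteq> F" for S using that F(2) by auto
  have q_F: "q = expect F pe (\<lambda>_. 1)"
    unfolding q_def F(3) expect_insert[OF F(1,2)] pe_def using notin
    by (simp add: expect_zero cong: expect_cong)
  have g_F: "expect E p (\<lambda>S. of_bool (e \<in> S) * g S) = expect F pe g"
    unfolding F(3) expect_insert[OF F(1,2)] pe_def using notin gF
    by (simp add: expect_zero cong: expect_cong)
  have pe_nn: "0 \<le> pe S" if "S \<subseteq> F" for S unfolding pe_def using that F(3) by (intro nn) auto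
  have q0: "0 \<le> q" unfolding q_F expect_def using pe_nn by (intro sum_nonneg) auto
  show ?case
  proof (cases "q = 0")
    case True
    hence "expect F pe g = 0" using expect_zero_weight[OF F(1) pe_nn] q_F by simp
    thus ?thesis unfolding g_F using True by (simp add: q_def)
  next
    case False
    hence qpos: "0 < q" using q0 by simp
    have d1: "dpp F (schur Q e) (\<lambda>S. pe S / q)"
      unfolding pe_def using dpp_in[OF F(1,2)] less.prems(2) q qpos F(3) by metis
    have k1: "proj_kernel F (schur Q e)"
      using proj_kernel_schur[OF F(1,2)] less.prems(3) q False F(3) by (metis of_real_eq_0_iff)
    \<comment> \<open>The covariance of \<open>f\<close> and \<open>g\<close> given
      \<open>e\<close>, times the square of \<open>q\<close>: the weights \<open>pe\<close> are not
      normalised and have total mass \<open>q\<close>.\<close>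
    define cv where "cv f = q * expect F pe (\<lambda>S. of_bool (f \<in> S) * g S) - expect F pe (\<lambda>S. of_bool (f \<in> S)) * expect F pe g" for f
    have "(\<Sum>f\<in>F. expect F pe (\<lambda>S. of_bool (f \<in> S) * g S) / q - expect F pe (\<lambda>S. of_bool (f \<in> S)) / q * (expect F pe g / q)) = 0"
      using proj_dpp_sum_cov[OF F(1) d1 k1, of g] unfolding expect_divide .
    also have "(\<Sum>f\<in>F. expect F pe (\<lambda>S. of_bool (f \<in> S) * g S) / q - expect F pe (\<lambda>S. of_bool (f \<in> S)) / q * (expect F pe g / q))
       = (\<Sum>f\<in>F. cv f) / (q * q)"
      unfolding sum_divide_distrib cv_def using qpos by (intro sum.cong refl) (simp add: field_simps)
    finally have cv0: "(\<Sum>f\<in>F. cv f) = 0" using qpos by simp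
    have Pf_nn: "0 \<le> expect F pe (\<lambda>S. of_bool (f \<in> S))" for f
      unfolding expect_def using pe_nn by (intro sum_nonneg) auto
    show ?thesis
    proof (cases "\<exists>f\<in>F. 0 < expect F pe (\<lambda>S. of_bool (f \<in> S))")
      \<comment> \<open>Given \<open>e\<close>, no other point occurs, so the conditional mean of
        \<open>g\<close> is its least value \<open>g {}\<close>.\<close>
      case False
      hence z: "expect F pe (\<lambda>S. of_bool (f \<in> S)) = 0" if "f \<in> F" for f
        using Pf_nn[of f] False that by force
      have pz: "pe S = 0" if sub: "S \<subseteq> F" and ne: "S \<noteq> {}" for S
      proof -
        obtain f where f: "f \<in> S" using ne by blast
        have "(\<Sum>S\<in>Pow F. pe S * of_bool (f \<in> S)) = 0" using z[of f] f sub unfolding expect_def by auto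
        hence "\<forall>S\<in>Pow F. pe S * of_bool (f \<in> S) = 0"
          using F(1) pe_nn by (subst (asm) sum_nonneg_eq_0_iff) auto
        thus ?thesis using f sub by auto
      qed
      have "expect F pe g = expect F pe (\<lambda>_. g {} * 1)" unfolding expect_def
      proof (intro sum.cong refl)
        fix S assume "S \<in> Pow F"
        thus "pe S * g S = pe S * (g {} * 1)" using pz[of S] by (cases "S = {}") auto
      qed
      also have "\<dots> = q * g {}" unfolding expect_cmult q_F by simp
      also have "g {} = expect E p (\<lambda>_. g {} * 1)" unfolding expect_cmult dpp_total[OF less.prems(1,2)] by simp
      also have "q * expect E p (\<lambda>_. g {} * 1) \<le> q * expect E p g"
        unfolding expect_def using nn increasing_onD[OF less.prems(4)] q0
        by (intro mult_left_mono sum_mono) auto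
      finally show ?thesis unfolding g_F by (simp add: q_def)
    next
      case True
      \<comment> \<open>A point of conditional probability zero has \<open>cv f = 0\<close>. If
        \<open>cv\<close> were negative at all points that do occur, the sum could not
        vanish.\<close>
      have "\<exists>f\<in>F. 0 < expect F pe (\<lambda>S. of_bool (f \<in> S)) \<and> 0 \<le> cv f"
      proof (rule ccontr)
        assume "\<not> ?thesis"
        hence neg: "0 < expect F pe (\<lambda>S. of_bool (f \<in> S)) \<Longrightarrow> cv f < 0" if "f \<in> F" for f using that by force
        have le: "cv f \<le> 0" if f: "f \<in> F" for f
        proof (cases "0 < expect F pe (\<lambda>S. of_bool (f \<in> S))")
          case False
          hence "expect F pe (\<lambda>S. of_bool (f \<in> S)) = 0" using Pf_nn[of f] by simp
          hence "(\<Sum>S\<in>Pow F. pe S * of_bool (f \<in> S)) = 0" unfolding expect_def .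
          hence "\<forall>S\<in>Pow F. pe S * of_bool (f \<in> S) = 0"
            using F(1) pe_nn by (subst (asm) sum_nonneg_eq_0_iff) auto
          hence "expect F pe (\<lambda>S. of_bool (f \<in> S) * g S) = 0"
            unfolding expect_def by (intro sum.neutral) auto
          thus ?thesis using \<open>expect F pe (\<lambda>S. of_bool (f \<in> S)) = 0\<close> by (simp add: cv_def)
        qed (use neg[OF f] in auto)
        obtain f where f: "f \<in> F" "cv f < 0" using True neg by auto
        have "(\<Sum>f\<in>F. cv f) < (\<Sum>f\<in>F. 0)" using F(1) le f by (intro sum_strict_mono_ex1) auto
        thus False using cv0 by simp
      qed
      then obtain f where f: "f \<in> F" "0 < expect F pe (\<lambda>S. of_bool (f \<in> S))" "0 \<le> cv f" by blast
      define G where "G = F - {f}"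
      have G: "finite G" "f \<notin> G" "e \<notin> G" "F = insert f G" "e \<noteq> f" using F f(1) by (auto simp: G_def)
      have nin: "e \<notin> S" "f \<notin> S" if "S \<subseteq> G" for S using that G by auto
      \<comment> \<open>\<open>u A h\<close> integrates over the sets whose trace on {e, f} is
        \<open>A\<close>, parametrised by their remainder in \<open>G\<close>.\<close>
      define u where "u A h = expect G (\<lambda>S. p (A \<union> S)) h" for A h
      define X where "X A = u A (\<lambda>S. g (A \<union> S))" for A
      define w where "w A = u A (\<lambda>_. 1)" for A
      have gA: "g (insert e (A \<union> S)) = g (A \<union> S)" if "S \<subseteq> G" "A \<subseteq> {f}" for A S
        using gF[of "A \<union> S"] that G(4) by auto
      have u_nn: "0 \<le> p (A \<union> S)" if "S \<subseteq> G" "A \<subseteq> {e, f}" for A S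
        using that F(3) G(4) by (intro nn) auto
      have w_nn: "0 \<le> w A" if "A \<subseteq> {e, f}" for A
        unfolding w_def u_def expect_def using u_nn[OF _ that] by (intro sum_nonneg) auto
      have w0: "X A = 0" if "w A = 0" "A \<subseteq> {e, f}" for A
        using expect_zero_weight[OF G(1) u_nn[OF _ that(2)]] that(1) unfolding X_def w_def u_def by simp
      have EF: "expect E p h = expect G (\<lambda>S. p ({e, f} \<union> S)) (\<lambda>S. h ({e, f} \<union> S)) + expect G (\<lambda>S. p ({e} \<union> S)) (\<lambda>S. h ({e} \<union> S))
          + expect G (\<lambda>S. p ({f} \<union> S)) (\<lambda>S. h ({f} \<union> S)) + expect G p h" for h
        unfolding F(3) expect_insert[OF F(1,2)] unfolding G(4) expect_insert[OF G(1,2)] by simp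
      have wt: "w {e, f} + w {e} + w {f} + w {} = 1"
        using EF[of "\<lambda>_. 1"] dpp_total[OF less.prems(1,2)] unfolding w_def u_def by simp
      have Xt: "expect E p g = X {e, f} + X {e} + X {f} + X {}"
        using EF[of g] unfolding X_def u_def by simp
      have "q = w {e, f} + w {e}"
        unfolding q_F G(4) expect_insert[OF G(1,2)] w_def u_def pe_def by simp
      note qw = this
      have gX: "expect F pe g = X {e, f} + X {e}"
        unfolding G(4) expect_insert[OF G(1,2)] X_def u_def pe_def using gA[of _ "{f}"] gA[of _ "{}"]
        by (simp cong: expect_cong)
      have fw: "expect F pe (\<lambda>S. of_bool (f \<in> S)) = w {e, f}"
        unfolding G(4) expect_insert[OF G(1,2)] w_def u_def pe_def using nin by (simp add: expect_zero cong: expect_cong)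
      have fX: "expect F pe (\<lambda>S. of_bool (f \<in> S) * g S) = X {e, f}"
        unfolding G(4) expect_insert[OF G(1,2)] X_def u_def pe_def using nin gA[of _ "{f}"]
        by (simp add: expect_zero cong: expect_cong)
      have h1: "w {e, f} * X {e} \<le> w {e} * X {e, f}"
        using f(3) unfolding cv_def fX fw gX qw by (simp add: algebra_simps)
      define s where "s = expect E p (\<lambda>S. of_bool (f \<in> S))"
      have s: "complex_of_real s = Q f f"
        unfolding s_def using dpp_single[OF less.prems(1,2), of f] f F by auto
      have sw: "s = w {e, f} + w {f}"
        unfolding s_def EF w_def u_def using nin G(5) by (simp add: expect_zero cong: expect_cong)
      have a0: "0 < w {e, f}" using f(2) fw by simp
      have E': "E = insert f (insert e G)" "f \<notin> insert e G" using F(3) G by auto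
      have fin': "finite (insert e G)" using G by simp
      have card': "card (insert e G) < card E" using E' fin' by simp
      have s0: "0 < s" using a0 w_nn[of "{f}"] sw by auto
      have i1: "increasing_on (insert e G) (\<lambda>S. g (insert f S))"
        unfolding increasing_on_def using E' by (auto intro!: increasing_onD[OF less.prems(4)])
      have g1: "g (insert f S) = g (insert f (S - {e}))" if "S \<subseteq> insert e G" for S
        using less.prems(6)[of "insert f S"] less.prems(6)[of "insert f (S - {e})"] that G(5) E'(1)
        by (auto simp: insert_Diff_if)
      have "expect (insert e G) (\<lambda>S. p (insert f S) / s) (\<lambda>S. of_bool (e \<in> S) * g (insert f S))
         \<le> expect (insert e G) (\<lambda>S. p (insert f S) / s) (\<lambda>S. of_bool (e \<in> S))
            * expect (insert e G) (\<lambda>S. p (insert f S) / s) (\<lambda>S. g (insert f S))"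
      proof (rule less.hyps[OF card' fin' _ _ i1 _ g1])
        show "dpp (insert e G) (schur Q f) (\<lambda>S. p (insert f S) / s)"
          using dpp_in[OF fin' E'(2)] less.prems(2) s s0 E'(1) by metis
        show "proj_kernel (insert e G) (schur Q f)"
          using proj_kernel_schur[OF fin' E'(2)] less.prems(3) s s0 E'(1) by (metis less_irrefl of_real_eq_0_iff)
      qed auto
      moreover have "expect (insert e G) (\<lambda>S. p (insert f S)) (\<lambda>S. of_bool (e \<in> S) * g (insert f S)) = X {e, f}"
        "expect (insert e G) (\<lambda>S. p (insert f S)) (\<lambda>S. of_bool (e \<in> S)) = w {e, f}"
        "expect (insert e G) (\<lambda>S. p (insert f S)) (\<lambda>S. g (insert f S)) = X {e, f} + X {f}"
        unfolding expect_insert[OF G(1,3)] X_def w_def u_def using nin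
        by (simp_all add: expect_zero insert_commute cong: expect_cong)
      ultimately have "X {e, f} / s \<le> w {e, f} / s * ((X {e, f} + X {f}) / s)"
        unfolding expect_divide by simp
      hence "s * X {e, f} \<le> w {e, f} * (X {e, f} + X {f})"
        using s0 by (simp add: field_simps)
      hence h2: "w {f} * X {e, f} \<le> w {e, f} * X {f}" unfolding sw by (simp add: algebra_simps)
      \<comment> \<open>The same argument given the absence of \<open>f\<close>, which has
        probability \<open>w {e} + w {}\<close>; if this is zero, both sides vanish.\<close>
      have h3: "w {} * X {e} \<le> w {e} * X {}"
      proof (cases "w {e} + w {} = 0")
        case True
        hence "w {} = 0" "w {e} = 0" using w_nn[of "{}"] w_nn[of "{e}"] by auto
        thus ?thesis by simp
      next
        case False
        have s1: "1 - s = w {e} + w {}" using sw wt by simp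
        hence sl: "s < 1" using False w_nn[of "{}"] w_nn[of "{e}"] by auto
        have i2: "increasing_on (insert e G) g"
          using less.prems(4) E'(1) by (auto intro: increasing_on_subset)
        have g2: "g S = g (S - {e})" if "S \<subseteq> insert e G" for S
          using less.prems(6)[of S] that E'(1) by auto
        have "expect (insert e G) (\<lambda>S. p S / (1 - s)) (\<lambda>S. of_bool (e \<in> S) * g S)
           \<le> expect (insert e G) (\<lambda>S. p S / (1 - s)) (\<lambda>S. of_bool (e \<in> S))
              * expect (insert e G) (\<lambda>S. p S / (1 - s)) g"
        proof (rule less.hyps[OF card' fin' _ _ i2 _ g2])
          show "dpp (insert e G) (schur_out Q f) (\<lambda>S. p S / (1 - s))"
            using dpp_out[OF fin' E'(2)] less.prems(2) s sl E'(1) by metis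
          show "proj_kernel (insert e G) (schur_out Q f)"
            using proj_kernel_schur_out[OF fin' E'(2)] less.prems(3) s sl E'(1) by (metis less_irrefl of_real_eq_1_iff)
        qed auto
        moreover have "expect (insert e G) p (\<lambda>S. of_bool (e \<in> S) * g S) = X {e}"
          "expect (insert e G) p (\<lambda>S. of_bool (e \<in> S)) = w {e}"
          "expect (insert e G) p g = X {e} + X {}"
          unfolding expect_insert[OF G(1,3)] X_def w_def u_def using nin
          by (simp_all add: expect_zero insert_commute cong: expect_cong)
        ultimately have "X {e} / (1 - s) \<le> w {e} / (1 - s) * ((X {e} + X {}) / (1 - s))"
          unfolding expect_divide by simp
        hence "(1 - s) * X {e} \<le> w {e} * (X {e} + X {})"
          using sl by (intro rescale_product_le) auto
        thus ?thesis unfolding s1 by (simp add: algebra_simps)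
      qed
      have "expect E p (\<lambda>S. of_bool (e \<in> S) * of_bool (f \<in> S)) = w {e, f}"
        unfolding EF w_def u_def using nin G(5) by (simp add: expect_zero cong: expect_cong)
      moreover have fE: "f \<in> E" using f(1) F(3) by simp
      ultimately have "w {e, f} = (w {e, f} + w {e}) * (w {e, f} + w {f}) - (cmod (Q e f))\<^sup>2"
        using dpp_pair[OF less.prems(1-3,5) fE G(5)] unfolding q_def[symmetric] s_def[symmetric] qw sw
        by linarith
      moreover have "0 \<le> (cmod (Q e f))\<^sup>2" by simp
      ultimately have nc: "w {e, f} \<le> (w {e, f} + w {e}) * (w {e, f} + w {f})" by linarith
      have "X {e, f} + X {e} \<le> (w {e, f} + w {e}) * (X {e, f} + X {e} + X {f} + X {})"
        using four_cell_inequality[OF a0 w_nn w_nn w_nn wt nc h2 h3 h1] w0 by simp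
      thus ?thesis unfolding g_F gX Xt q_def[symmetric] qw by simp
    qed
  qed
qed

text \<open>The law of total covariance for two cells of weights a and b, where F, G and H are the
  integrals of f, g and their product over them. Negative correlation within each cell and cell
  means ordered in opposite directions make the total covariance non-positive.\<close>

lemma chebyshev_two_cells:
  fixes a b :: real
  assumes "0 < a" "0 < b" "a + b = 1" "a * H1 \<le> F1 * G1" "b * H0 \<le> F0 * G0"
    and "F1 \<le> a * (F1 + F0)" "a * (G1 + G0) \<le> G1"
  shows "H1 + H0 \<le> (F1 + F0) * (G1 + G0)"
proof -
  have b: "b = 1 - a" using assms by simp
  have "0 \<le> (a * (F1 + F0) - F1) * (G1 - a * (G1 + G0))" using assms by simp
  hence "b * (F1 * G1) + a * (F0 * G0) \<le> (a * b) * ((F1 + F0) * (G1 + G0))"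
    unfolding b by (simp add: algebra_simps power2_eq_square)
  moreover have "b * (a * H1) \<le> b * (F1 * G1)" "a * (b * H0) \<le> a * (F0 * G0)"
    using assms by (auto intro!: mult_left_mono)
  ultimately have "(a * b) * (H1 + H0) \<le> (a * b) * ((F1 + F0) * (G1 + G0))"
    by (simp add: algebra_simps)
  thus ?thesis using assms(1,2) by (simp add: mult_le_cancel_left)
qed

text \<open>The covariances of \<open>g\<close> with all points of \<open>E\<close> add up to zero,
  and those with points outside \<open>B\<close> are non-positive by
  \<open>proj_dpp_neg_cov\<close>; so some \<open>e\<close> in \<open>B\<close> is non-negatively
  correlated with \<open>g\<close>. It is non-positively correlated with \<open>f\<close>, which
  depends on \<open>A\<close> only. Given the presence or the absence of \<open>e\<close> the
  induction hypothesis applies, and \<open>chebyshev_two_cells\<close> joins both cases.\<close>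

lemma proj_dpp_neg_assoc:
  assumes "finite E" "dpp E Q p" "proj_kernel E Q" "increasing_on E f" "increasing_on E g" "A \<inter> B = {}"
    and "\<And>S. S \<subseteq> E \<Longrightarrow> f S = f (S \<inter> A)" "\<And>S. S \<subseteq> E \<Longrightarrow> g S = g (S \<inter> B)"
  shows "expect E p (\<lambda>S. f S * g S) \<le> expect E p f * expect E p g"
  using assms
proof (induction "card E" arbitrary: E Q p f g rule: less_induct)
  case less
  show ?case
  proof (cases "E \<inter> B = {}")
    case True
    have g: "g S = g {}" if "S \<subseteq> E" for S
      using less.prems(8)[OF that] True that by (metis inf.absorb_iff1 inf_assoc inf_bot_right)
    have "expect E p (\<lambda>S. f S * g S) = expect E p (\<lambda>S. g {} * f S)"
      by (intro expect_cong refl) (metis g mult.commute)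
    moreover have "expect E p g = expect E p (\<lambda>_. g {} * 1)" by (intro expect_cong refl) (metis g mult_1_right)
    ultimately show ?thesis unfolding expect_cmult dpp_total[OF less.prems(1,2)] by simp
  next
    case False
    define cv where "cv e = expect E p (\<lambda>S. of_bool (e \<in> S) * g S) - expect E p (\<lambda>S. of_bool (e \<in> S)) * expect E p g" for e
    have cv0: "(\<Sum>e\<in>E. cv e) = 0" unfolding cv_def by (rule proj_dpp_sum_cov[OF less.prems(1-3)])
    have out: "cv e \<le> 0" if e: "e \<in> E - B" for e
    proof -
      have "g S = g (S - {e})" if "S \<subseteq> E" for S
      proof -
        have "S \<inter> B = (S - {e}) \<inter> B" using e by auto
        thus ?thesis using less.prems(8)[of S] less.prems(8)[of "S - {e}"] that by (metis Diff_subset order_trans)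
      qed
      thus ?thesis unfolding cv_def
        using proj_dpp_neg_cov[OF less.prems(1-3,5), of e] e by simp
    qed
    have "\<exists>e\<in>E \<inter> B. 0 \<le> cv e"
    proof (rule ccontr)
      assume "\<not> ?thesis"
      hence "(\<Sum>e\<in>E \<inter> B. cv e) < (\<Sum>e\<in>E \<inter> B. 0)"
        using False less.prems(1) by (intro sum_strict_mono) (auto simp: not_le)
      moreover have "(\<Sum>e\<in>E - B. cv e) \<le> (\<Sum>e\<in>E - B. 0)" using out by (intro sum_mono) auto
      moreover have "(\<Sum>e\<in>E. cv e) = (\<Sum>e\<in>E \<inter> B. cv e) + (\<Sum>e\<in>E - B. cv e)"
        using less.prems(1) by (rule sum.Int_Diff)
      ultimately show False using cv0 by simp
    qed
    then obtain e where e: "e \<in> E" "e \<in> B" "0 \<le> cv e" by auto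
    have eA: "e \<notin> A" using e less.prems(6) by auto
    define F where "F = E - {e}"
    have F: "finite F" "e \<notin> F" "E = insert e F" using less.prems e by (auto simp: F_def)
    have card': "card F < card E" using F by simp
    have nin: "e \<notin> S" if "S \<subseteq> F" for S using that F(2) by auto
    define u where "u h = expect F (\<lambda>S. p (insert e S)) (\<lambda>S. h (insert e S))" for h
    define v where "v h = expect F p h" for h
    have E_uv: "expect E p h = u h + v h" for h unfolding u_def v_def F(3) by (rule expect_insert[OF F(1,2)])
    have E_u: "expect E p (\<lambda>S. of_bool (e \<in> S) * h S) = u h" for h
      unfolding E_uv using nin by (simp add: u_def v_def expect_zero)
    define a where "a = u (\<lambda>_. 1)"
    define b where "b = v (\<lambda>_. 1)"
    have ab: "a + b = 1" unfolding a_def b_def E_uv[symmetric] by (rule dpp_total[OF less.prems(1,2)])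
    have aE: "expect E p (\<lambda>S. of_bool (e \<in> S)) = a" using E_u[of "\<lambda>_. 1"] by (simp add: a_def)
    have q: "Q e e = complex_of_real a" using dpp_single[OF less.prems(1,2) e(1)] aE by simp
    have nn1: "0 \<le> p (insert e S)" and nn2: "0 \<le> p S" if "S \<subseteq> F" for S
      using that F(3) by (auto intro!: dpp_nonneg[OF less.prems(2)])
    have a0: "0 \<le> a" "0 \<le> b" unfolding a_def b_def u_def v_def expect_def using nn1 nn2
      by (auto intro!: sum_nonneg)
    have ua0: "u h = 0" if "a = 0" for h
      using expect_zero_weight[OF F(1), of "\<lambda>S. p (insert e S)"] nn1 that unfolding a_def u_def by auto
    have vb0: "v h = 0" if "b = 0" for h
      using expect_zero_weight[OF F(1), of p] nn2 that unfolding b_def v_def by auto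
    have covf: "u f \<le> a * (u f + v f)"
    proof -
      have "f S = f (S - {e})" if "S \<subseteq> E" for S
      proof -
        have "S \<inter> A = (S - {e}) \<inter> A" using eA by auto
        thus ?thesis using less.prems(7)[of S] less.prems(7)[of "S - {e}"] that by (metis Diff_subset order_trans)
      qed
      thus ?thesis using proj_dpp_neg_cov[OF less.prems(1-4) e(1)] unfolding E_u aE E_uv by simp
    qed
    have covg: "a * (u g + v g) \<le> u g" using e(3) unfolding cv_def E_u aE E_uv by simp
    have in_sub: "insert e S \<subseteq> E" "S \<subseteq> E" if "S \<subseteq> F" for S using that F(3) by auto
    have H1: "a * u (\<lambda>S. f S * g S) \<le> u f * u g" if ap: "0 < a"
    proof -
      have "expect F (\<lambda>S. p (insert e S) / a) (\<lambda>S. f (insert e S) * g (insert e S))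
        \<le> expect F (\<lambda>S. p (insert e S) / a) (\<lambda>S. f (insert e S)) * expect F (\<lambda>S. p (insert e S) / a) (\<lambda>S. g (insert e S))"
      proof (rule less.hyps[OF card' F(1) _ _ _ _ less.prems(6)])
        show "dpp F (schur Q e) (\<lambda>S. p (insert e S) / a)"
          using dpp_in[OF F(1,2)] less.prems(2) q ap F(3) by metis
        show "proj_kernel F (schur Q e)"
          using proj_kernel_schur[OF F(1,2)] less.prems(3) q ap F(3) by (metis less_irrefl of_real_eq_0_iff)
        show "increasing_on F (\<lambda>S. f (insert e S))" "increasing_on F (\<lambda>S. g (insert e S))"
          unfolding increasing_on_def using F(3)
          by (auto intro!: increasing_onD[OF less.prems(4)] increasing_onD[OF less.prems(5)])
        fix S assume S: "S \<subseteq> F"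
        hence S': "S \<inter> A \<subseteq> F" "S \<inter> B \<subseteq> F" by auto
        have "insert e S \<inter> A = insert e (S \<inter> A) \<inter> A" "insert e S \<inter> B = insert e (S \<inter> B) \<inter> B" by auto
        thus "f (insert e S) = f (insert e (S \<inter> A))" "g (insert e S) = g (insert e (S \<inter> B))"
          using less.prems(7)[of "insert e S"] less.prems(7)[of "insert e (S \<inter> A)"]
            less.prems(8)[of "insert e S"] less.prems(8)[of "insert e (S \<inter> B)"]
            in_sub[OF S] in_sub[OF S'(1)] in_sub[OF S'(2)] by auto
      qed
      thus ?thesis unfolding expect_divide u_def using ap by (simp add: field_simps)
    qed
    have H0: "b * v (\<lambda>S. f S * g S) \<le> v f * v g" if bp: "0 < b"
    proof -
      have b1: "b = 1 - a" "a < 1" using ab bp by auto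
      have "expect F (\<lambda>S. p S / (1 - a)) (\<lambda>S. f S * g S) \<le> expect F (\<lambda>S. p S / (1 - a)) f * expect F (\<lambda>S. p S / (1 - a)) g"
      proof (rule less.hyps[OF card' F(1) _ _ _ _ less.prems(6)])
        show "dpp F (schur_out Q e) (\<lambda>S. p S / (1 - a))"
          using dpp_out[OF F(1,2)] less.prems(2) q b1 F(3) by metis
        show "proj_kernel F (schur_out Q e)"
          using proj_kernel_schur_out[OF F(1,2)] less.prems(3) q b1 F(3) by (metis less_irrefl of_real_eq_1_iff)
        show "increasing_on F f" "increasing_on F g"
          using less.prems(4,5) F(3) by (auto intro: increasing_on_subset)
        fix S assume "S \<subseteq> F"
        thus "f S = f (S \<inter> A)" "g S = g (S \<inter> B)"
          using less.prems(7,8)[of S] in_sub by auto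
      qed
      thus ?thesis unfolding expect_divide v_def b1(1) using b1(2) by (intro rescale_product_le) auto
    qed
    consider "a = 0" | "b = 0" | "0 < a" "0 < b" using a0 by fastforce
    thus ?thesis
    proof cases
      case 1
      thus ?thesis unfolding E_uv using ua0 H0 ab by simp
    next
      case 2
      thus ?thesis unfolding E_uv using vb0 H1 ab by simp
    next
      case 3
      thus ?thesis unfolding E_uv
        by (intro chebyshev_two_cells[OF 3 ab H1[OF 3(1)] H0[OF 3(2)] covf covg])
    qed
  qed
qed

subsection \<open>Dilation of Hermitian contractions\<close>

definition psd :: "'i set \<Rightarrow> ('i \<Rightarrow> 'i \<Rightarrow> complex) \<Rightarrow> bool" where
  "psd E M \<longleftrightarrow> (\<forall>i\<in>E. \<forall>j\<in>E. M j i = cnj (M i j)) \<and>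
     (\<forall>u. 0 \<le> Re (\<Sum>i\<in>E. \<Sum>j\<in>E. cnj (u i) * M i j * u j))"

lemma psd_herm: "psd E M \<Longrightarrow> i \<in> E \<Longrightarrow> j \<in> E \<Longrightarrow> M j i = cnj (M i j)"
  unfolding psd_def by blast

lemma psd_quad: "psd E M \<Longrightarrow> 0 \<le> Re (\<Sum>i\<in>E. \<Sum>j\<in>E. cnj (u i) * M i j * u j)"
  unfolding psd_def by blast

lemma psd_diag_real: "psd E M \<Longrightarrow> i \<in> E \<Longrightarrow> complex_of_real (Re (M i i)) = M i i"
  using psd_herm[of E M i i] by (simp add: complex_eq_iff)

lemma quad_insert:
  fixes M :: "'i \<Rightarrow> 'i \<Rightarrow> complex"
  assumes "finite F" "e \<notin> F"
  shows "(\<Sum>i\<in>insert e F. \<Sum>j\<in>insert e F. cnj (u i) * M i j * u j) =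
    cnj (u e) * M e e * u e + cnj (u e) * (\<Sum>j\<in>F. M e j * u j) + (\<Sum>i\<in>F. cnj (u i) * M i e) * u e
    + (\<Sum>i\<in>F. \<Sum>j\<in>F. cnj (u i) * M i j * u j)"
  using assms by (simp add: sum.distrib sum_distrib_left sum_distrib_right mult.assoc)

lemma psd_subset:
  assumes "finite E" "psd E M" "F \<subseteq> E"
  shows "psd F M"
  unfolding psd_def
proof (intro conjI ballI allI)
  fix i j assume "i \<in> F" "j \<in> F" thus "M j i = cnj (M i j)"
    using psd_herm[OF assms(2)] assms(3) by blast
next
  fix u :: "'a \<Rightarrow> complex"
  define v where "v i = (if i \<in> F then u i else 0)" for i
  have "(\<Sum>i\<in>E. \<Sum>j\<in>E. cnj (v i) * M i j * v j) = (\<Sum>i\<in>F. \<Sum>j\<in>E. cnj (v i) * M i j * v j)"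
    using assms(1,3) by (intro sum.mono_neutral_right) (auto simp: v_def)
  also have "\<dots> = (\<Sum>i\<in>F. \<Sum>j\<in>F. cnj (v i) * M i j * v j)"
    using assms(1,3) by (intro sum.cong[OF refl], intro sum.mono_neutral_right) (auto simp: v_def)
  also have "\<dots> = (\<Sum>i\<in>F. \<Sum>j\<in>F. cnj (u i) * M i j * u j)"
    by (intro sum.cong refl) (auto simp: v_def)
  finally show "0 \<le> Re (\<Sum>i\<in>F. \<Sum>j\<in>F. cnj (u i) * M i j * u j)"
    using psd_quad[OF assms(2), of v] by simp
qed

lemma psd_diag_nonneg:
  assumes "finite E" "psd E M" "e \<in> E"
  shows "0 \<le> Re (M e e)"
  using psd_quad[OF psd_subset[OF assms(1,2), of "{e}"], of "\<lambda>_. 1"] assms(3) by simp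

text \<open>Without a quadratic term at \<open>e\<close> the form can be driven to minus infinity
  along that coordinate, unless \<open>M e f\<close> vanishes.\<close>

lemma psd_zero_diag:
  assumes "finite E" "psd E M" "e \<in> E" "f \<in> E" "M e e = 0"
  shows "M e f = 0"
proof (cases "e = f")
  case False
  have p: "psd (insert e {f}) M" using psd_subset[OF assms(1,2)] assms by auto
  have M: "M f e = cnj (M e f)" using psd_herm[OF assms(2-4)] .
  have "2 * s * (cmod (M e f))\<^sup>2 \<le> Re (M f f)" for s :: real
  proof -
    define u where "u i = (if i = e then - complex_of_real s * M e f else 1)" for i
    have "(\<Sum>i\<in>insert e {f}. \<Sum>j\<in>insert e {f}. cnj (u i) * M i j * u j)
      = M f f - 2 * complex_of_real s * (M e f * cnj (M e f))"
      using False assms(5) by (subst quad_insert) (auto simp: u_def M algebra_simps)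
    also have "\<dots> = M f f - complex_of_real (2 * s * (cmod (M e f))\<^sup>2)"
      using complex_norm_square[of "M e f"] by simp
    finally show ?thesis using psd_quad[OF p, of u] by simp
  qed
  \<comment> \<open>This value of \<open>s\<close> makes the left side equal to
    \<open>Re (M f f) + 1\<close>.\<close>
  from this[of "(Re (M f f) + 1) / (2 * (cmod (M e f))\<^sup>2)"] show ?thesis
    by (cases "M e f = 0") (auto simp: field_simps)
qed (use assms in simp)

text \<open>Minimising the form over the coordinate at \<open>e\<close> leaves the form of the Schur
  complement; the minimiser is the value \<open>- b / M e e\<close> in \<open>v\<close>.\<close>

lemma psd_schur:
  assumes "finite F" "e \<notin> F" "psd (insert e F) M" "M e e \<noteq> 0"
  shows "psd F (\<lambda>i j. M i j - M i e * M e j / M e e)"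
  unfolding psd_def
proof (intro conjI ballI allI)
  note h = psd_herm[OF assms(3)]
  have m: "cnj (M e e) = M e e" using h[of e e] by simp
  {
    fix i j assume ij: "i \<in> F" "j \<in> F"
    show "M j i - M j e * M e i / M e e = cnj (M i j - M i e * M e j / M e e)"
      using h[of i j] h[of e j] h[of e i] m ij by (simp add: mult.commute)
  next
    fix u :: "'a \<Rightarrow> complex"
    define b where "b = (\<Sum>j\<in>F. M e j * u j)"
    define v where "v i = (if i = e then - b / M e e else u i)" for i
    have cb: "(\<Sum>i\<in>F. cnj (u i) * M i e) = cnj b"
      unfolding b_def cnj_sum
    proof (intro sum.cong refl)
      fix i assume "i \<in> F"
      hence "M i e = cnj (M e i)" using h[of e i] by auto
      thus "cnj (u i) * M i e = cnj (M e i * u i)" by simp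
    qed
    have vF: "v i = u i" if "i \<in> F" for i using that assms(2) by (auto simp: v_def)
    have "(\<Sum>i\<in>insert e F. \<Sum>j\<in>insert e F. cnj (v i) * M i j * v j) =
       cnj (v e) * M e e * v e + cnj (v e) * b + cnj b * v e + (\<Sum>i\<in>F. \<Sum>j\<in>F. cnj (u i) * M i j * u j)"
    proof -
      have "(\<Sum>i\<in>F. cnj (v i) * M i e) = cnj b"
        unfolding cb[symmetric] by (intro sum.cong refl) (simp add: vF)
      moreover have "(\<Sum>j\<in>F. M e j * v j) = b"
        "(\<Sum>i\<in>F. \<Sum>j\<in>F. cnj (v i) * M i j * v j) = (\<Sum>i\<in>F. \<Sum>j\<in>F. cnj (u i) * M i j * u j)"
        by (auto intro!: sum.cong simp: vF b_def)
      ultimately show ?thesis unfolding quad_insert[OF assms(1,2)] by simp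
    qed
    also have "cnj (v e) * M e e * v e + cnj (v e) * b + cnj b * v e = - (cnj b * b / M e e)"
      using assms(4) by (simp add: v_def m field_simps)
    also have "cnj b * b / M e e = (\<Sum>i\<in>F. \<Sum>j\<in>F. cnj (u i) * (M i e * M e j / M e e) * u j)"
    proof -
      have "cnj b * b / M e e = (\<Sum>i\<in>F. cnj (u i) * M i e) * (\<Sum>j\<in>F. M e j * u j) / M e e"
        by (simp only: cb b_def[symmetric])
      thus ?thesis unfolding sum_product sum_divide_distrib by (simp add: mult_ac)
    qed
    finally have "(\<Sum>i\<in>insert e F. \<Sum>j\<in>insert e F. cnj (v i) * M i j * v j) =
      (\<Sum>i\<in>F. \<Sum>j\<in>F. cnj (u i) * (M i j - M i e * M e j / M e e) * u j)"
      by (simp add: algebra_simps sum_subtractf)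
    thus "0 \<le> Re (\<Sum>i\<in>F. \<Sum>j\<in>F. cnj (u i) * (M i j - M i e * M e j / M e e) * u j)"
      using psd_quad[OF assms(3), of v] by simp
  }
qed

text \<open>Cholesky decomposition, one pivot per point. A zero pivot has a zero row by
  \<open>psd_zero_diag\<close>, and then \<open>M\<close> itself passes to the induction
  hypothesis.\<close>

lemma psd_gram:
  assumes "finite E" "psd E M"
  shows "\<exists>x. \<forall>i\<in>E. \<forall>j\<in>E. M i j = (\<Sum>k\<in>E. x i k * cnj (x j k))"
  using assms
proof (induction E arbitrary: M rule: finite_induct)
  case (insert e F)
  have e: "e \<in> Set.insert e F" and fin: "finite (Set.insert e F)" using insert.hyps by auto
  note h = psd_herm[OF insert.prems]
  define m where "m = Re (M e e)"
  have m: "M e e = complex_of_real m" "0 \<le> m"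
    using psd_diag_real[OF insert.prems e] psd_diag_nonneg[OF fin insert.prems e] by (auto simp: m_def)
  define s where "s = complex_of_real (sqrt m)"
  have s: "s * s = M e e" "cnj s = s" using m by (simp_all add: s_def flip: of_real_mult)
  have "\<exists>x. \<forall>i\<in>F. \<forall>j\<in>F. M i j - M i e * M e j / M e e = (\<Sum>k\<in>F. x i k * cnj (x j k))"
  proof (cases "M e e = 0")
    case True
    have "psd F M" using psd_subset[OF fin insert.prems] by auto
    thus ?thesis using insert.IH[of M] psd_zero_diag[OF fin insert.prems e _ True] by auto
  next
    case False
    show ?thesis by (rule insert.IH[OF psd_schur[OF insert.hyps insert.prems False]])
  qed
  then obtain x where x: "\<And>i j. i \<in> F \<Longrightarrow> j \<in> F \<Longrightarrow> M i j - M i e * M e j / M e e = (\<Sum>k\<in>F. x i k * cnj (x j k))"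
    by blast
  \<comment> \<open>For a zero pivot the quotient \<open>M i e / s\<close> is 0 by the convention
    for division, in agreement with the vanishing row.\<close>
  define y where "y i k = (if k = e then (if i = e then s else M i e / s) else if i = e then 0 else x i k)" for i k
  have "M i j = (\<Sum>k\<in>Set.insert e F. y i k * cnj (y j k))" if ij: "i \<in> Set.insert e F" "j \<in> Set.insert e F" for i j
  proof -
    have z: "M e k = 0" "M k e = 0" if "s = 0" "k \<in> Set.insert e F" for k
      using psd_zero_diag[OF fin insert.prems e that(2)] s(1) that h[OF e that(2)] by auto
    have yF: "(\<Sum>k\<in>F. y i k * cnj (y j k)) = (if i = e \<or> j = e then 0 else \<Sum>k\<in>F. x i k * cnj (x j k))"
      using insert.hyps(2) by (auto simp: y_def intro!: sum.neutral sum.cong)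
    have *: "(\<Sum>k\<in>Set.insert e F. y i k * cnj (y j k)) = y i e * cnj (y j e) + (\<Sum>k\<in>F. y i k * cnj (y j k))"
      using insert.hyps by simp
    have c: "cnj (M j e) = M e j" using h[of j e] ij e by simp
    show ?thesis
    proof (cases "i = e \<or> j = e")
      case True
      thus ?thesis unfolding * yF using s c z ij
        by (cases "s = 0") (auto simp: y_def)
    next
      case False
      have "y i e * cnj (y j e) = M i e * M e j / (s * s)" using False by (simp add: y_def s c)
      thus ?thesis unfolding * yF using False x[of i j] ij s(1) by (simp add: algebra_simps)
    qed
  qed
  thus ?case by blast
qed auto

lemma sum_norm_square: "(\<Sum>i\<in>E. cnj (a i) * a i) = complex_of_real (\<Sum>i\<in>E. (cmod (a i))\<^sup>2)"
  unfolding of_real_sum by (intro sum.cong refl) (metis complex_norm_square mult.commute)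

text \<open>Gram vectors of \<open>Q\<close> and of the defect of their frame operator form a Parseval frame, and the
  Gram matrix of a Parseval frame is a projection.\<close>

lemma psd_contraction_dilation:
  assumes "finite E" "psd E Q" "psd E (compl_kernel Q)"
  shows "\<exists>P :: 'i \<times> bool \<Rightarrow> 'i \<times> bool \<Rightarrow> complex. proj_kernel (E \<times> UNIV) P \<and>
     (\<forall>i\<in>E. \<forall>j\<in>E. P (i, True) (j, True) = Q i j)"
proof -
  obtain x where x: "\<And>i j. i \<in> E \<Longrightarrow> j \<in> E \<Longrightarrow> Q i j = (\<Sum>k\<in>E. x i k * cnj (x j k))"
    using psd_gram[OF assms(1,2)] by blast
  define W where "W k l = of_bool (k = l) - (\<Sum>i\<in>E. cnj (x i k) * x i l)" for k l
  have "psd E W"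
    unfolding psd_def
  proof (intro conjI ballI allI)
    fix k l show "W l k = cnj (W k l)" unfolding W_def by (auto simp: mult.commute)
  next
    fix u :: "'i \<Rightarrow> complex"
    \<comment> \<open>With X the matrix of Gram vectors, b = X u and c = X* b, so C is the form of
      \<open>Q = X X*\<close> at b, and C \<le> B because \<open>Q\<close> is at most 1. On the
      other hand B is the inner product of u and c, so 2 B \<le> U + C. Together B \<le> U, which is
      the non-negativity of \<open>W\<close>.\<close>
    define b where "b i = (\<Sum>l\<in>E. x i l * u l)" for i
    define c where "c l = (\<Sum>i\<in>E. b i * cnj (x i l))" for l
    define U where "U = (\<Sum>l\<in>E. (cmod (u l))\<^sup>2)"
    define B where "B = (\<Sum>i\<in>E. (cmod (b i))\<^sup>2)"
    define C where "C = (\<Sum>l\<in>E. (cmod (c l))\<^sup>2)"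
    have del: "(\<Sum>i\<in>E. \<Sum>j\<in>E. cnj (a i) * of_bool (i = j) * a j) = (\<Sum>i\<in>E. cnj (a i) * a i)" for a
      using assms(1) by (intro sum.cong refl) (simp add: of_bool_def if_distrib if_distribR cong: if_cong)
    have q: "(\<Sum>k\<in>E. \<Sum>l\<in>E. cnj (u k) * (\<Sum>i\<in>E. cnj (x i k) * x i l) * u l) = (\<Sum>i\<in>E. cnj (b i) * b i)"
    proof -
      have "(\<Sum>k\<in>E. \<Sum>l\<in>E. cnj (u k) * (\<Sum>i\<in>E. cnj (x i k) * x i l) * u l)
        = (\<Sum>k\<in>E. \<Sum>l\<in>E. \<Sum>i\<in>E. (cnj (x i k) * cnj (u k)) * (x i l * u l))"
        by (simp add: sum_distrib_left sum_distrib_right mult_ac)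
      also have "\<dots> = (\<Sum>k\<in>E. \<Sum>i\<in>E. \<Sum>l\<in>E. (cnj (x i k) * cnj (u k)) * (x i l * u l))"
        by (rule sum.cong[OF refl], rule sum.swap)
      also have "\<dots> = (\<Sum>i\<in>E. \<Sum>k\<in>E. \<Sum>l\<in>E. (cnj (x i k) * cnj (u k)) * (x i l * u l))"
        by (rule sum.swap)
      also have "\<dots> = (\<Sum>i\<in>E. cnj (b i) * b i)"
        unfolding b_def cnj_sum sum_product by simp
      finally show ?thesis .
    qed
    have BC: "complex_of_real B = (\<Sum>l\<in>E. u l * cnj (c l))"
    proof -
      have "complex_of_real B = (\<Sum>i\<in>E. \<Sum>l\<in>E. cnj (b i) * (x i l * u l))"
        unfolding B_def sum_norm_square[symmetric] by (subst (2) b_def) (simp add: sum_distrib_left)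
      also have "\<dots> = (\<Sum>l\<in>E. \<Sum>i\<in>E. cnj (b i) * (x i l * u l))" by (rule sum.swap)
      also have "\<dots> = (\<Sum>l\<in>E. u l * cnj (c l))"
        unfolding c_def by (simp add: sum_distrib_left mult_ac)
      finally show ?thesis .
    qed
    have "Re (u l * cnj (c l)) \<le> ((cmod (u l))\<^sup>2 + (cmod (c l))\<^sup>2) / 2" for l
    proof -
      have "Re (u l * cnj (c l)) \<le> cmod (u l) * cmod (c l)"
        by (metis complex_Re_le_cmod complex_mod_cnj norm_mult)
      also have "\<dots> \<le> ((cmod (u l))\<^sup>2 + (cmod (c l))\<^sup>2) / 2"
        using sum_squares_bound[of "cmod (u l)" "cmod (c l)"] by simp
      finally show ?thesis .
    qed
    hence "(\<Sum>l\<in>E. Re (u l * cnj (c l))) \<le> (\<Sum>l\<in>E. ((cmod (u l))\<^sup>2 + (cmod (c l))\<^sup>2) / 2)"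
      by (rule sum_mono)
    hence 1: "2 * B \<le> U + C"
      using arg_cong[OF BC, of Re] by (simp add: U_def C_def sum.distrib sum_divide_distrib[symmetric])
    have "complex_of_real C = (\<Sum>l\<in>E. \<Sum>j\<in>E. \<Sum>i\<in>E. cnj (b j) * x j l * (b i * cnj (x i l)))"
      unfolding C_def sum_norm_square[symmetric] c_def cnj_sum sum_product by (simp add: mult_ac)
    also have "\<dots> = (\<Sum>j\<in>E. \<Sum>l\<in>E. \<Sum>i\<in>E. cnj (b j) * x j l * (b i * cnj (x i l)))" by (rule sum.swap)
    also have "\<dots> = (\<Sum>j\<in>E. \<Sum>i\<in>E. \<Sum>l\<in>E. cnj (b j) * x j l * (b i * cnj (x i l)))"
      by (rule sum.cong[OF refl], rule sum.swap)
    also have "\<dots> = (\<Sum>j\<in>E. \<Sum>i\<in>E. cnj (b j) * Q j i * b i)"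
      by (intro sum.cong refl) (simp add: x sum_distrib_left sum_distrib_right mult_ac)
    finally have Cq: "complex_of_real C = (\<Sum>j\<in>E. \<Sum>i\<in>E. cnj (b j) * Q j i * b i)" .
    have "(\<Sum>i\<in>E. \<Sum>j\<in>E. cnj (b i) * compl_kernel Q i j * b j) = complex_of_real B - complex_of_real C"
      unfolding Cq B_def sum_norm_square[symmetric] del[symmetric] compl_kernel_def
      by (simp add: algebra_simps sum_subtractf)
    hence 2: "C \<le> B" using psd_quad[OF assms(3), of b] by simp
    have "(\<Sum>i\<in>E. \<Sum>j\<in>E. cnj (u i) * W i j * u j) = (\<Sum>i\<in>E. cnj (u i) * u i) - (\<Sum>i\<in>E. cnj (b i) * b i)"
      unfolding q[symmetric] del[symmetric] W_def by (simp add: algebra_simps sum_subtractf)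
    also have "\<dots> = complex_of_real (U - B)" unfolding sum_norm_square U_def B_def by simp
    finally show "0 \<le> Re (\<Sum>i\<in>E. \<Sum>j\<in>E. cnj (u i) * W i j * u j)" using 1 2 by simp
  qed
  then obtain z where z: "\<And>k l. k \<in> E \<Longrightarrow> l \<in> E \<Longrightarrow> W k l = (\<Sum>m\<in>E. z k m * cnj (z l m))"
    using psd_gram[OF assms(1)] by blast
  \<comment> \<open>The conjugate in the second half makes its contribution to \<open>frame\<close>
    equal to \<open>W k l\<close>.\<close>
  define v where "v a k = (if snd a then x (fst a) k else cnj (z k (fst a)))" for a :: "'i \<times> bool" and k
  define P where "P a b = (\<Sum>k\<in>E. v a k * cnj (v b k))" for a b
  have frame: "(\<Sum>b\<in>E \<times> UNIV. cnj (v b k) * v b l) = of_bool (k = l)" if kl: "k \<in> E" "l \<in> E" for k l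
  proof -
    have "(\<Sum>b\<in>E \<times> UNIV. cnj (v b k) * v b l) = (\<Sum>i\<in>E. \<Sum>s\<in>UNIV. cnj (v (i, s) k) * v (i, s) l)"
      by (simp add: sum.cartesian_product split_def)
    also have "\<dots> = (\<Sum>i\<in>E. cnj (x i k) * x i l) + (\<Sum>m\<in>E. z k m * cnj (z l m))"
      by (simp add: UNIV_bool v_def sum.distrib)
    also have "\<dots> = of_bool (k = l)" unfolding z[OF kl, symmetric] W_def by simp
    finally show ?thesis .
  qed
  have "proj_kernel (E \<times> UNIV) P"
    unfolding proj_kernel_def
  proof (intro conjI ballI)
    fix a b show "P b a = cnj (P a b)" unfolding P_def by (simp add: mult.commute)
  next
    fix a c
    have "(\<Sum>b\<in>E \<times> UNIV. P a b * P b c) = (\<Sum>b\<in>E \<times> UNIV. \<Sum>k\<in>E. \<Sum>l\<in>E. v a k * cnj (v c l) * (cnj (v b k) * v b l))"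
      unfolding P_def sum_product by (simp add: mult_ac)
    also have "\<dots> = (\<Sum>k\<in>E. \<Sum>b\<in>E \<times> UNIV. \<Sum>l\<in>E. v a k * cnj (v c l) * (cnj (v b k) * v b l))"
      by (rule sum.swap)
    also have "\<dots> = (\<Sum>k\<in>E. \<Sum>l\<in>E. \<Sum>b\<in>E \<times> UNIV. v a k * cnj (v c l) * (cnj (v b k) * v b l))"
      by (rule sum.cong[OF refl], rule sum.swap)
    also have "\<dots> = (\<Sum>k\<in>E. \<Sum>l\<in>E. v a k * cnj (v c l) * of_bool (k = l))"
      by (intro sum.cong refl) (simp add: sum_distrib_left[symmetric] frame)
    also have "\<dots> = P a c" unfolding P_def using assms(1)
      by (intro sum.cong refl) (simp add: of_bool_def if_distrib cong: if_cong)
    finally show "(\<Sum>b\<in>E \<times> UNIV. P a b * P b c) = P a c" .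
  qed
  moreover have "\<forall>i\<in>E. \<forall>j\<in>E. P (i, True) (j, True) = Q i j" using x by (simp add: P_def v_def)
  ultimately show ?thesis by blast
qed

text \<open>The law is the image of that of the dilated process under restriction to the points
  \<open>(i, True)\<close>. Minors over these points are minors of \<open>Q\<close>, and increasing
  functions of the restriction stay increasing and keep depending on disjoint sets of
  points.\<close>

lemma psd_contraction_dpp:
  assumes "finite E" "psd E Q" "psd E (compl_kernel Q)"
  shows "\<exists>p. dpp E Q p \<and> (\<forall>f g A B. increasing_on E f \<longrightarrow> increasing_on E g \<longrightarrow> A \<inter> B = {} \<longrightarrow>
     (\<forall>S\<subseteq>E. f S = f (S \<inter> A)) \<longrightarrow> (\<forall>S\<subseteq>E. g S = g (S \<inter> B)) \<longrightarrow>
     expect E p (\<lambda>S. f S * g S) \<le> expect E p f * expect E p g)"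
proof -
  obtain P :: "'a \<times> bool \<Rightarrow> 'a \<times> bool \<Rightarrow> complex" where P: "proj_kernel (E \<times> UNIV) P"
    and PQ: "\<And>i j. i \<in> E \<Longrightarrow> j \<in> E \<Longrightarrow> P (i, True) (j, True) = Q i j"
    using psd_contraction_dilation[OF assms] by blast
  have fin: "finite (E \<times> (UNIV :: bool set))" using assms(1) by simp
  obtain p where p: "dpp (E \<times> UNIV) P p" using dpp_exists[OF fin P] by blast
  define r where "r S = {i \<in> E. (i, True) \<in> S}" for S
  define p' where "p' T = (\<Sum>S | S \<in> Pow (E \<times> UNIV) \<and> r S = T. p S)" for T
  have expect: "expect E p' g = expect (E \<times> UNIV) p (\<lambda>S. g (r S))" for g
  proof -
    have "expect E p' g = (\<Sum>T\<in>Pow E. \<Sum>S | S \<in> Pow (E \<times> UNIV) \<and> r S = T. p S * g (r S))"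
      unfolding expect_def p'_def sum_distrib_right by (intro sum.cong refl) auto
    also have "\<dots> = expect (E \<times> UNIV) p (\<lambda>S. g (r S))"
      unfolding expect_def using fin assms(1) by (intro sum.group) (auto simp: r_def)
    finally show ?thesis .
  qed
  have "dpp E Q p'"
    unfolding dpp_def
  proof (intro conjI allI impI)
    fix T show "0 \<le> p' T" unfolding p'_def by (intro sum_nonneg dpp_nonneg[OF p]) auto
  next
    fix xs assume xs: "distinct xs" "set xs \<subseteq> E"
    define ys where "ys = map (\<lambda>i. (i, True)) xs"
    have ys: "distinct ys" "set ys \<subseteq> E \<times> UNIV" using xs by (auto simp: ys_def distinct_map inj_on_def)
    have "(\<Sum>S | S \<subseteq> E \<and> set xs \<subseteq> S. p' S) = (\<Sum>S\<in>Pow E. if set xs \<subseteq> S then p' S else 0)"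
      using assms(1) by (subst sum.inter_filter[symmetric]) (auto simp: Pow_def)
    also have "\<dots> = expect E p' (\<lambda>S. of_bool (set xs \<subseteq> S))"
      unfolding expect_def by (intro sum.cong) auto
    also have "\<dots> = expect (E \<times> UNIV) p (\<lambda>S. of_bool (set ys \<subseteq> S))"
      unfolding expect using xs by (intro expect_cong refl arg_cong[of _ _ of_bool]) (auto simp: r_def ys_def)
    also have "complex_of_real \<dots> = pminor P ys" by (rule dpp_expect[OF fin p ys])
    also have "pminor P ys = pminor Q xs"
      unfolding pminor_def ys_def using xs(2) nth_mem
      by (intro arg_cong[of _ _ Determinant.det] eq_matI) (auto intro!: PQ)
    finally show "complex_of_real (\<Sum>S | S \<subseteq> E \<and> set xs \<subseteq> S. p' S) = pminor Q xs" .
  qed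
  moreover have "expect E p' (\<lambda>S. f S * g S) \<le> expect E p' f * expect E p' g"
    if f: "increasing_on E f" and g: "increasing_on E g" and AB: "A \<inter> B = {}"
      and fA: "\<forall>S\<subseteq>E. f S = f (S \<inter> A)" and gB: "\<forall>S\<subseteq>E. g S = g (S \<inter> B)" for f g A B
    unfolding expect
  proof (rule proj_dpp_neg_assoc[OF fin p P])
    show "increasing_on (E \<times> UNIV) (\<lambda>S. f (r S))" "increasing_on (E \<times> UNIV) (\<lambda>S. g (r S))"
      by (auto simp: increasing_on_def r_def intro!: increasing_onD[OF f] increasing_onD[OF g])
    show "A \<times> {True} \<inter> B \<times> {True} = {}" using AB by auto
    fix S :: "('a \<times> bool) set"
    have "r S \<subseteq> E" "r (S \<inter> A \<times> {True}) = r S \<inter> A" "r (S \<inter> B \<times> {True}) = r S \<inter> B"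
      by (auto simp: r_def)
    thus "f (r S) = f (r (S \<inter> A \<times> {True}))" "g (r S) = g (r (S \<inter> B \<times> {True}))"
      using fA gB by auto
  qed
  ultimately show ?thesis by blast
qed

subsection \<open>Newton series in factorial moments\<close>

definition colour_count :: "'i set \<Rightarrow> ('i \<Rightarrow> nat) \<Rightarrow> nat \<Rightarrow> nat" where
  "colour_count J c = (\<lambda>i. card {j \<in> J. c j = i})"

text \<open>Moebius inverse, on the lattice of subsets of \<open>T\<close>, of the function that
  sends \<open>J\<close> to \<open>F\<close> of its colour counts. With a single colour it is the
  iterated forward difference of \<open>F\<close> at 0.\<close>

definition moebius_sum :: "((nat \<Rightarrow> nat) \<Rightarrow> real) \<Rightarrow> 'i set \<Rightarrow> ('i \<Rightarrow> nat) \<Rightarrow> real" where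
  "moebius_sum F T c = (\<Sum>J\<in>Pow T. (-1) ^ (card T - card J) * F (colour_count J c))"

definition tuples :: "nat \<Rightarrow> 'i set \<Rightarrow> ('i \<Rightarrow> nat) \<Rightarrow> (nat \<Rightarrow> nat) \<Rightarrow> (nat \<Rightarrow> 'i) set" where
  "tuples n X c \<gamma> = {t \<in> {..<n} \<rightarrow>\<^sub>E X. inj_on t {..<n} \<and> (\<forall>j<n. c (t j) = \<gamma> j)}"

text \<open>The factorial undoes the counting of each n-element set by its orderings. With a single
  colour this is a term of Newton's forward difference series, averaged by means of the n-th
  factorial moment.\<close>

definition newton_term :: "nat \<Rightarrow> ((nat \<Rightarrow> nat) \<Rightarrow> real) \<Rightarrow> (nat \<Rightarrow> (nat \<Rightarrow> nat) \<Rightarrow> real) \<Rightarrow> nat \<Rightarrow> real" where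
  "newton_term N F m n = (\<Sum>\<gamma>\<in>{..<n} \<rightarrow>\<^sub>E {..<N}. moebius_sum F {..<n} \<gamma> * m n \<gamma>) / fact n"

text \<open>For \<open>m n \<gamma>\<close> the expected number of ordered \<open>n\<close>-tuples of distinct points whose colours are
  \<open>\<gamma>\<close>, this is the expectation of \<open>F\<close> evaluated at the numbers of points of each colour.\<close>

definition newton :: "nat \<Rightarrow> ((nat \<Rightarrow> nat) \<Rightarrow> real) \<Rightarrow> (nat \<Rightarrow> (nat \<Rightarrow> nat) \<Rightarrow> real) \<Rightarrow> real" where
  "newton N F m = (\<Sum>n. newton_term N F m n)"

text \<open>The bound is shaped for the series: with the factor 2^n of
  \<open>moebius_sum_bound\<close> the terms are at most \<open>(2 * C) ^ n / fact n\<close>,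
  uniformly over all sequences with the same \<open>C\<close>.\<close>

definition moment_bounded :: "nat \<Rightarrow> real \<Rightarrow> (nat \<Rightarrow> (nat \<Rightarrow> nat) \<Rightarrow> real) \<Rightarrow> bool" where
  "moment_bounded N C m \<longleftrightarrow> (\<forall>n. (\<forall>\<gamma>\<in>{..<n} \<rightarrow>\<^sub>E {..<N}. 0 \<le> m n \<gamma>) \<and>
     (\<Sum>\<gamma>\<in>{..<n} \<rightarrow>\<^sub>E {..<N}. m n \<gamma>) \<le> C ^ n)"

lemma colour_count_cong: "(\<And>j. j \<in> J \<Longrightarrow> c j = c' j) \<Longrightarrow> colour_count J c = colour_count J c'"
  unfolding colour_count_def by (intro ext arg_cong[of _ _ card]) auto

lemma moebius_sum_cong: "(\<And>j. j \<in> T \<Longrightarrow> c j = c' j) \<Longrightarrow> moebius_sum F T c = moebius_sum F T c'"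
  unfolding moebius_sum_def by (intro sum.cong refl arg_cong2[of _ _ _ _ "(*)"] arg_cong[of _ _ F] colour_count_cong) auto

lemma sum_moebius_sum:
  assumes "finite X"
  shows "(\<Sum>T\<in>Pow X. moebius_sum F T c) = F (colour_count X c)"
proof -
  define g where "g S = (\<Sum>J\<in>Pow S. (-1) ^ card J * F (colour_count J c))" for S
  have "F (colour_count X c) = (\<Sum>T\<in>Pow X. (-1) ^ card T * g T)"
    by (rule inclusion_exclusion_symmetric[of g]) (auto simp: g_def assms)
  also have "\<dots> = (\<Sum>T\<in>Pow X. moebius_sum F T c)"
  proof (intro sum.cong refl)
    fix T assume T: "T \<in> Pow X"
    have "(-1) ^ card T * (-1) ^ card J = ((-1) ^ (card T - card J) :: real)" if "J \<subseteq> T" for J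
    proof -
      have "card J \<le> card T" using that T assms by (meson PowD card_mono finite_subset)
      hence e: "card T + card J = (card T - card J) + 2 * card J" by simp
      have "(-1) ^ card T * (-1) ^ card J = ((-1) ^ (card T + card J) :: real)" by (simp add: power_add)
      also have "\<dots> = (-1) ^ (card T - card J) * ((-1) ^ 2) ^ card J"
        unfolding e by (simp only: power_add power_mult)
      finally show ?thesis by simp
    qed
    thus "(-1) ^ card T * g T = moebius_sum F T c"
      unfolding g_def moebius_sum_def sum_distrib_left by (intro sum.cong refl) (auto simp: mult.assoc[symmetric])
  qed
  finally show ?thesis by simp
qed

lemma colour_count_image: "inj_on t J \<Longrightarrow> colour_count (t ` J) c = colour_count J (c \<circ> t)"
proof (unfold colour_count_def, intro ext)
  fix i assume "inj_on t J"
  hence "inj_on t {j \<in> J. c (t j) = i}" by (auto simp: inj_on_def)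
  moreover have "{j \<in> t ` J. c j = i} = t ` {j \<in> J. c (t j) = i}" by auto
  ultimately show "card {j \<in> t ` J. c j = i} = card {j \<in> J. (c \<circ> t) j = i}" by (simp add: card_image)
qed

lemma moebius_sum_image:
  assumes "inj_on t A"
  shows "moebius_sum F (t ` A) c = moebius_sum F A (c \<circ> t)"
proof -
  have sub: "inj_on t J" if "J \<in> Pow A" for J using assms that by (auto intro: inj_on_subset)
  have "moebius_sum F (t ` A) c = (\<Sum>J\<in>(`) t ` Pow A. (-1) ^ (card (t ` A) - card J) * F (colour_count J c))"
    unfolding moebius_sum_def by (simp add: image_Pow_surj)
  also have "\<dots> = moebius_sum F A (c \<circ> t)"
    unfolding moebius_sum_def using assms
    by (subst sum.reindex[OF inj_on_image_Pow[OF assms]])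
       (auto intro!: sum.cong simp: card_image sub colour_count_image)
  finally show ?thesis .
qed

lemma moebius_sum_bound:
  assumes "\<And>u. \<bar>F u\<bar> \<le> 1" "finite T"
  shows "\<bar>moebius_sum F T c\<bar> \<le> 2 ^ card T"
proof -
  have "\<bar>moebius_sum F T c\<bar> \<le> (\<Sum>J\<in>Pow T. \<bar>(-1) ^ (card T - card J) * F (colour_count J c)\<bar>)"
    unfolding moebius_sum_def by (rule sum_abs)
  also have "\<dots> \<le> (\<Sum>J\<in>Pow T. 1)" using assms(1) by (intro sum_mono) (simp add: abs_mult power_abs)
  also have "\<dots> = 2 ^ card T" using assms(2) by (simp add: card_Pow)
  finally show ?thesis .
qed

lemma card_inj_tuples:
  assumes "finite X"
  shows "card {t \<in> {..<n} \<rightarrow>\<^sub>E X. inj_on t {..<n}} = (\<Prod>i<n. card X - i)"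
  using card_inj_on_subset_funcset[of "{..<n}" X "{..<n}"] assms by (simp add: lessThan_atLeast0)

lemma sum_subsets_tuples:
  fixes G :: "'i set \<Rightarrow> real"
  assumes "finite X"
  shows "(\<Sum>t | t \<in> {..<n} \<rightarrow>\<^sub>E X \<and> inj_on t {..<n}. G (t ` {..<n})) = fact n * (\<Sum>T | T \<subseteq> X \<and> card T = n. G T)"
proof -
  let ?S = "{t \<in> {..<n} \<rightarrow>\<^sub>E X. inj_on t {..<n}}"
  have finS: "finite ?S" using assms by (auto intro!: finite_subset[OF _ finite_PiE[of "{..<n}" "\<lambda>_. X"]])
  have "(\<Sum>t\<in>?S. G (t ` {..<n})) = (\<Sum>T | T \<subseteq> X \<and> card T = n. \<Sum>t | t \<in> ?S \<and> t ` {..<n} = T. G (t ` {..<n}))"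
  proof (rule sum.group[OF finS, symmetric])
    show "finite {T. T \<subseteq> X \<and> card T = n}" using assms by simp
    show "(\<lambda>t. t ` {..<n}) ` ?S \<subseteq> {T. T \<subseteq> X \<and> card T = n}"
    proof (rule image_subsetI)
      fix t assume "t \<in> ?S"
      hence "card (t ` {..<n}) = n" "t ` {..<n} \<subseteq> X" by (auto simp: card_image)
      thus "t ` {..<n} \<in> {T. T \<subseteq> X \<and> card T = n}" by simp
    qed
  qed
  also have "\<dots> = (\<Sum>T | T \<subseteq> X \<and> card T = n. fact n * G T)"
  proof (intro sum.cong refl)
    fix T assume T: "T \<in> {T. T \<subseteq> X \<and> card T = n}"
    hence finT: "finite T" using assms finite_subset by auto
    have "{t. t \<in> ?S \<and> t ` {..<n} = T} = {t \<in> {..<n} \<rightarrow>\<^sub>E T. inj_on t {..<n}}"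
    proof (rule Set.set_eqI, rule iffI)
      fix t assume t: "t \<in> {t \<in> {..<n} \<rightarrow>\<^sub>E T. inj_on t {..<n}}"
      hence "t ` {..<n} \<subseteq> T" "card (t ` {..<n}) = card T" using T by (auto simp: card_image)
      hence "t ` {..<n} = T" using finT by (simp add: card_subset_eq)
      thus "t \<in> {t. t \<in> ?S \<and> t ` {..<n} = T}" using t T by (auto simp: PiE_def)
    qed (auto simp: PiE_def)
    moreover have "card {t \<in> {..<n} \<rightarrow>\<^sub>E T. inj_on t {..<n}} = fact n"
      unfolding card_inj_tuples[OF finT] using T by (simp add: fact_prod_rev lessThan_atLeast0)
    ultimately have "card {t. t \<in> ?S \<and> t ` {..<n} = T} = fact n" by simp
    moreover have "(\<Sum>t | t \<in> ?S \<and> t ` {..<n} = T. G (t ` {..<n})) = (\<Sum>t | t \<in> ?S \<and> t ` {..<n} = T. G T)"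
      by (intro sum.cong refl) auto
    ultimately show "(\<Sum>t | t \<in> ?S \<and> t ` {..<n} = T. G (t ` {..<n})) = fact n * G T" by simp
  qed
  finally show ?thesis by (simp add: sum_distrib_left)
qed

lemma sum_tuples_colours:
  fixes H :: "(nat \<Rightarrow> nat) \<Rightarrow> real"
  assumes "finite X" "c ` X \<subseteq> {..<N}"
  shows "(\<Sum>\<gamma>\<in>{..<n} \<rightarrow>\<^sub>E {..<N}. H \<gamma> * (\<Sum>t\<in>tuples n X c \<gamma>. w t)) =
    (\<Sum>t | t \<in> {..<n} \<rightarrow>\<^sub>E X \<and> inj_on t {..<n}. H (restrict (c \<circ> t) {..<n}) * w t)"
proof -
  let ?S = "{t \<in> {..<n} \<rightarrow>\<^sub>E X. inj_on t {..<n}}"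
  have finS: "finite ?S" using assms by (auto intro!: finite_subset[OF _ finite_PiE[of "{..<n}" "\<lambda>_. X"]])
  have "(\<Sum>t\<in>?S. H (restrict (c \<circ> t) {..<n}) * w t) =
     (\<Sum>\<gamma>\<in>{..<n} \<rightarrow>\<^sub>E {..<N}. \<Sum>t | t \<in> ?S \<and> restrict (c \<circ> t) {..<n} = \<gamma>. H (restrict (c \<circ> t) {..<n}) * w t)"
  proof (rule sum.group[OF finS, symmetric])
    show "finite ({..<n} \<rightarrow>\<^sub>E {..<N})" by (auto intro!: finite_PiE)
    show "(\<lambda>t. restrict (c \<circ> t) {..<n}) ` ?S \<subseteq> {..<n} \<rightarrow>\<^sub>E {..<N}"
      using assms(2) by (fastforce dest: PiE_mem)
  qed
  also have "\<dots> = (\<Sum>\<gamma>\<in>{..<n} \<rightarrow>\<^sub>E {..<N}. H \<gamma> * (\<Sum>t\<in>tuples n X c \<gamma>. w t))"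
  proof (intro sum.cong refl)
    fix \<gamma> assume \<gamma>: "\<gamma> \<in> {..<n} \<rightarrow>\<^sub>E {..<N}"
    have "{t. t \<in> ?S \<and> restrict (c \<circ> t) {..<n} = \<gamma>} = tuples n X c \<gamma>"
      using \<gamma> unfolding tuples_def by (auto simp: fun_eq_iff PiE_def extensional_def)
    moreover have "(\<Sum>t | t \<in> ?S \<and> restrict (c \<circ> t) {..<n} = \<gamma>. H (restrict (c \<circ> t) {..<n}) * w t)
       = (\<Sum>t | t \<in> ?S \<and> restrict (c \<circ> t) {..<n} = \<gamma>. H \<gamma> * w t)"
      by (intro sum.cong refl) auto
    ultimately show "(\<Sum>t | t \<in> ?S \<and> restrict (c \<circ> t) {..<n} = \<gamma>. H (restrict (c \<circ> t) {..<n}) * w t)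
       = H \<gamma> * (\<Sum>t\<in>tuples n X c \<gamma>. w t)" by (simp add: sum_distrib_left)
  qed
  finally show ?thesis by simp
qed

lemma finite_tuples: "finite X \<Longrightarrow> finite (tuples n X c \<gamma>)"
  unfolding tuples_def by (rule finite_subset[OF _ finite_PiE[of "{..<n}" "\<lambda>_. X"]]) auto

lemma tuples_empty: "finite X \<Longrightarrow> card X < n \<Longrightarrow> tuples n X c \<gamma> = {}"
  unfolding tuples_def using card_inj[of _ "{..<n}" X] by (force simp: PiE_def)

lemma newton_term_tuples:
  assumes "finite X" "c ` X \<subseteq> {..<N}"
  shows "newton_term N F (\<lambda>n \<gamma>. real (card (tuples n X c \<gamma>))) n = (\<Sum>T | T \<subseteq> X \<and> card T = n. moebius_sum F T c)"
proof -
  have "(\<Sum>\<gamma>\<in>{..<n} \<rightarrow>\<^sub>E {..<N}. moebius_sum F {..<n} \<gamma> * real (card (tuples n X c \<gamma>)))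
     = (\<Sum>\<gamma>\<in>{..<n} \<rightarrow>\<^sub>E {..<N}. moebius_sum F {..<n} \<gamma> * (\<Sum>t\<in>tuples n X c \<gamma>. 1))" by simp
  also have "\<dots> = (\<Sum>t | t \<in> {..<n} \<rightarrow>\<^sub>E X \<and> inj_on t {..<n}. moebius_sum F {..<n} (restrict (c \<circ> t) {..<n}) * 1)"
    by (rule sum_tuples_colours[OF assms])
  also have "\<dots> = (\<Sum>t | t \<in> {..<n} \<rightarrow>\<^sub>E X \<and> inj_on t {..<n}. moebius_sum F (t ` {..<n}) c)"
  proof (intro sum.cong refl)
    fix t assume "t \<in> {t \<in> {..<n} \<rightarrow>\<^sub>E X. inj_on t {..<n}}"
    hence "moebius_sum F (t ` {..<n}) c = moebius_sum F {..<n} (c \<circ> t)" by (intro moebius_sum_image) auto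
    also have "\<dots> = moebius_sum F {..<n} (restrict (c \<circ> t) {..<n})" by (intro moebius_sum_cong) auto
    finally show "moebius_sum F {..<n} (restrict (c \<circ> t) {..<n}) * 1 = moebius_sum F (t ` {..<n}) c" by simp
  qed
  also have "\<dots> = fact n * (\<Sum>T | T \<subseteq> X \<and> card T = n. moebius_sum F T c)" by (rule sum_subsets_tuples[OF assms(1)])
  finally show ?thesis unfolding newton_term_def by simp
qed

text \<open>For a fixed finite configuration the series is a finite sum, since there are no
  injective n-tuples for n above \<open>card X\<close>; it is Moebius inversion with the subsets
  grouped by size.\<close>

lemma newton_tuples_sums:
  assumes "finite X" "c ` X \<subseteq> {..<N}"
  shows "newton_term N F (\<lambda>n \<gamma>. real (card (tuples n X c \<gamma>))) sums F (colour_count X c)"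
proof -
  have z: "newton_term N F (\<lambda>n \<gamma>. real (card (tuples n X c \<gamma>))) n = 0" if "n \<notin> {..card X}" for n
    using that by (simp add: newton_term_def tuples_empty[OF assms(1)])
  have "F (colour_count X c) = (\<Sum>T\<in>Pow X. moebius_sum F T c)" by (rule sum_moebius_sum[OF assms(1), symmetric])
  also have "\<dots> = (\<Sum>n\<le>card X. \<Sum>T | T \<in> Pow X \<and> card T = n. moebius_sum F T c)"
    using assms(1) by (intro sum.group[symmetric]) (auto intro!: card_mono)
  also have "\<dots> = (\<Sum>n\<le>card X. newton_term N F (\<lambda>n \<gamma>. real (card (tuples n X c \<gamma>))) n)"
    by (simp add: newton_term_tuples[OF assms])
  finally show ?thesis using sums_finite[OF _ z, of "{..card X}"] by simp
qed

lemma newton_term_bound: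
  assumes "\<And>u. \<bar>F u\<bar> \<le> 1" "moment_bounded N C m"
  shows "\<bar>newton_term N F m n\<bar> \<le> (2 * C) ^ n / fact n"
proof -
  let ?P = "{..<n} \<rightarrow>\<^sub>E {..<N}"
  have "\<bar>\<Sum>\<gamma>\<in>?P. moebius_sum F {..<n} \<gamma> * m n \<gamma>\<bar> \<le> (\<Sum>\<gamma>\<in>?P. \<bar>moebius_sum F {..<n} \<gamma> * m n \<gamma>\<bar>)" by (rule sum_abs)
  also have "\<dots> \<le> (\<Sum>\<gamma>\<in>?P. 2 ^ n * m n \<gamma>)"
    using assms(2) moebius_sum_bound[OF assms(1), of "{..<n}"]
    by (intro sum_mono) (auto simp: abs_mult moment_bounded_def intro!: mult_right_mono)
  also have "\<dots> \<le> 2 ^ n * C ^ n"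
    unfolding sum_distrib_left[symmetric] using assms(2) by (intro mult_left_mono) (auto simp: moment_bounded_def)
  finally show ?thesis unfolding newton_term_def by (simp add: power_mult_distrib divide_right_mono)
qed

lemma summable_power_fact: "summable (\<lambda>n. (2 * C) ^ n / fact n :: real)"
  using summable_exp[of "2 * C"] by (simp add: divide_inverse mult.commute)

text \<open>Dominated convergence for series (Tannery): the common bound \<open>C\<close> provides
  one summable majorant.\<close>

lemma newton_tendsto:
  assumes "\<And>u. \<bar>F u\<bar> \<le> 1" "\<And>k. moment_bounded N C (m k)"
    and "\<And>n \<gamma>. \<gamma> \<in> {..<n} \<rightarrow>\<^sub>E {..<N} \<Longrightarrow> (\<lambda>k. m k n \<gamma>) \<longlonglongrightarrow> m' n \<gamma>"
  shows "(\<lambda>k. newton N F (m k)) \<longlonglongrightarrow> newton N F m'"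
proof -
  have "(\<lambda>k. newton_term N F (m k) n) \<longlonglongrightarrow> newton_term N F m' n" for n
    unfolding newton_term_def by (intro tendsto_intros assms(3)) auto
  moreover have "\<forall>\<^sub>F (n, k) in at_top \<times>\<^sub>F sequentially. norm (newton_term N F (m k) n) \<le> (2 * C) ^ n / fact n"
    using newton_term_bound[OF assms(1,2)] by (intro always_eventually) auto
  ultimately show ?thesis
    unfolding newton_def
    using tannerys_theorem[of "\<lambda>n k. newton_term N F (m k) n" "newton_term N F m'" sequentially,
      OF _ _ summable_power_fact[of C]] by simp
qed

lemma moment_bounded_lim:
  assumes "\<And>k. moment_bounded N C (m k)"
    and "\<And>n \<gamma>. \<gamma> \<in> {..<n} \<rightarrow>\<^sub>E {..<N} \<Longrightarrow> (\<lambda>k. m k n \<gamma>) \<longlonglongrightarrow> m' n \<gamma>"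
  shows "moment_bounded N C m'"
  unfolding moment_bounded_def
proof (intro allI conjI ballI)
  fix n :: nat and \<gamma> assume "\<gamma> \<in> {..<n} \<rightarrow>\<^sub>E {..<N}"
  thus "0 \<le> m' n \<gamma>" using assms(1) by (intro LIMSEQ_le_const[OF assms(2)]) (auto simp: moment_bounded_def)
next
  fix n :: nat
  have "(\<lambda>k. \<Sum>\<gamma>\<in>{..<n} \<rightarrow>\<^sub>E {..<N}. m k n \<gamma>) \<longlonglongrightarrow> (\<Sum>\<gamma>\<in>{..<n} \<rightarrow>\<^sub>E {..<N}. m' n \<gamma>)"
    by (intro tendsto_sum assms(2))
  thus "(\<Sum>\<gamma>\<in>{..<n} \<rightarrow>\<^sub>E {..<N}. m' n \<gamma>) \<le> C ^ n"
    by (rule LIMSEQ_le_const2) (use assms(1) in \<open>auto simp: moment_bounded_def\<close>)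
qed

section \<open>Orthant inequality for the moments of finite kernels\<close>

definition lower_orthant :: "nat \<Rightarrow> (nat \<Rightarrow> nat) \<Rightarrow> (nat \<Rightarrow> nat) \<Rightarrow> real" where
  "lower_orthant N b u = of_bool (\<forall>i<N. u i \<le> b i)"

text \<open>Stated for moments and not for a law, so that it survives limits of moment sequences
  before any law with these moments is known.\<close>

definition orthant_dependent :: "nat \<Rightarrow> (nat \<Rightarrow> (nat \<Rightarrow> nat) \<Rightarrow> real) \<Rightarrow> bool" where
  "orthant_dependent N m \<longleftrightarrow>
     (\<forall>b. newton N (lower_orthant N b) m \<le> (\<Prod>i<N. newton N (\<lambda>u. of_bool (u i \<le> b i)) m))"

text \<open>The expected number of tuples coloured by \<open>\<gamma>\<close>, written through
  minors so that it makes sense without a law.\<close>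

definition kernel_moment :: "'i set \<Rightarrow> ('i \<Rightarrow> 'i \<Rightarrow> complex) \<Rightarrow> ('i \<Rightarrow> nat) \<Rightarrow> nat \<Rightarrow> (nat \<Rightarrow> nat) \<Rightarrow> real" where
  "kernel_moment E Q c n \<gamma> = (\<Sum>t\<in>tuples n E c \<gamma>. Re (pminor Q (map t [0..<n])))"

lemma orthant_dependent_lim:
  assumes "\<And>k. moment_bounded N C (m k)" "\<And>k. orthant_dependent N (m k)"
    and "\<And>n \<gamma>. \<gamma> \<in> {..<n} \<rightarrow>\<^sub>E {..<N} \<Longrightarrow> (\<lambda>k. m k n \<gamma>) \<longlonglongrightarrow> m' n \<gamma>"
  shows "orthant_dependent N m'"
  unfolding orthant_dependent_def
proof
  fix b
  have 1: "(\<lambda>k. newton N (lower_orthant N b) (m k)) \<longlonglongrightarrow> newton N (lower_orthant N b) m'"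
    by (rule newton_tendsto[OF _ assms(1,3)]) (auto simp: lower_orthant_def)
  have 2: "(\<lambda>k. \<Prod>i<N. newton N (\<lambda>u. of_bool (u i \<le> b i)) (m k)) \<longlonglongrightarrow> (\<Prod>i<N. newton N (\<lambda>u. of_bool (u i \<le> b i)) m')"
    by (intro tendsto_prod newton_tendsto[OF _ assms(1,3)]) auto
  show "newton N (lower_orthant N b) m' \<le> (\<Prod>i<N. newton N (\<lambda>u. of_bool (u i \<le> b i)) m')"
    by (rule LIMSEQ_le[OF 1 2]) (use assms(2) in \<open>auto simp: orthant_dependent_def\<close>)
qed

text \<open>Both parts come from one law with the minors of \<open>Q\<close>. The moment bound is
  Hadamard's inequality summed over all tuples, where the products of diagonal entries become a
  power of the trace. The orthant inequality is negative association, applied to one colour after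
  the other.\<close>

lemma kernel_moment_inequality:
  assumes "finite E" "psd E Q" "psd E (compl_kernel Q)" "c ` E \<subseteq> {..<N}"
  shows "moment_bounded N (\<Sum>e\<in>E. Re (Q e e)) (kernel_moment E Q c)" (is "?A")
    and "orthant_dependent N (kernel_moment E Q c)" (is "?B")
proof -
  from psd_contraction_dpp[OF assms(1-3)] obtain p where pp: "dpp E Q p \<and>
     (\<forall>f g A B. increasing_on E f \<longrightarrow> increasing_on E g \<longrightarrow> A \<inter> B = {} \<longrightarrow>
     (\<forall>S\<subseteq>E. f S = f (S \<inter> A)) \<longrightarrow> (\<forall>S\<subseteq>E. g S = g (S \<inter> B)) \<longrightarrow>
     expect E p (\<lambda>S. f S * g S) \<le> expect E p f * expect E p g)" ..
  note p = pp[THEN conjunct1] and NA = pp[THEN conjunct2, rule_format]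
  note nn = dpp_nonneg[OF p]
  have fin: "finite S" if "S \<subseteq> E" for S using that assms(1) finite_subset by auto
  have ex_nn: "0 \<le> expect E p h" if "\<And>S. 0 \<le> h S" for h
    unfolding expect_def using nn that by (intro sum_nonneg mult_nonneg_nonneg) auto
  have det: "Re (pminor Q (map t [0..<n])) = expect E p (\<lambda>S. of_bool (t ` {..<n} \<subseteq> S))"
    if "t \<in> {..<n} \<rightarrow>\<^sub>E E" "inj_on t {..<n}" for t and n :: nat
  proof -
    have "distinct (map t [0..<n])" using that by (simp add: distinct_map lessThan_atLeast0)
    moreover have s: "set (map t [0..<n]) = t ` {..<n}" by (simp add: lessThan_atLeast0)
    moreover have "t ` {..<n} \<subseteq> E" using that by auto
    ultimately show ?thesis using dpp_expect[OF assms(1) p, of "map t [0..<n]"] by (metis Re_complex_of_real)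
  qed
  have km: "kernel_moment E Q c n \<gamma> = expect E p (\<lambda>S. real (card (tuples n S c \<gamma>)))" for n \<gamma>
  proof -
    have "kernel_moment E Q c n \<gamma> = (\<Sum>t\<in>tuples n E c \<gamma>. expect E p (\<lambda>S. of_bool (t ` {..<n} \<subseteq> S)))"
      unfolding kernel_moment_def by (intro sum.cong refl det) (auto simp: tuples_def)
    also have "\<dots> = expect E p (\<lambda>S. \<Sum>t\<in>tuples n E c \<gamma>. of_bool (t ` {..<n} \<subseteq> S))"
      by (rule expect_sum[OF finite_tuples[OF assms(1)], symmetric])
    also have "\<dots> = expect E p (\<lambda>S. real (card (tuples n S c \<gamma>)))"
    proof (intro expect_cong refl)
      fix S assume "S \<subseteq> E"
      hence "tuples n S c \<gamma> = tuples n E c \<gamma> \<inter> {t. t ` {..<n} \<subseteq> S}"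
        unfolding tuples_def by (auto simp: PiE_def Pi_def)
      thus "(\<Sum>t\<in>tuples n E c \<gamma>. of_bool (t ` {..<n} \<subseteq> S)) = real (card (tuples n S c \<gamma>))"
        using finite_tuples[OF assms(1)] by (simp add: sum_of_bool_eq)
    qed
    finally show ?thesis .
  qed
  have newt: "newton N F (kernel_moment E Q c) = expect E p (\<lambda>S. F (colour_count S c))" for F
  proof -
    have "newton_term N F (kernel_moment E Q c) n =
        (\<Sum>S\<in>Pow E. p S * newton_term N F (\<lambda>n \<gamma>. real (card (tuples n S c \<gamma>))) n)" for n
    proof -
      have "(\<Sum>\<gamma>\<in>{..<n} \<rightarrow>\<^sub>E {..<N}. moebius_sum F {..<n} \<gamma> * kernel_moment E Q c n \<gamma>) =
        (\<Sum>\<gamma>\<in>{..<n} \<rightarrow>\<^sub>E {..<N}. \<Sum>S\<in>Pow E. p S * (moebius_sum F {..<n} \<gamma> * real (card (tuples n S c \<gamma>))))"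
        unfolding km expect_def sum_distrib_left by (simp add: mult_ac)
      also have "\<dots> = (\<Sum>S\<in>Pow E. \<Sum>\<gamma>\<in>{..<n} \<rightarrow>\<^sub>E {..<N}. p S * (moebius_sum F {..<n} \<gamma> * real (card (tuples n S c \<gamma>))))"
        by (rule sum.swap)
      finally have "(\<Sum>\<gamma>\<in>{..<n} \<rightarrow>\<^sub>E {..<N}. moebius_sum F {..<n} \<gamma> * kernel_moment E Q c n \<gamma>) =
        (\<Sum>S\<in>Pow E. p S * (\<Sum>\<gamma>\<in>{..<n} \<rightarrow>\<^sub>E {..<N}. moebius_sum F {..<n} \<gamma> * real (card (tuples n S c \<gamma>))))"
        by (simp only: sum_distrib_left)
      thus ?thesis
        unfolding newton_term_def by (simp only: sum_divide_distrib[of _ "Pow E"] times_divide_eq_right)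
    qed
    moreover have "(\<lambda>n. \<Sum>S\<in>Pow E. p S * newton_term N F (\<lambda>n \<gamma>. real (card (tuples n S c \<gamma>))) n)
       sums (\<Sum>S\<in>Pow E. p S * F (colour_count S c))"
      using fin assms(4) by (intro sums_sum sums_mult newton_tuples_sums) auto
    ultimately have "newton_term N F (kernel_moment E Q c) sums (\<Sum>S\<in>Pow E. p S * F (colour_count S c))" by presburger
    thus ?thesis unfolding newton_def expect_def by (rule sums_unique[symmetric])
  qed
  \<comment> \<open>Hadamard's inequality for minors, from the negative correlation between the
    presence of all of \<open>T\<close> and the presence of one more point.\<close>
  have had: "expect E p (\<lambda>S. of_bool (T \<subseteq> S)) \<le> (\<Prod>e\<in>T. expect E p (\<lambda>S. of_bool (e \<in> S)))" if "T \<subseteq> E" for T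
    using fin[OF that] that
  proof (induction T rule: finite_induct)
    case empty
    thus ?case using dpp_total[OF assms(1) p] by simp
  next
    case (insert e T)
    have "expect E p (\<lambda>S. of_bool (T \<subseteq> S) * of_bool (e \<in> S))
      \<le> expect E p (\<lambda>S. of_bool (T \<subseteq> S)) * expect E p (\<lambda>S. of_bool (e \<in> S))"
      by (rule NA[of _ _ T "{e}"]) (use insert.hyps in \<open>auto simp: increasing_on_def\<close>)
    also have "\<dots> \<le> (\<Prod>e\<in>T. expect E p (\<lambda>S. of_bool (e \<in> S))) * expect E p (\<lambda>S. of_bool (e \<in> S))"
      using insert by (intro mult_right_mono ex_nn) auto
    also have "(\<lambda>S. of_bool (T \<subseteq> S) * of_bool (e \<in> S)) = (\<lambda>S. of_bool (Set.insert e T \<subseteq> S) :: real)" by auto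
    finally show ?case using insert.hyps by (simp add: mult.commute)
  qed
  show ?A
    unfolding moment_bounded_def
  proof (intro allI conjI ballI)
    fix n \<gamma> show "0 \<le> kernel_moment E Q c n \<gamma>" unfolding km by (intro ex_nn) auto
  next
    fix n
    let ?q = "\<lambda>e. expect E p (\<lambda>S. of_bool (e \<in> S))"
    have "(\<Sum>\<gamma>\<in>{..<n} \<rightarrow>\<^sub>E {..<N}. kernel_moment E Q c n \<gamma>)
      = (\<Sum>\<gamma>\<in>{..<n} \<rightarrow>\<^sub>E {..<N}. 1 * (\<Sum>t\<in>tuples n E c \<gamma>. Re (pminor Q (map t [0..<n]))))"
      unfolding kernel_moment_def by simp
    also have "\<dots> = (\<Sum>t | t \<in> {..<n} \<rightarrow>\<^sub>E E \<and> inj_on t {..<n}. 1 * Re (pminor Q (map t [0..<n])))"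
      by (rule sum_tuples_colours[OF assms(1,4)])
    also have "\<dots> \<le> (\<Sum>t | t \<in> {..<n} \<rightarrow>\<^sub>E E \<and> inj_on t {..<n}. \<Prod>j<n. ?q (t j))"
    proof (intro sum_mono)
      fix t assume t: "t \<in> {t \<in> {..<n} \<rightarrow>\<^sub>E E. inj_on t {..<n}}"
      hence "t ` {..<n} \<subseteq> E" by auto
      from had[OF this] show "1 * Re (pminor Q (map t [0..<n])) \<le> (\<Prod>j<n. ?q (t j))"
        using t by (simp add: det prod.reindex)
    qed
    \<comment> \<open>Non-injective tuples are added to complete the sum to an n-th power.\<close>
    also have "\<dots> \<le> (\<Sum>t\<in>{..<n} \<rightarrow>\<^sub>E E. \<Prod>j<n. ?q (t j))"
    proof (rule sum_mono2)
      show "finite ({..<n} \<rightarrow>\<^sub>E E)" using assms(1) by (intro finite_PiE) auto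
      show "0 \<le> (\<Prod>j<n. ?q (t j))" for t by (intro prod_nonneg ballI ex_nn) simp
    qed auto
    also have "\<dots> = (\<Prod>j<n. \<Sum>e\<in>E. ?q e)"
      using assms(1) by (intro prod_sum_PiE[symmetric]) auto
    also have "\<dots> = (\<Sum>e\<in>E. Re (Q e e)) ^ n"
    proof -
      have "?q e = Re (Q e e)" if "e \<in> E" for e using dpp_single[OF assms(1) p that] by (metis Re_complex_of_real)
      thus ?thesis by simp
    qed
    finally show "(\<Sum>\<gamma>\<in>{..<n} \<rightarrow>\<^sub>E {..<N}. kernel_moment E Q c n \<gamma>) \<le> (\<Sum>e\<in>E. Re (Q e e)) ^ n" .
  qed
  show ?B
    unfolding orthant_dependent_def newt
  proof
    fix b
    define D where "D i S = (of_bool (colour_count S c i \<le> b i) :: real)" for i S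
    have D_mono: "D i T \<le> D i S" if "S \<subseteq> T" "T \<subseteq> E" for i S T
    proof -
      have "colour_count S c i \<le> colour_count T c i" unfolding colour_count_def using that fin[of T] by (intro card_mono) auto
      thus ?thesis by (auto simp: D_def)
    qed
    have D_dep: "D i (S \<inter> A) = D i S" if "{e \<in> E. c e = i} \<subseteq> A" "S \<subseteq> E" for i S A
    proof -
      have "{j \<in> S \<inter> A. c j = i} = {j \<in> S. c j = i}" using that by auto
      thus ?thesis by (simp add: D_def colour_count_def)
    qed
    have D01: "0 \<le> D i S" for i S by (simp add: D_def)
    have neg: "expect E p (\<lambda>S. - h S) = - expect E p h" for h using expect_cmult[of E p "-1" h] by simp
    have "expect E p (\<lambda>S. \<Prod>i<k. D i S) \<le> (\<Prod>i<k. expect E p (D i))" for k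
    proof (induction k)
      case 0
      thus ?case using dpp_total[OF assms(1) p] by simp
    next
      case (Suc k)
      \<comment> \<open>The factors are decreasing; negating both makes them increasing and leaves
        their product unchanged.\<close>
      have "expect E p (\<lambda>S. (- (\<Prod>i<k. D i S)) * (- D k S)) \<le> expect E p (\<lambda>S. - (\<Prod>i<k. D i S)) * expect E p (\<lambda>S. - D k S)"
      proof (rule NA)
        show "increasing_on E (\<lambda>S. - (\<Prod>i<k. D i S))" "increasing_on E (\<lambda>S. - D k S)"
          unfolding increasing_on_def using D_mono D01 by (auto intro!: prod_mono)
        show "{e \<in> E. c e < k} \<inter> {e \<in> E. c e = k} = {}" by auto
        fix S assume S: "S \<subseteq> E"
        show "- (\<Prod>i<k. D i S) = - (\<Prod>i<k. D i (S \<inter> {e \<in> E. c e < k}))"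
          using S by (intro arg_cong[of _ _ uminus] prod.cong refl D_dep[symmetric]) auto
        show "- D k S = - D k (S \<inter> {e \<in> E. c e = k})"
          using S by (intro arg_cong[of _ _ uminus] D_dep[symmetric]) auto
      qed
      hence "expect E p (\<lambda>S. \<Prod>i<Suc k. D i S) \<le> expect E p (\<lambda>S. \<Prod>i<k. D i S) * expect E p (D k)"
        by (simp add: neg)
      also have "\<dots> \<le> (\<Prod>i<k. expect E p (D i)) * expect E p (D k)"
        using Suc D01 by (intro mult_right_mono ex_nn) auto
      finally show ?case by simp
    qed
    moreover have "lower_orthant N b (colour_count S c) = (\<Prod>i<N. D i S)" for S
      unfolding lower_orthant_def D_def by (induction N) (auto simp: less_Suc_eq)
    ultimately show "expect E p (\<lambda>S. lower_orthant N b (colour_count S c)) \<le> (\<Prod>i<N. expect E p (\<lambda>S. of_bool (colour_count S c i \<le> b i)))"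
      by (simp add: D_def[abs_def])
  qed
qed

subsection \<open>Step kernels\<close>

lemma pminor_diagonal_scaling:
  fixes Q :: "nat \<Rightarrow> nat \<Rightarrow> complex"
  shows "pminor (\<lambda>i j. a i * Q i j * a j) [0..<n] = (\<Prod>i<n. a i * a i) * pminor Q [0..<n]"
proof -
  let ?A = "Matrix.mat n n (\<lambda>(i, j). Q i j)"
  let ?B = "Matrix.mat n n (\<lambda>(i, j). a i * Q i j * a j)"
  have "signof p * (\<Prod>i = 0..<n. ?B $$ (i, p i)) = (\<Prod>i<n. a i * a i) * (signof p * (\<Prod>i = 0..<n. ?A $$ (i, p i)))"
    if p: "p permutes {0..<n}" for p
  proof -
    have pin: "p i < n" if "i < n" for i using permutes_in_image[OF p, of i] that by simp
    have "(\<Prod>i = 0..<n. ?B $$ (i, p i)) = (\<Prod>i = 0..<n. a i * ?A $$ (i, p i) * a (p i))"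
      by (intro prod.cong refl) (simp add: pin)
    also have "\<dots> = (\<Prod>i = 0..<n. a i) * (\<Prod>i = 0..<n. ?A $$ (i, p i)) * (\<Prod>i = 0..<n. a (p i))"
      by (simp add: prod.distrib)
    also have "(\<Prod>i = 0..<n. a (p i)) = (\<Prod>i = 0..<n. a i)"
      using prod.permute[OF p, of a] by (simp add: o_def)
    finally show ?thesis by (simp add: prod.distrib lessThan_atLeast0 mult_ac)
  qed
  hence "(\<Sum>p | p permutes {0..<n}. signof p * (\<Prod>i = 0..<n. ?B $$ (i, p i)))
     = (\<Prod>i<n. a i * a i) * (\<Sum>p | p permutes {0..<n}. signof p * (\<Prod>i = 0..<n. ?A $$ (i, p i)))"
    unfolding sum_distrib_left by (intro sum.cong refl) blast
  hence "Determinant.det ?B = (\<Prod>i<n. a i * a i) * Determinant.det ?A"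
    using det_def'[of ?A n] det_def'[of ?B n] by simp
  moreover have "pminor Q [0..<n] = Determinant.det ?A" "pminor (\<lambda>i j. a i * Q i j * a j) [0..<n] = Determinant.det ?B"
    unfolding pminor_def by (auto intro!: arg_cong[of _ _ Determinant.det] eq_matI)
  ultimately show ?thesis by simp
qed

lemma pminor_map: "pminor Q (map t xs) = pminor (\<lambda>i j. Q (t i) (t j)) xs"
  unfolding pminor_def by (intro arg_cong[of _ _ Determinant.det] eq_matI) auto

text \<open>The step kernel at a tuple of cells \<open>c\<close>. The case distinction is on the
  positions i and j, not on the cells: two different points of one cell see the average of K over
  the square of the cell, and only a point paired with itself sees the mean of K(x,x).\<close>

definition cell_kernel :: "(nat \<Rightarrow> real) \<Rightarrow> (nat \<Rightarrow> nat \<Rightarrow> complex) \<Rightarrow> (nat \<Rightarrow> real) \<Rightarrow> (nat \<Rightarrow> nat) \<Rightarrow> nat \<Rightarrow> nat \<Rightarrow> complex" where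
  "cell_kernel w g d c i j = (if i = j then complex_of_real (d (c i) / w (c i))
     else g (c i) (c j) / complex_of_real (w (c i) * w (c j)))"

text \<open>The integral of the n-point intensity of the step kernel over the box with sides the
  cells \<open>c j\<close>.\<close>

definition cell_weight :: "(nat \<Rightarrow> real) \<Rightarrow> (nat \<Rightarrow> nat \<Rightarrow> complex) \<Rightarrow> (nat \<Rightarrow> real) \<Rightarrow> nat \<Rightarrow> (nat \<Rightarrow> nat) \<Rightarrow> real" where
  "cell_weight w g d n c = (\<Prod>j<n. w (c j)) * Re (pminor (cell_kernel w g d c) [0..<n])"

definition cell_moment :: "nat \<Rightarrow> (nat \<Rightarrow> real) \<Rightarrow> (nat \<Rightarrow> nat \<Rightarrow> complex) \<Rightarrow> (nat \<Rightarrow> real) \<Rightarrow> (nat \<Rightarrow> nat) \<Rightarrow> nat \<Rightarrow> (nat \<Rightarrow> nat) \<Rightarrow> real" where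
  "cell_moment M w g d cl n \<gamma> =
     (\<Sum>c | c \<in> {..<n} \<rightarrow>\<^sub>E {..<M} \<and> (\<forall>j<n. cl (c j) = \<gamma> j). cell_weight w g d n c)"

text \<open>Choosing a copy at each position gives at most L^n tuples; choosing pairwise different
  copies always gives an injective one, whatever coincidences \<open>c\<close> has. Both bounds are
  asymptotic to L^n.\<close>

lemma card_coloured_tuples:
  fixes M L :: nat
  assumes "c \<in> {..<n} \<rightarrow>\<^sub>E {..<M}"
  shows "card {t \<in> {..<n} \<rightarrow>\<^sub>E {..<M} \<times> {..<L}. inj_on t {..<n} \<and> restrict (fst \<circ> t) {..<n} = c} \<le> L ^ n" (is "card ?T \<le> _")
    and "(\<Prod>i<n. L - i) \<le> card {t \<in> {..<n} \<rightarrow>\<^sub>E {..<M} \<times> {..<L}. inj_on t {..<n} \<and> restrict (fst \<circ> t) {..<n} = c}"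
proof -
  have fst: "fst (t j) = c j" if "t \<in> ?T" "j < n" for t j
  proof -
    have "restrict (fst \<circ> t) {..<n} = c" using that(1) by simp
    from fun_cong[OF this, of j] show ?thesis using that(2) by simp
  qed
  have "card ?T \<le> card ({..<n} \<rightarrow>\<^sub>E {..<L})"
  proof (rule card_inj_on_le[of "\<lambda>t. restrict (snd \<circ> t) {..<n}"])
    show "inj_on (\<lambda>t. restrict (snd \<circ> t) {..<n}) ?T"
    proof (rule inj_onI)
      fix s t assume st: "s \<in> ?T" "t \<in> ?T" "restrict (snd \<circ> s) {..<n} = restrict (snd \<circ> t) {..<n}"
      have "s j = t j" if "j < n" for j
        using fst[OF st(1) that] fst[OF st(2) that] fun_cong[OF st(3), of j] that by (auto intro!: prod_eqI)
      moreover have "s j = t j" if "\<not> j < n" for j using st(1,2) that by (auto simp: PiE_def extensional_def)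
      ultimately show "s = t" by blast
    qed
    show "(\<lambda>t. restrict (snd \<circ> t) {..<n}) ` ?T \<subseteq> {..<n} \<rightarrow>\<^sub>E {..<L}"
    proof (rule image_subsetI)
      fix t assume "t \<in> ?T"
      hence t: "t j \<in> {..<M} \<times> {..<L}" if "j < n" for j using that by (auto simp: PiE_def Pi_def)
      hence "snd (t j) < L" if "j < n" for j using t[OF that] by (cases "t j") auto
      thus "restrict (snd \<circ> t) {..<n} \<in> {..<n} \<rightarrow>\<^sub>E {..<L}" by auto
    qed
  qed (auto intro!: finite_PiE)
  thus "card ?T \<le> L ^ n" by (simp add: card_funcsetE)
  let ?l = "\<lambda>l. restrict (\<lambda>j. (c j, l j)) {..<n}"
  have "card {l \<in> {..<n} \<rightarrow>\<^sub>E {..<L}. inj_on l {..<n}} \<le> card ?T"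
  proof (rule card_inj_on_le[of ?l])
    show "inj_on ?l {l \<in> {..<n} \<rightarrow>\<^sub>E {..<L}. inj_on l {..<n}}"
    proof (rule inj_onI)
      fix s t assume st: "s \<in> {l \<in> {..<n} \<rightarrow>\<^sub>E {..<L}. inj_on l {..<n}}" "t \<in> {l \<in> {..<n} \<rightarrow>\<^sub>E {..<L}. inj_on l {..<n}}" "?l s = ?l t"
      have "s j = t j" if "j < n" for j using fun_cong[OF st(3), of j] that by auto
      moreover have "s j = t j" if "\<not> j < n" for j using st(1,2) that by (auto simp: PiE_def extensional_def)
      ultimately show "s = t" by blast
    qed
    show "?l ` {l \<in> {..<n} \<rightarrow>\<^sub>E {..<L}. inj_on l {..<n}} \<subseteq> ?T"
    proof (rule image_subsetI)
      fix l assume l: "l \<in> {l \<in> {..<n} \<rightarrow>\<^sub>E {..<L}. inj_on l {..<n}}"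
      have "l j < L" "c j < M" if "j < n" for j using l assms that by (auto simp: PiE_def Pi_def)
      moreover have "inj_on (?l l) {..<n}" using l by (auto simp: inj_on_def)
      moreover have "restrict (fst \<circ> ?l l) {..<n} = c"
        using assms by (auto simp: fun_eq_iff PiE_def extensional_def restrict_def)
      ultimately show "?l l \<in> ?T" by auto
    qed
    show "finite ?T" by (rule finite_subset[OF _ finite_PiE[of "{..<n}" "\<lambda>_. {..<M} \<times> {..<L}"]]) auto
  qed
  thus "(\<Prod>i<n. L - i) \<le> card ?T" by (simp add: card_inj_tuples)
qed

lemma falling_power_ratio:
  "(\<lambda>L. real (\<Prod>i<n. Suc L - i) / real (Suc L) ^ n) \<longlonglongrightarrow> 1"
proof -
  have 1: "(\<lambda>L. (real (Suc L) - real i) / real (Suc L)) \<longlonglongrightarrow> 1" for i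
  proof -
    have "(\<lambda>L. 1 - real i * inverse (real (Suc L))) \<longlonglongrightarrow> 1 - real i * 0"
      by (intro tendsto_intros LIMSEQ_inverse_real_of_nat)
    thus ?thesis by (simp add: field_simps)
  qed
  have "(\<lambda>L. \<Prod>i<n. (real (Suc L) - real i) / real (Suc L)) \<longlonglongrightarrow> (\<Prod>i<n. 1)"
    by (intro tendsto_prod 1)
  moreover have "\<forall>\<^sub>F L in sequentially. (\<Prod>i<n. (real (Suc L) - real i) / real (Suc L)) = real (\<Prod>i<n. Suc L - i) / real (Suc L) ^ n"
    using eventually_ge_at_top[of n]
    by eventually_elim (simp add: prod_dividef of_nat_diff)
  ultimately show ?thesis by (simp add: tendsto_cong)
qed

lemma cauchy_schwarz_count:
  fixes u :: "'l \<Rightarrow> complex"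
  assumes "finite I"
  shows "(cmod (\<Sum>l\<in>I. u l))\<^sup>2 \<le> real (card I) * (\<Sum>l\<in>I. (cmod (u l))\<^sup>2)"
proof -
  have "(cmod (\<Sum>l\<in>I. u l))\<^sup>2 \<le> (\<Sum>l\<in>I. cmod (u l))\<^sup>2" by (intro power_mono norm_sum) auto
  also have "\<dots> = (\<Sum>l\<in>I. 1 * cmod (u l))\<^sup>2" by simp
  also have "\<dots> \<le> (\<Sum>l\<in>I. 1\<^sup>2) * (\<Sum>l\<in>I. (cmod (u l))\<^sup>2)" by (rule Cauchy_Schwarz_ineq_sum)
  finally show ?thesis by simp
qed

text \<open>The step kernel with an enlarged diagonal is the limit of honest kernels in which every
  cell is split into \<open>L\<close> points: off the diagonal all copies see the same value, so the excess on
  the diagonal is diluted like \<open>1/L\<close>. The numbers \<open>w\<close>, \<open>g\<close> and \<open>d\<close> stand for the integrals of 1, of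
  \<open>K(x,y)\<close> and of \<open>K(x,x)\<close> over cells, and \<open>cl\<close> for the set \<open>A i\<close> in which a cell lies.\<close>

locale cells =
  fixes M N :: nat and w :: "nat \<Rightarrow> real" and g :: "nat \<Rightarrow> nat \<Rightarrow> complex" and d :: "nat \<Rightarrow> real"
    and cl :: "nat \<Rightarrow> nat" and B :: real
  assumes w: "\<And>c. c < M \<Longrightarrow> 0 \<le> w c"
    and herm: "\<And>a b. a < M \<Longrightarrow> b < M \<Longrightarrow> g b a = cnj (g a b)"
    and quad_ge: "\<And>u. 0 \<le> Re (\<Sum>a<M. \<Sum>b<M. cnj (u a) * g a b * u b)"
    and quad_le: "\<And>u. Re (\<Sum>a<M. \<Sum>b<M. cnj (u a) * g a b * u b) \<le> (\<Sum>a<M. (cmod (u a))\<^sup>2 * w a)"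
    and d0: "\<And>c. c < M \<Longrightarrow> 0 \<le> d c" and dB: "\<And>c. c < M \<Longrightarrow> d c \<le> B"
    and d_null: "\<And>c. c < M \<Longrightarrow> w c = 0 \<Longrightarrow> d c = 0"
    and diag: "\<And>c. c < M \<Longrightarrow> Re (g c c) / w c \<le> d c"
    and cl: "\<And>c. c < M \<Longrightarrow> cl c < N"
begin

text \<open>Matrix of the operator in the orthonormal system of normalised cell indicators. At a
  cell of measure zero the division returns 0.\<close>

definition G :: "nat \<Rightarrow> nat \<Rightarrow> complex" where
  "G a b = g a b / complex_of_real (sqrt (w a) * sqrt (w b))"

text \<open>The scaling that keeps the split kernel below 1: the averaged part contributes at most 1
  to the norm and the excess on the diagonal at most \<open>B / L\<close>.\<close>

definition s :: "nat \<Rightarrow> real" where "s L = real L / (real L + B)"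

text \<open>The points are pairs of a cell and the number of a copy, and each copy carries the share
  1/L. Different copies of the same cell see the entry of \<open>G\<close>, so only L of the L^2
  entries of a diagonal block carry \<open>d\<close>.\<close>

definition split_kernel :: "nat \<Rightarrow> nat \<times> nat \<Rightarrow> nat \<times> nat \<Rightarrow> complex" where
  "split_kernel L x y = complex_of_real (s L / real L) *
     (if x = y then complex_of_real (d (fst x)) else G (fst x) (fst y))"

lemma G_diag: "c < M \<Longrightarrow> G c c = complex_of_real (Re (g c c) / w c)"
proof -
  assume c: "c < M"
  have "g c c = complex_of_real (Re (g c c))" using herm[OF c c] by (simp add: complex_eq_iff)
  moreover have "sqrt (w c) * sqrt (w c) = w c" using w[OF c] by simp
  ultimately show ?thesis unfolding G_def by (metis of_real_divide)
qed

lemma g_diag_nonneg: "c < M \<Longrightarrow> 0 \<le> Re (g c c)"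
proof -
  assume c: "c < M"
  have "(\<Sum>a<M. \<Sum>b<M. cnj (of_bool (a = c)) * g a b * of_bool (b = c)) = g c c"
  proof -
    have "(\<Sum>a<M. \<Sum>b<M. cnj (of_bool (a = c)) * g a b * of_bool (b = c)) =
      (\<Sum>a<M. \<Sum>b<M. if b = c then (if a = c then g c c else 0) else 0)"
      by (intro sum.cong refl) auto
    thus ?thesis using c by simp
  qed
  thus ?thesis using quad_ge[of "\<lambda>a. of_bool (a = c)"] by simp
qed

lemma B_nonneg: "0 < M \<Longrightarrow> 0 \<le> B"
  using d0[of 0] dB[of 0] by simp

text \<open>The form is \<open>r * (q + e)\<close>, with q the form of \<open>g\<close> at the
  normalised sums over copies and e the excess on the diagonal. Cauchy-Schwarz over the copies gives
  \<open>q \<le> L * U\<close>, the bound on \<open>d\<close> gives \<open>e \<le> B * U\<close>,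
  and r is 1 / (L + B). The sign of e is the hypothesis \<open>diag\<close>.\<close>

lemma split_quad:
  fixes u :: "nat \<times> nat \<Rightarrow> complex"
  assumes "0 < L"
  defines "E \<equiv> {..<M} \<times> {..<L}"
  defines "U \<equiv> (\<Sum>x\<in>E. (cmod (u x))\<^sup>2)"
  shows "0 \<le> Re (\<Sum>x\<in>E. \<Sum>y\<in>E. cnj (u x) * split_kernel L x y * u y)"
    and "Re (\<Sum>x\<in>E. \<Sum>y\<in>E. cnj (u x) * split_kernel L x y * u y) \<le> U"
proof -
  have finE: "finite E" by (simp add: E_def)
  define v where "v a = (\<Sum>l<L. u (a, l))" for a
  define \<alpha> where "\<alpha> a = v a / complex_of_real (sqrt (w a))" for a
  define q where "q = Re (\<Sum>a<M. \<Sum>b<M. cnj (\<alpha> a) * g a b * \<alpha> b)"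
  define e where "e = (\<Sum>x\<in>E. (cmod (u x))\<^sup>2 * (d (fst x) - Re (g (fst x) (fst x)) / w (fst x)))"
  define r where "r = s L / real L"
  have "cnj (u x) * split_kernel L x y * u y = complex_of_real r * (cnj (u x) * G (fst x) (fst y) * u y)
      + (if x = y then complex_of_real (r * ((cmod (u x))\<^sup>2 * (d (fst x) - Re (g (fst x) (fst x)) / w (fst x)))) else 0)"
    if "x \<in> E" "y \<in> E" for x y
  proof (cases "x = y")
    case True
    have f: "fst x < M" using that by (auto simp: E_def)
    have "cnj (u x) * u x = complex_of_real ((cmod (u x))\<^sup>2)" by (metis complex_norm_square mult.commute)
    hence c: "cnj (u x) * z * u x = complex_of_real ((cmod (u x))\<^sup>2) * z" for z by (metis mult.assoc mult.commute)
    show ?thesis unfolding True[symmetric] c G_diag[OF f] split_kernel_def r_def by (simp add: algebra_simps)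
  qed (simp add: split_kernel_def r_def)
  hence "(\<Sum>x\<in>E. \<Sum>y\<in>E. cnj (u x) * split_kernel L x y * u y) =
     complex_of_real r * (\<Sum>x\<in>E. \<Sum>y\<in>E. cnj (u x) * G (fst x) (fst y) * u y) + complex_of_real (r * e)"
    using finE by (simp add: sum.distrib sum_distrib_left e_def)
  also have "(\<Sum>x\<in>E. \<Sum>y\<in>E. cnj (u x) * G (fst x) (fst y) * u y) = (\<Sum>a<M. \<Sum>b<M. cnj (\<alpha> a) * g a b * \<alpha> b)"
  proof -
    have E: "(\<Sum>x\<in>E. h x) = (\<Sum>a<M. \<Sum>l<L. h (a, l))" for h :: "nat \<times> nat \<Rightarrow> complex"
      by (simp add: E_def sum.cartesian_product)
    have "(\<Sum>x\<in>E. \<Sum>y\<in>E. cnj (u x) * G (fst x) (fst y) * u y) =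
      (\<Sum>a<M. \<Sum>l<L. \<Sum>b<M. \<Sum>l'<L. cnj (u (a, l)) * G a b * u (b, l'))"
      by (simp only: E fst_conv)
    also have "\<dots> = (\<Sum>a<M. \<Sum>b<M. \<Sum>l<L. \<Sum>l'<L. cnj (u (a, l)) * G a b * u (b, l'))"
      by (rule sum.cong[OF refl], rule sum.swap)
    also have "\<dots> = (\<Sum>a<M. \<Sum>b<M. cnj (v a) * G a b * v b)"
    proof -
      have "cnj (v a) * G a b * v b = (\<Sum>l<L. \<Sum>l'<L. cnj (u (a, l)) * G a b * u (b, l'))" for a b
        unfolding v_def cnj_sum sum_distrib_right[of "\<lambda>l. cnj (u (a, l))" _ "G a b"] sum_product by simp
      thus ?thesis by simp
    qed
    also have "\<dots> = (\<Sum>a<M. \<Sum>b<M. cnj (\<alpha> a) * g a b * \<alpha> b)"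
      unfolding \<alpha>_def G_def by simp
    finally show ?thesis .
  qed
  finally have tot: "Re (\<Sum>x\<in>E. \<Sum>y\<in>E. cnj (u x) * split_kernel L x y * u y) = r * (q + e)"
    by (simp add: q_def algebra_simps)
  have q0: "0 \<le> q" unfolding q_def by (rule quad_ge)
  have "q \<le> (\<Sum>a<M. (cmod (\<alpha> a))\<^sup>2 * w a)" unfolding q_def by (rule quad_le)
  also have "\<dots> \<le> (\<Sum>a<M. real L * (\<Sum>l<L. (cmod (u (a, l)))\<^sup>2))"
  proof (rule sum_mono)
    fix a assume "a \<in> {..<M}"
    hence "0 \<le> w a" using w by simp
    hence "(cmod (\<alpha> a))\<^sup>2 * w a \<le> (cmod (v a))\<^sup>2" by (simp add: \<alpha>_def norm_divide power_divide)
    also have "\<dots> \<le> real L * (\<Sum>l<L. (cmod (u (a, l)))\<^sup>2)"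
      unfolding v_def using cauchy_schwarz_count[of "{..<L}" "\<lambda>l. u (a, l)"] by simp
    finally show "(cmod (\<alpha> a))\<^sup>2 * w a \<le> real L * (\<Sum>l<L. (cmod (u (a, l)))\<^sup>2)" .
  qed
  also have "\<dots> = real L * U"
    unfolding U_def E_def by (simp add: sum_distrib_left[symmetric] sum.cartesian_product)
  finally have qU: "q \<le> real L * U" .
  have e0: "0 \<le> e" unfolding e_def using diag by (intro sum_nonneg mult_nonneg_nonneg) (auto simp: E_def)
  have "e \<le> (\<Sum>x\<in>E. (cmod (u x))\<^sup>2 * B)"
    unfolding e_def
  proof (intro sum_mono mult_left_mono)
    fix x assume "x \<in> E"
    hence f: "fst x < M" by (auto simp: E_def)
    have "0 \<le> Re (g (fst x) (fst x)) / w (fst x)" using g_diag_nonneg[OF f] w[OF f] by simp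
    thus "d (fst x) - Re (g (fst x) (fst x)) / w (fst x) \<le> B" using dB[OF f] by simp
  qed auto
  hence eU: "e \<le> B * U" unfolding U_def by (simp add: sum_distrib_left mult.commute)
  show "0 \<le> Re (\<Sum>x\<in>E. \<Sum>y\<in>E. cnj (u x) * split_kernel L x y * u y)"
    and "Re (\<Sum>x\<in>E. \<Sum>y\<in>E. cnj (u x) * split_kernel L x y * u y) \<le> U"
  proof -
    have "0 \<le> r * (q + e) \<and> r * (q + e) \<le> U"
    proof (cases "M = 0")
      case True
      hence "E = {}" by (simp add: E_def)
      hence "U = 0" "e = 0" by (simp_all add: U_def e_def)
      moreover have "q = 0" using True by (simp add: q_def)
      ultimately show ?thesis by simp
    next
      case False
      hence B: "0 \<le> B" using B_nonneg by simp
      have r: "r = 1 / (real L + B)" "0 < real L + B" using assms(1) B by (auto simp: r_def s_def)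
      have "r * (q + e) \<le> r * ((real L + B) * U)"
        using qU eU r by (intro mult_left_mono) (auto simp: algebra_simps)
      also have "\<dots> = U" using r by simp
      finally show ?thesis using q0 e0 r by simp
    qed
    thus "0 \<le> Re (\<Sum>x\<in>E. \<Sum>y\<in>E. cnj (u x) * split_kernel L x y * u y)"
      and "Re (\<Sum>x\<in>E. \<Sum>y\<in>E. cnj (u x) * split_kernel L x y * u y) \<le> U" unfolding tot by auto
  qed
qed

lemma split_kernel_psd:
  assumes "0 < L"
  shows "psd ({..<M} \<times> {..<L}) (split_kernel L)" "psd ({..<M} \<times> {..<L}) (compl_kernel (split_kernel L))"
proof -
  let ?E = "{..<M} \<times> {..<L}"
  have h: "split_kernel L y x = cnj (split_kernel L x y)" if "x \<in> ?E" "y \<in> ?E" for x y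
    using that herm[of "fst x" "fst y"] by (auto simp: split_kernel_def G_def mult.commute)
  show "psd ?E (split_kernel L)" unfolding psd_def using h split_quad(1)[OF assms] by blast
  have "0 \<le> Re (\<Sum>x\<in>?E. \<Sum>y\<in>?E. cnj (u x) * compl_kernel (split_kernel L) x y * u y)" for u
  proof -
    have "(\<Sum>x\<in>?E. \<Sum>y\<in>?E. cnj (u x) * of_bool (x = y) * u y) = (\<Sum>x\<in>?E. cnj (u x) * u x)"
      by (intro sum.cong refl) (simp add: of_bool_def if_distrib if_distribR cong: if_cong)
    hence "(\<Sum>x\<in>?E. \<Sum>y\<in>?E. cnj (u x) * compl_kernel (split_kernel L) x y * u y) =
      complex_of_real (\<Sum>x\<in>?E. (cmod (u x))\<^sup>2) - (\<Sum>x\<in>?E. \<Sum>y\<in>?E. cnj (u x) * split_kernel L x y * u y)"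
      unfolding sum_norm_square[symmetric] compl_kernel_def
      by (simp only: right_diff_distrib left_diff_distrib sum_subtractf)
    thus ?thesis using split_quad(2)[OF assms, of u] by simp
  qed
  moreover have "compl_kernel (split_kernel L) y x = cnj (compl_kernel (split_kernel L) x y)"
    if "x \<in> ?E" "y \<in> ?E" for x y using h[OF that] by (auto simp: compl_kernel_def)
  ultimately show "psd ?E (compl_kernel (split_kernel L))" unfolding psd_def by blast
qed

lemma pminor_split_kernel:
  assumes "0 < L" "t \<in> {..<n} \<rightarrow>\<^sub>E {..<M} \<times> {..<L}" "inj_on t {..<n}"
  shows "Re (pminor (split_kernel L) (map t [0..<n])) = (s L / real L) ^ n * cell_weight w g d n (restrict (fst \<circ> t) {..<n})"
proof -
  define c where "c = restrict (fst \<circ> t) {..<n}"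
  have c: "c i = fst (t i)" "c i < M" if "i < n" for i
    using assms(2) that by (auto simp: c_def PiE_def Pi_def mem_Times_iff)
  show ?thesis
  proof (cases "n = 0 \<or> M = 0")
    case True
    thus ?thesis using c(2)[of 0] by (cases "n = 0") (auto simp: cell_weight_def)
  next
    case False
    hence "0 \<le> B" using B_nonneg by auto
    hence r0: "0 \<le> s L / real L" by (simp add: s_def)
    \<comment> \<open>The square roots share the factor \<open>s L / L\<close> and the measure of
      the cell between row and column, so that \<open>pminor_diagonal_scaling\<close> recovers each
      of them once per position.\<close>
    define a where "a i = complex_of_real (sqrt (s L / real L) * sqrt (w (c i)))" for i
    have aa: "a i * a i = complex_of_real (s L / real L * w (c i))" if "i < n" for i
    proof -
      have "(sqrt (s L / real L) * sqrt (w (c i))) * (sqrt (s L / real L) * sqrt (w (c i))) = s L / real L * w (c i)"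
        using r0 w[OF c(2)[OF that]] by (metis mult.assoc mult.commute real_sqrt_mult_self abs_of_nonneg)
      thus ?thesis unfolding a_def by (metis of_real_mult)
    qed
    have "pminor (split_kernel L) (map t [0..<n]) = pminor (\<lambda>i j. a i * cell_kernel w g d c i j * a j) [0..<n]"
      unfolding pminor_map
    proof (rule pminor_cong)
      fix i j assume "i \<in> set [0..<n]" "j \<in> set [0..<n]"
      hence ij: "i < n" "j < n" by auto
      show "split_kernel L (t i) (t j) = a i * cell_kernel w g d c i j * a j"
      proof (cases "i = j")
        case True
        have "a i * cell_kernel w g d c i j * a j = complex_of_real (s L / real L * w (c i) * (d (c i) / w (c i)))"
          unfolding of_real_mult aa[OF ij(1), unfolded of_real_mult, symmetric] using True
          by (simp add: cell_kernel_def)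
        \<comment> \<open>On a null cell the quotient is 0 by convention, and \<open>d_null\<close>
          makes the right side 0 as well.\<close>
        also have "s L / real L * w (c i) * (d (c i) / w (c i)) = s L / real L * d (c i)"
          using d_null[OF c(2)[OF ij(1)]] by (cases "w (c i) = 0") auto
        finally show ?thesis using True c(1)[OF ij(1)] by (simp add: split_kernel_def)
      next
        case False
        hence "t i \<noteq> t j" using assms(3) ij by (auto simp: inj_on_def)
        have sq: "complex_of_real (sqrt x) / complex_of_real x = 1 / complex_of_real (sqrt x)" if "0 \<le> x" for x
        proof -
          have "sqrt x / x = 1 / sqrt x" using that real_div_sqrt[of x] by (cases "x = 0") (auto simp: field_simps)
          thus ?thesis by (metis of_real_1 of_real_divide)
        qed
        have rr: "complex_of_real (sqrt (s L / real L)) * complex_of_real (sqrt (s L / real L)) = complex_of_real (s L / real L)"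
          using r0 by (metis abs_of_nonneg of_real_mult real_sqrt_mult_self)
        have "a i * cell_kernel w g d c i j * a j =
          (complex_of_real (sqrt (s L / real L)) * complex_of_real (sqrt (s L / real L))) * (g (c i) (c j)
            * (complex_of_real (sqrt (w (c i))) / complex_of_real (w (c i)))
            * (complex_of_real (sqrt (w (c j))) / complex_of_real (w (c j))))"
          using False by (simp add: a_def cell_kernel_def)
        also have "\<dots> = complex_of_real (s L / real L) * G (c i) (c j)"
          unfolding rr sq[OF w[OF c(2)[OF ij(1)]]] sq[OF w[OF c(2)[OF ij(2)]]] by (simp add: G_def)
        finally show ?thesis using \<open>t i \<noteq> t j\<close> c(1)[OF ij(1)] c(1)[OF ij(2)] by (simp add: split_kernel_def)
      qed
    qed
    also have "\<dots> = (\<Prod>i<n. a i * a i) * pminor (cell_kernel w g d c) [0..<n]" by (rule pminor_diagonal_scaling)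
    also have "(\<Prod>i<n. a i * a i) = complex_of_real ((s L / real L) ^ n * (\<Prod>i<n. w (c i)))"
    proof -
      have "(\<Prod>i<n. a i * a i) = (\<Prod>i<n. complex_of_real (s L / real L * w (c i)))"
        by (intro prod.cong refl) (use aa in auto)
      also have "\<dots> = complex_of_real (\<Prod>i<n. s L / real L * w (c i))" by simp
      also have "(\<Prod>i<n. s L / real L * w (c i)) = (s L / real L) ^ n * (\<Prod>i<n. w (c i))"
        by (simp only: prod.distrib prod_constant card_lessThan)
      finally show ?thesis .
    qed
    finally have e: "pminor (split_kernel L) (map t [0..<n]) =
      complex_of_real ((s L / real L) ^ n * (\<Prod>i<n. w (c i))) * pminor (cell_kernel w g d c) [0..<n]" .
    have "Re (complex_of_real x * z) = x * Re z" for x z by simp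
    thus ?thesis unfolding c_def[symmetric] cell_weight_def e by (simp only: mult.assoc)
  qed
qed

text \<open>Every tuple of cells is hit by about L^n injective tuples of copies, each with a minor
  that carries the factor \<open>(s L / L) ^ n\<close>, and \<open>s L\<close> tends to 1.\<close>

lemma split_moment_tendsto:
  "(\<lambda>L. kernel_moment ({..<M} \<times> {..<Suc L}) (split_kernel (Suc L)) (cl \<circ> fst) n \<gamma>) \<longlonglongrightarrow> cell_moment M w g d cl n \<gamma>"
proof -
  let ?C = "{c \<in> {..<n} \<rightarrow>\<^sub>E {..<M}. \<forall>j<n. cl (c j) = \<gamma> j}"
  define T where "T (L :: nat) c = {t \<in> {..<n} \<rightarrow>\<^sub>E {..<M} \<times> {..<L}. inj_on t {..<n} \<and> restrict (fst \<circ> t) {..<n} = c}" for L c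
  have finC: "finite ?C" by (rule finite_subset[OF _ finite_PiE[of "{..<n}" "\<lambda>_. {..<M}"]]) auto
  have eq: "kernel_moment ({..<M} \<times> {..<L}) (split_kernel L) (cl \<circ> fst) n \<gamma> =
      (\<Sum>c\<in>?C. (s L / real L) ^ n * real (card (T L c)) * cell_weight w g d n c)" if "0 < L" for L
  proof -
    let ?E = "{..<M} \<times> {..<L}"
    have "kernel_moment ?E (split_kernel L) (cl \<circ> fst) n \<gamma> =
      (\<Sum>t\<in>tuples n ?E (cl \<circ> fst) \<gamma>. (s L / real L) ^ n * cell_weight w g d n (restrict (fst \<circ> t) {..<n}))"
      unfolding kernel_moment_def by (intro sum.cong refl pminor_split_kernel[OF that]) (auto simp: tuples_def)
    also have "\<dots> = (\<Sum>c\<in>?C. \<Sum>t | t \<in> tuples n ?E (cl \<circ> fst) \<gamma> \<and> restrict (fst \<circ> t) {..<n} = c.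
        (s L / real L) ^ n * cell_weight w g d n (restrict (fst \<circ> t) {..<n}))"
    proof (rule sum.group[symmetric])
      show "finite (tuples n ?E (cl \<circ> fst) \<gamma>)" by (rule finite_tuples) simp
      show "(\<lambda>t. restrict (fst \<circ> t) {..<n}) ` tuples n ?E (cl \<circ> fst) \<gamma> \<subseteq> ?C"
        by (auto simp: tuples_def PiE_def Pi_def mem_Times_iff)
    qed (rule finC)
    also have "\<dots> = (\<Sum>c\<in>?C. (s L / real L) ^ n * real (card (T L c)) * cell_weight w g d n c)"
    proof (intro sum.cong refl)
      fix c assume c: "c \<in> ?C"
      have "{t. t \<in> tuples n ?E (cl \<circ> fst) \<gamma> \<and> restrict (fst \<circ> t) {..<n} = c} = T L c"
      proof -
        have "fst (t j) = c j" if "restrict (fst \<circ> t) {..<n} = c" "j < n" for t j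
          using fun_cong[OF that(1), of j] that(2) by simp
        note fst = this
        show ?thesis
        proof (rule Set.set_eqI, rule iffI)
          fix t assume t: "t \<in> T L c"
          hence r: "restrict (fst \<circ> t) {..<n} = c" by (simp add: T_def)
          have "\<forall>j<n. cl (fst (t j)) = \<gamma> j" using fst[OF r] c by simp
          thus "t \<in> {t. t \<in> tuples n ?E (cl \<circ> fst) \<gamma> \<and> restrict (fst \<circ> t) {..<n} = c}"
            using t r by (simp add: T_def tuples_def)
        qed (simp add: T_def tuples_def)
      qed
      moreover have "(\<Sum>t | t \<in> tuples n ?E (cl \<circ> fst) \<gamma> \<and> restrict (fst \<circ> t) {..<n} = c.
        (s L / real L) ^ n * cell_weight w g d n (restrict (fst \<circ> t) {..<n})) =
         (\<Sum>t | t \<in> tuples n ?E (cl \<circ> fst) \<gamma> \<and> restrict (fst \<circ> t) {..<n} = c.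
        (s L / real L) ^ n * cell_weight w g d n c)" by (intro sum.cong refl) auto
      ultimately show "(\<Sum>t | t \<in> tuples n ?E (cl \<circ> fst) \<gamma> \<and> restrict (fst \<circ> t) {..<n} = c.
        (s L / real L) ^ n * cell_weight w g d n (restrict (fst \<circ> t) {..<n})) =
         (s L / real L) ^ n * real (card (T L c)) * cell_weight w g d n c" by simp
    qed
    finally show ?thesis .
  qed
  have s1: "(\<lambda>L. s (Suc L)) \<longlonglongrightarrow> 1" if "0 \<le> B"
  proof -
    have "(\<lambda>L. 1 / (1 + B * inverse (real (Suc L)))) \<longlonglongrightarrow> 1 / (1 + B * 0)"
      by (intro tendsto_intros LIMSEQ_inverse_real_of_nat) auto
    moreover have "1 / (1 + B * inverse (real (Suc L))) = s (Suc L)" for L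
      using that by (simp add: s_def field_simps)
    ultimately show ?thesis by simp
  qed
  have "(\<lambda>L. \<Sum>c\<in>?C. (s (Suc L) / real (Suc L)) ^ n * real (card (T (Suc L) c)) * cell_weight w g d n c)
     \<longlonglongrightarrow> (\<Sum>c\<in>?C. 1 * cell_weight w g d n c)"
  proof (intro tendsto_sum tendsto_mult tendsto_const)
    fix c assume c: "c \<in> ?C"
    have ratio: "(\<lambda>L. real (card (T (Suc L) c)) / real (Suc L) ^ n) \<longlonglongrightarrow> 1"
    proof (rule tendsto_sandwich[OF _ _ falling_power_ratio[of n] tendsto_const])
      show "\<forall>\<^sub>F L in sequentially. real (\<Prod>i<n. Suc L - i) / real (Suc L) ^ n \<le> real (card (T (Suc L) c)) / real (Suc L) ^ n"
      proof (intro always_eventually allI divide_right_mono)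
        fix L show "real (\<Prod>i<n. Suc L - i) \<le> real (card (T (Suc L) c))"
          using card_coloured_tuples(2)[of c n M "Suc L"] c unfolding T_def
          by (simp only: of_nat_le_iff mem_Collect_eq)
      qed simp
      show "\<forall>\<^sub>F L in sequentially. real (card (T (Suc L) c)) / real (Suc L) ^ n \<le> 1"
      proof (intro always_eventually allI)
        fix L
        have "card (T (Suc L) c) \<le> Suc L ^ n"
          using card_coloured_tuples(1)[of c n M "Suc L"] c unfolding T_def by blast
        hence "real (card (T (Suc L) c)) \<le> real (Suc L) ^ n" by (metis of_nat_le_iff of_nat_power)
        thus "real (card (T (Suc L) c)) / real (Suc L) ^ n \<le> 1" by simp
      qed
    qed
    show "(\<lambda>L. (s (Suc L) / real (Suc L)) ^ n * real (card (T (Suc L) c))) \<longlonglongrightarrow> 1"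
    \<comment> \<open>The sign of \<open>B\<close> is known only once a cell exists, hence for n >
      0.\<close>
    proof (cases "n = 0")
      case True
      thus ?thesis using ratio by simp
    next
      case False
      hence "c 0 < M" using c by (auto simp: PiE_def Pi_def)
      hence "0 \<le> B" using B_nonneg by simp
      hence "(\<lambda>L. s (Suc L) ^ n * (real (card (T (Suc L) c)) / real (Suc L) ^ n)) \<longlonglongrightarrow> 1 ^ n * 1"
        by (intro tendsto_mult tendsto_power s1 ratio)
      thus ?thesis by (simp add: power_divide)
    qed
  qed
  thus ?thesis unfolding cell_moment_def by (simp add: eq)
qed

text \<open>Both statements are inherited from the split kernels, whose traces
  \<open>s L * (\<Sum>c<M. d c)\<close> stay below the sum of \<open>d\<close> uniformly in
  L.\<close>

lemma cell_moment_inequality: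
  shows "moment_bounded N (\<Sum>c<M. d c) (cell_moment M w g d cl)"
    and "orthant_dependent N (cell_moment M w g d cl)"
proof -
  let ?m = "\<lambda>L. kernel_moment ({..<M} \<times> {..<Suc L}) (split_kernel (Suc L)) (cl \<circ> fst)"
  have cE: "(cl \<circ> fst) ` ({..<M} \<times> {..<Suc L}) \<subseteq> {..<N}" for L using cl by auto
  have mb: "moment_bounded N (\<Sum>c<M. d c) (?m L)" for L
  proof -
    define C where "C = (\<Sum>x\<in>{..<M} \<times> {..<Suc L}. Re (split_kernel (Suc L) x x))"
    have 1: "moment_bounded N C (?m L)"
      unfolding C_def by (rule kernel_moment_inequality(1)[OF _ split_kernel_psd cE]) auto
    have "C = (\<Sum>c<M. \<Sum>l<Suc L. s (Suc L) / real (Suc L) * d c)"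
      unfolding C_def sum.cartesian_product by (intro sum.cong refl) (auto simp: split_kernel_def)
    also have "\<dots> = (\<Sum>c<M. s (Suc L) * d c)" by (simp del: sum.lessThan_Suc of_nat_Suc)
    also have "\<dots> = s (Suc L) * (\<Sum>c<M. d c)" by (simp add: sum_distrib_left)
    finally have C: "C = s (Suc L) * (\<Sum>c<M. d c)" .
    have d: "0 \<le> (\<Sum>c<M. d c)" using d0 by (intro sum_nonneg) auto
    have "0 \<le> C \<and> C \<le> (\<Sum>c<M. d c)"
    proof (cases "M = 0")
      case False
      hence "0 \<le> B" using B_nonneg by simp
      hence "0 \<le> s (Suc L)" "s (Suc L) \<le> 1" by (auto simp: s_def)
      thus ?thesis unfolding C using d by (auto intro: mult_left_le_one_le)
    qed (simp add: C)
    hence "C ^ n \<le> (\<Sum>c<M. d c) ^ n" for n by (intro power_mono) auto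
    thus ?thesis using 1 unfolding moment_bounded_def by (meson order_trans)
  qed
  have od: "orthant_dependent N (?m L)" for L
    by (rule kernel_moment_inequality(2)[OF _ split_kernel_psd cE]) auto
  show "moment_bounded N (\<Sum>c<M. d c) (cell_moment M w g d cl)"
    by (rule moment_bounded_lim[OF mb split_moment_tendsto])
  show "orthant_dependent N (cell_moment M w g d cl)"
    by (rule orthant_dependent_lim[OF mb od split_moment_tendsto])
qed

end

section \<open>Determinants as polynomials in their entries\<close>

lemma pminor_upt: "pminor Q [0..<n] = (\<Sum>p | p permutes {0..<n}. signof p * (\<Prod>i = 0..<n. Q i (p i)))"
proof -
  have "pminor Q [0..<n] = Determinant.det (Matrix.mat n n (\<lambda>(i, j). Q i j))"
    unfolding pminor_def by (intro arg_cong[of _ _ Determinant.det] eq_matI) auto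
  also have "\<dots> = (\<Sum>p | p permutes {0..<n}. signof p * (\<Prod>i = 0..<n. Matrix.mat n n (\<lambda>(i, j). Q i j) $$ (i, p i)))"
    by (rule det_def'[of _ n]) simp
  also have "\<dots> = (\<Sum>p | p permutes {0..<n}. signof p * (\<Prod>i = 0..<n. Q i (p i)))"
  proof (intro sum.cong refl arg_cong2[of _ _ _ _ "(*)"] prod.cong)
    fix p i assume "p \<in> {p. p permutes {0..<n}}" "i \<in> {0..<n}"
    hence "p i \<in> {0..<n}" using permutes_in_image by fastforce
    thus "Matrix.mat n n (\<lambda>(i, j). Q i j) $$ (i, p i) = Q i (p i)" using \<open>i \<in> {0..<n}\<close> by simp
  qed
  finally show ?thesis .
qed

lemma permutes_less: "p permutes {0..<n :: nat} \<Longrightarrow> i < n \<Longrightarrow> p i < n"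
  using permutes_in_image[of p "{0..<n}" i] by simp

lemma pminor_upt_tendsto:
  fixes Q :: "'b \<Rightarrow> nat \<Rightarrow> nat \<Rightarrow> complex"
  assumes "\<And>i j. i < n \<Longrightarrow> j < n \<Longrightarrow> ((\<lambda>k. Q k i j) \<longlongrightarrow> Q' i j) F"
  shows "((\<lambda>k. pminor (Q k) [0..<n]) \<longlongrightarrow> pminor Q' [0..<n]) F"
  unfolding pminor_upt using permutes_less by (intro tendsto_sum tendsto_mult tendsto_const tendsto_prod assms) auto

lemma pminor_upt_measurable:
  fixes Q :: "'b \<Rightarrow> nat \<Rightarrow> nat \<Rightarrow> complex"
  assumes "\<And>i j. i < n \<Longrightarrow> j < n \<Longrightarrow> (\<lambda>x. Q x i j) \<in> borel_measurable M"
  shows "(\<lambda>x. pminor (Q x) [0..<n]) \<in> borel_measurable M"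
  unfolding pminor_upt using permutes_less
  by (intro borel_measurable_sum borel_measurable_times borel_measurable_const borel_measurable_prod assms) auto

text \<open>This crude bound dominates integrals for a fixed n, where the factor
  \<open>fact n\<close> does no harm; the sum over n is controlled by \<open>moment_bounded\<close>
  instead.\<close>

lemma pminor_upt_bound:
  fixes Q :: "nat \<Rightarrow> nat \<Rightarrow> complex"
  assumes "\<And>i j. i < n \<Longrightarrow> j < n \<Longrightarrow> cmod (Q i j) \<le> R"
  shows "cmod (pminor Q [0..<n]) \<le> fact n * R ^ n"
proof -
  have "cmod (pminor Q [0..<n]) \<le> (\<Sum>p | p permutes {0..<n}. cmod (signof p * (\<Prod>i = 0..<n. Q i (p i))))"
    unfolding pminor_upt by (rule norm_sum)
  also have "\<dots> \<le> (\<Sum>p | p permutes {0..<n}. R ^ n)"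
  proof (rule sum_mono)
    fix p assume p: "p \<in> {p. p permutes {0..<n}}"
    have "cmod (signof p * (\<Prod>i = 0..<n. Q i (p i))) = (\<Prod>i = 0..<n. cmod (Q i (p i)))"
      by (simp add: norm_mult prod_norm sign_def)
    also have "\<dots> \<le> (\<Prod>i = 0..<n. R)" using p permutes_less by (intro prod_mono) (auto intro!: assms)
    finally show "cmod (signof p * (\<Prod>i = 0..<n. Q i (p i))) \<le> R ^ n" by simp
  qed
  also have "\<dots> = fact n * R ^ n" by (simp add: card_permutations)
  finally show ?thesis .
qed

subsection \<open>Approximation by step kernels\<close>

text \<open>A partition is encoded by the map sending a point to the number of its cell, so that a
  common refinement is arithmetic on numbers.\<close>

definition cellwise :: "('a \<Rightarrow> nat) \<Rightarrow> (nat \<Rightarrow> nat \<Rightarrow> complex) \<Rightarrow> 'a \<times> 'a \<Rightarrow> complex" where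
  "cellwise \<pi> h z = h (\<pi> (fst z)) (\<pi> (snd z))"

text \<open>One partition serves both coordinates, because the cells have to index the rows and the
  columns of one Hermitian matrix.\<close>

definition cell_approximable :: "'a measure \<Rightarrow> ('a \<times> 'a \<Rightarrow> complex) \<Rightarrow> bool" where
  "cell_approximable \<nu> f \<longleftrightarrow> (\<forall>e>0. \<exists>\<pi> M h. \<pi> \<in> measurable \<nu> (count_space UNIV) \<and> (\<forall>x. \<pi> x < M) \<and>
     (\<integral>z. cmod (f z - cellwise \<pi> h z) \<partial>(\<nu> \<Otimes>\<^sub>M \<nu>)) < e)"

lemma cellwise_measurable:
  assumes [measurable]: "\<pi> \<in> measurable \<nu> (count_space UNIV)"
  shows "cellwise \<pi> h \<in> borel_measurable (\<nu> \<Otimes>\<^sub>M \<nu>)"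
proof -
  have "(\<lambda>z. h a (\<pi> (snd z))) \<in> borel_measurable (\<nu> \<Otimes>\<^sub>M \<nu>)" for a
    by (rule measurable_compose_countable[of "\<lambda>b z. h a b"]) measurable
  hence "(\<lambda>z. h (\<pi> (fst z)) (\<pi> (snd z))) \<in> borel_measurable (\<nu> \<Otimes>\<^sub>M \<nu>)"
    by (rule measurable_compose_countable[of "\<lambda>a z. h a (\<pi> (snd z))"]) measurable
  thus ?thesis unfolding cellwise_def[abs_def] .
qed

lemma cellwise_bound:
  assumes "\<And>x. \<pi> x < M"
  shows "cmod (cellwise \<pi> h z) \<le> (\<Sum>a<M. \<Sum>b<M. cmod (h a b))"
proof -
  have "cmod (cellwise \<pi> h z) \<le> (\<Sum>b<M. cmod (h (\<pi> (fst z)) b))"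
    unfolding cellwise_def using assms by (intro member_le_sum) auto
  also have "\<dots> \<le> (\<Sum>a<M. \<Sum>b<M. cmod (h a b))"
    using assms by (intro member_le_sum[of _ _ "\<lambda>a. \<Sum>b<M. cmod (h a b)"]) (auto intro!: sum_nonneg)
  finally show ?thesis .
qed

context finite_measure
begin

lemma finite_measure_pair: "finite_measure (M \<Otimes>\<^sub>M M)"
proof
  have "emeasure (M \<Otimes>\<^sub>M M) (space (M \<Otimes>\<^sub>M M)) = emeasure M (space M) * emeasure M (space M)"
    unfolding space_pair_measure by (rule emeasure_pair_measure_Times) auto
  thus "emeasure (M \<Otimes>\<^sub>M M) (space (M \<Otimes>\<^sub>M M)) \<noteq> \<infinity>"
    by (simp add: ennreal_mult_eq_top_iff emeasure_eq_measure)
qed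

lemma cellwise_integrable:
  assumes "\<pi> \<in> measurable M (count_space UNIV)" "\<And>x. \<pi> x < m"
  shows "integrable (M \<Otimes>\<^sub>M M) (cellwise \<pi> h)"
  using cellwise_bound[of \<pi> m h, OF assms(2)]
  by (intro finite_measure.integrable_const_bound[OF finite_measure_pair, where B = "\<Sum>a<m. \<Sum>b<m. cmod (h a b)"]
        cellwise_measurable[OF assms(1)]) auto

lemma cell_approximable_add:
  assumes "cell_approximable M f" "cell_approximable M g"
    "integrable (M \<Otimes>\<^sub>M M) f" "integrable (M \<Otimes>\<^sub>M M) g"
  shows "cell_approximable M (\<lambda>z. f z + g z)"
  unfolding cell_approximable_def
proof (intro allI impI)
  fix e :: real assume "e > 0"
  hence e: "e / 2 > 0" by simp
  obtain \<pi>1 m1 h1 where 1: "\<pi>1 \<in> measurable M (count_space UNIV)" "\<And>x. \<pi>1 x < m1"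
    "(\<integral>z. cmod (f z - cellwise \<pi>1 h1 z) \<partial>(M \<Otimes>\<^sub>M M)) < e / 2"
    using assms(1) e unfolding cell_approximable_def by meson
  obtain \<pi>2 m2 h2 where 2: "\<pi>2 \<in> measurable M (count_space UNIV)" "\<And>x. \<pi>2 x < m2"
    "(\<integral>z. cmod (g z - cellwise \<pi>2 h2 z) \<partial>(M \<Otimes>\<^sub>M M)) < e / 2"
    using assms(2) e unfolding cell_approximable_def by meson
  note [measurable] = 1(1) 2(1)
  \<comment> \<open>The common refinement in mixed radix; \<open>div\<close> and \<open>mod\<close>
    recover the two cell numbers.\<close>
  define \<pi> where "\<pi> x = \<pi>1 x * m2 + \<pi>2 x" for x
  define h where "h a b = h1 (a div m2) (b div m2) + h2 (a mod m2) (b mod m2)" for a b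
  have m: "\<pi> \<in> measurable M (count_space UNIV)" unfolding \<pi>_def[abs_def] by measurable
  have dm: "\<pi> x div m2 = \<pi>1 x" "\<pi> x mod m2 = \<pi>2 x" for x using 2(2)[of x] by (auto simp: \<pi>_def)
  have bd: "\<pi> x < m1 * m2" for x
  proof -
    have "\<pi> x < (\<pi>1 x + 1) * m2" using 2(2)[of x] by (simp add: \<pi>_def)
    also have "\<dots> \<le> m1 * m2" using 1(2)[of x] by (intro mult_le_mono) auto
    finally show ?thesis .
  qed
  have c: "cellwise \<pi> h z = cellwise \<pi>1 h1 z + cellwise \<pi>2 h2 z" for z
    unfolding cellwise_def h_def dm by simp
  note i1 = cellwise_integrable[OF 1(1,2), of h1] and i2 = cellwise_integrable[OF 2(1,2), of h2]
  have "(\<integral>z. cmod (f z + g z - cellwise \<pi> h z) \<partial>(M \<Otimes>\<^sub>M M))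
    \<le> (\<integral>z. cmod (f z - cellwise \<pi>1 h1 z) + cmod (g z - cellwise \<pi>2 h2 z) \<partial>(M \<Otimes>\<^sub>M M))"
  proof (rule integral_mono)
    show "integrable (M \<Otimes>\<^sub>M M) (\<lambda>z. cmod (f z + g z - cellwise \<pi> h z))"
      unfolding c using assms(3,4) i1 i2 by auto
    show "integrable (M \<Otimes>\<^sub>M M) (\<lambda>z. cmod (f z - cellwise \<pi>1 h1 z) + cmod (g z - cellwise \<pi>2 h2 z))"
      using assms(3,4) i1 i2 by auto
    fix z show "cmod (f z + g z - cellwise \<pi> h z) \<le> cmod (f z - cellwise \<pi>1 h1 z) + cmod (g z - cellwise \<pi>2 h2 z)"
      unfolding c using norm_triangle_ineq[of "f z - cellwise \<pi>1 h1 z" "g z - cellwise \<pi>2 h2 z"] by (simp add: algebra_simps)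
  qed
  also have "\<dots> = (\<integral>z. cmod (f z - cellwise \<pi>1 h1 z) \<partial>(M \<Otimes>\<^sub>M M)) + (\<integral>z. cmod (g z - cellwise \<pi>2 h2 z) \<partial>(M \<Otimes>\<^sub>M M))"
    using assms(3,4) i1 i2 by (intro Bochner_Integration.integral_add) auto
  also have "\<dots> < e" using 1(3) 2(3) by simp
  finally show "\<exists>\<pi> m h. \<pi> \<in> measurable M (count_space UNIV) \<and> (\<forall>x. \<pi> x < m) \<and>
     (\<integral>z. cmod (f z + g z - cellwise \<pi> h z) \<partial>(M \<Otimes>\<^sub>M M)) < e" using m bd by blast
qed

lemma cell_approximable_lim:
  assumes "\<And>e. e > 0 \<Longrightarrow> \<exists>s. cell_approximable M s \<and> integrable (M \<Otimes>\<^sub>M M) s \<and> (\<integral>z. cmod (f z - s z) \<partial>(M \<Otimes>\<^sub>M M)) < e"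
    "integrable (M \<Otimes>\<^sub>M M) f"
  shows "cell_approximable M f"
  unfolding cell_approximable_def
proof (intro allI impI)
  fix e :: real assume "e > 0"
  hence e: "e / 2 > 0" by simp
  obtain s where s: "cell_approximable M s" "integrable (M \<Otimes>\<^sub>M M) s" "(\<integral>z. cmod (f z - s z) \<partial>(M \<Otimes>\<^sub>M M)) < e / 2"
    using assms(1)[OF e] by blast
  obtain \<pi> m h where 1: "\<pi> \<in> measurable M (count_space UNIV)" "\<And>x. \<pi> x < m"
    "(\<integral>z. cmod (s z - cellwise \<pi> h z) \<partial>(M \<Otimes>\<^sub>M M)) < e / 2"
    using s(1) e unfolding cell_approximable_def by meson
  note i1 = cellwise_integrable[OF 1(1,2), of h]
  have "(\<integral>z. cmod (f z - cellwise \<pi> h z) \<partial>(M \<Otimes>\<^sub>M M)) \<le> (\<integral>z. cmod (f z - s z) + cmod (s z - cellwise \<pi> h z) \<partial>(M \<Otimes>\<^sub>M M))"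
  proof (rule integral_mono)
    fix z show "cmod (f z - cellwise \<pi> h z) \<le> cmod (f z - s z) + cmod (s z - cellwise \<pi> h z)"
      using norm_triangle_ineq[of "f z - s z" "s z - cellwise \<pi> h z"] by simp
  qed (use assms(2) s i1 in auto)
  also have "\<dots> = (\<integral>z. cmod (f z - s z) \<partial>(M \<Otimes>\<^sub>M M)) + (\<integral>z. cmod (s z - cellwise \<pi> h z) \<partial>(M \<Otimes>\<^sub>M M))"
    using assms(2) s i1 by (intro Bochner_Integration.integral_add) auto
  also have "\<dots> < e" using 1(3) s(3) by simp
  finally show "\<exists>\<pi> m h. \<pi> \<in> measurable M (count_space UNIV) \<and> (\<forall>x. \<pi> x < m) \<and>
     (\<integral>z. cmod (f z - cellwise \<pi> h z) \<partial>(M \<Otimes>\<^sub>M M)) < e" using 1 by blast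
qed

lemma indicator_pair_integrable:
  "A \<in> sets (M \<Otimes>\<^sub>M M) \<Longrightarrow> integrable (M \<Otimes>\<^sub>M M) (\<lambda>z. indicator A z :: complex)"
  by (intro finite_measure.integrable_const_bound[OF finite_measure_pair, where B = 1])
     (auto simp: indicator_def)

text \<open>Rectangles are step functions exactly, and they form a generator closed under
  intersection. Complements and disjoint unions preserve approximability, by sums and limits in the
  mean, so Dynkin's argument covers the product sigma-algebra.\<close>

lemma cell_approximable_indicator:
  assumes "A \<in> sets (M \<Otimes>\<^sub>M M)"
  shows "cell_approximable M (\<lambda>z. indicator A z)"
proof -
  let ?P = "M \<Otimes>\<^sub>M M"
  have stable: "Int_stable {a \<times> b |a b. a \<in> sets M \<and> b \<in> sets M}" by (rule Int_stable_pair_measure_generator)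
  have closed: "{a \<times> b |a b. a \<in> sets M \<and> b \<in> sets M} \<subseteq> Pow (space M \<times> space M)" by (rule pair_measure_closed)
  have sets: "sets ?P = sigma_sets (space M \<times> space M) {a \<times> b |a b. a \<in> sets M \<and> b \<in> sets M}"
    by (rule sets_pair_measure)
  have space: "space ?P = space M \<times> space M" by (rule space_pair_measure)
  have exact: "cell_approximable M f" if "\<pi> \<in> measurable M (count_space UNIV)" "\<And>x. \<pi> x < m"
    "\<And>z. z \<in> space ?P \<Longrightarrow> f z = cellwise \<pi> h z" for f \<pi> m h
  proof -
    have "(\<integral>z. cmod (f z - cellwise \<pi> h z) \<partial>?P) = (\<integral>z. 0 \<partial>?P)"
      using that(3) by (intro Bochner_Integration.integral_cong) auto
    hence "(\<integral>z. cmod (f z - cellwise \<pi> h z) \<partial>?P) < e" if "0 < e" for e using that by simp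
    thus ?thesis unfolding cell_approximable_def using that(1,2) by blast
  qed
  show ?thesis
    using stable closed assms[unfolded sets]
  proof (induction rule: sigma_sets_induct_disjoint)
    case (basic A)
    then obtain a b where ab: "A = a \<times> b" "a \<in> sets M" "b \<in> sets M" by auto
    \<comment> \<open>The two binary digits record membership in \<open>a\<close> and in
      \<open>b\<close>; the rectangle asks for the upper digit in the first coordinate and for the
      lower one in the second.\<close>
    define \<pi> where "\<pi> x = (if x \<in> a then 2 else 0) + (if x \<in> b then 1 else (0::nat))" for x
    have [measurable]: "a \<in> sets M" "b \<in> sets M" using ab by auto
    have "\<pi> \<in> measurable M (count_space UNIV)" unfolding \<pi>_def[abs_def] by measurable
    moreover have "\<pi> x < 4" for x by (simp add: \<pi>_def)
    moreover have "indicator A z = cellwise \<pi> (\<lambda>i j. of_bool (i \<ge> 2 \<and> odd j)) z" for z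
      by (cases z) (simp add: ab(1) cellwise_def \<pi>_def indicator_def)
    ultimately show ?case by (intro exact) auto
  next
    case empty
    show ?case by (rule exact[of "\<lambda>_. 0" 1 _ "\<lambda>_ _. 0"]) (auto simp: cellwise_def)
  next
    case (compl A)
    have A: "A \<in> sets ?P" using compl.hyps sets by simp
    have "cell_approximable M (\<lambda>z. - indicator A z)"
      unfolding cell_approximable_def
    proof (intro allI impI)
      fix e :: real assume "e > 0"
      then obtain \<pi> m h where 1: "\<pi> \<in> measurable M (count_space UNIV)" "\<And>x. \<pi> x < m"
        "(\<integral>z. cmod (indicator A z - cellwise \<pi> h z) \<partial>?P) < e"
        using compl.IH unfolding cell_approximable_def by meson
      have "cmod (- indicator A z - cellwise \<pi> (\<lambda>a b. - h a b) z) = cmod (indicator A z - cellwise \<pi> h z)" for z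
        unfolding cellwise_def by (metis minus_diff_eq norm_minus_commute diff_minus_eq_add uminus_add_conv_diff)
      hence "(\<integral>z. cmod (- indicator A z - cellwise \<pi> (\<lambda>a b. - h a b) z) \<partial>?P) < e" using 1(3) by simp
      thus "\<exists>\<pi> m h. \<pi> \<in> measurable M (count_space UNIV) \<and> (\<forall>x. \<pi> x < m) \<and>
        (\<integral>z. cmod (- indicator A z - cellwise \<pi> h z) \<partial>?P) < e" using 1(1,2) by blast
    qed
    moreover have "cell_approximable M (\<lambda>z. 1)"
      by (rule exact[of "\<lambda>_. 0" 1 _ "\<lambda>_ _. 1"]) (auto simp: cellwise_def)
    moreover have "integrable ?P (\<lambda>z. - indicator A z :: complex)"
      using indicator_pair_integrable[OF A] by simp
    moreover have "integrable ?P (\<lambda>z. 1 :: complex)"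
      by (rule finite_measure.integrable_const[OF finite_measure_pair])
    ultimately have *: "cell_approximable M (\<lambda>z. 1 + - indicator A z)" by (intro cell_approximable_add)
    have "(\<integral>z. cmod (indicator (space M \<times> space M - A) z - s z) \<partial>?P) = (\<integral>z. cmod ((1 + - indicator A z) - s z) \<partial>?P)" for s
      by (intro Bochner_Integration.integral_cong) (auto simp: indicator_def space)
    thus ?case using * unfolding cell_approximable_def by simp
  next
    case (union A)
    have A: "A i \<in> sets ?P" for i using union.hyps(2) sets by auto
    hence UA: "(\<Union>i. A i) \<in> sets ?P" by auto
    define s where "s n z = (\<Sum>i<n. indicator (A i) z :: complex)" for n z
    have ints: "integrable ?P (s n)" for n
      unfolding s_def[abs_def] using indicator_pair_integrable[OF A] by auto
    have aps: "cell_approximable M (s n)" for n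
    proof (induction n)
      case 0
      show ?case unfolding s_def by (rule exact[of "\<lambda>_. 0" 1 _ "\<lambda>_ _. 0"]) (auto simp: cellwise_def)
    next
      case (Suc n)
      have "cell_approximable M (\<lambda>z. s n z + indicator (A n) z)"
        by (rule cell_approximable_add[OF Suc union.IH ints indicator_pair_integrable[OF A]])
      thus ?case unfolding s_def by simp
    qed
    have s_eq: "s n z = indicator (\<Union>i<n. A i) z" for n z
      unfolding s_def using union.hyps(1)
      by (subst indicator_UN_disjoint) (auto simp: disjoint_family_on_def)
    have lim: "(\<lambda>n. (\<integral>z. cmod (indicator (\<Union>i. A i) z - s n z) \<partial>?P)) \<longlonglongrightarrow> (\<integral>z. 0 \<partial>?P)"
    proof (rule integral_dominated_convergence[where w = "\<lambda>_. 1"])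
      show "(\<lambda>z. cmod (indicator (\<Union>i. A i) z - s n z)) \<in> borel_measurable ?P" for n
        using UA borel_measurable_integrable[OF ints[of n]] by measurable
      show "integrable ?P (\<lambda>_. 1 :: real)" by (rule finite_measure.integrable_const[OF finite_measure_pair])
      show "AE z in ?P. (\<lambda>n. cmod (indicator (\<Union>i. A i) z - s n z)) \<longlonglongrightarrow> 0"
      proof (rule AE_I2)
        fix z
        show "(\<lambda>n. cmod (indicator (\<Union>i. A i) z - s n z)) \<longlonglongrightarrow> 0"
        proof (cases "\<exists>i. z \<in> A i")
          case True
          then obtain i where "z \<in> A i" by auto
          hence "\<forall>\<^sub>F n in sequentially. cmod (indicator (\<Union>i. A i) z - s n z) = 0"
            unfolding s_eq by (intro eventually_mono[OF eventually_gt_at_top[of i]]) (auto simp: indicator_def)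
          thus ?thesis by (rule tendsto_eventually)
        next
          case False
          hence "cmod (indicator (\<Union>i. A i) z - s n z) = 0" for n unfolding s_eq by (simp add: indicator_def)
          thus ?thesis by simp
        qed
      qed
      show "AE z in ?P. norm (cmod (indicator (\<Union>i. A i) z - s n z)) \<le> 1" for n
        unfolding s_eq by (auto simp: indicator_def)
    qed auto
    show ?case
    proof (rule cell_approximable_lim[OF _ indicator_pair_integrable[OF UA]])
      fix e :: real assume "e > 0"
      hence "\<forall>\<^sub>F n in sequentially. (\<integral>z. cmod (indicator (\<Union>i. A i) z - s n z) \<partial>?P) < e"
        using lim by (intro order_tendstoD(2)) auto
      then obtain n where "(\<integral>z. cmod (indicator (\<Union>i. A i) z - s n z) \<partial>?P) < e"
        using eventually_happens trivial_limit_sequentially by blast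
      thus "\<exists>s. cell_approximable M s \<and> integrable ?P s \<and> (\<integral>z. cmod (indicator (\<Union>i. A i) z - s z) \<partial>?P) < e"
        using aps ints by blast
    qed
  qed
qed

lemma cell_approximable_integrable:
  assumes "integrable (M \<Otimes>\<^sub>M M) f"
  shows "cell_approximable M f"
  using assms
proof (induct f rule: integrable_induct)
  case (base A c)
  show ?case
    unfolding cell_approximable_def
  proof (intro allI impI)
    fix e :: real assume "e > 0"
    hence e: "e / (1 + cmod c) > 0" by (simp add: add_pos_nonneg)
    have c1: "1 + cmod c > 0" by (simp add: add_pos_nonneg)
    obtain \<pi> m h where 1: "\<pi> \<in> measurable M (count_space UNIV)" "\<And>x. \<pi> x < m"
      "(\<integral>z. cmod (indicator A z - cellwise \<pi> h z) \<partial>(M \<Otimes>\<^sub>M M)) < e / (1 + cmod c)"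
      using cell_approximable_indicator[OF base(1)] e unfolding cell_approximable_def by meson
    have "cmod (indicator A z *\<^sub>R c - cellwise \<pi> (\<lambda>a b. h a b * c) z) = cmod (indicator A z - cellwise \<pi> h z) * cmod c" for z
      unfolding cellwise_def norm_mult[symmetric] by (simp add: indicator_def algebra_simps)
    hence "(\<integral>z. cmod (indicator A z *\<^sub>R c - cellwise \<pi> (\<lambda>a b. h a b * c) z) \<partial>(M \<Otimes>\<^sub>M M))
      = (\<integral>z. cmod (indicator A z - cellwise \<pi> h z) \<partial>(M \<Otimes>\<^sub>M M)) * cmod c" by simp
    also have "\<dots> \<le> (\<integral>z. cmod (indicator A z - cellwise \<pi> h z) \<partial>(M \<Otimes>\<^sub>M M)) * (1 + cmod c)"
      by (intro mult_left_mono) auto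
    also have "\<dots> < e" using 1(3) c1 by (simp add: pos_less_divide_eq)
    finally show "\<exists>\<pi> m h. \<pi> \<in> measurable M (count_space UNIV) \<and> (\<forall>x. \<pi> x < m) \<and>
      (\<integral>z. cmod (indicator A z *\<^sub>R c - cellwise \<pi> h z) \<partial>(M \<Otimes>\<^sub>M M)) < e" using 1(1,2) by blast
  qed
next
  case (add f g)
  thus ?case by (intro cell_approximable_add)
next
  case (lim f s)
  have conv: "(\<lambda>n. (\<integral>z. cmod (f z - s n z) \<partial>(M \<Otimes>\<^sub>M M))) \<longlonglongrightarrow> (\<integral>z. 0 \<partial>(M \<Otimes>\<^sub>M M))"
  proof (rule integral_dominated_convergence[where w = "\<lambda>z. 3 * cmod (f z)"])
    show "(\<lambda>z. cmod (f z - s n z)) \<in> borel_measurable (M \<Otimes>\<^sub>M M)" for n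
      using borel_measurable_integrable[OF lim(1)[of n]] borel_measurable_integrable[OF lim(5)] by measurable
    show "AE z in M \<Otimes>\<^sub>M M. (\<lambda>n. cmod (f z - s n z)) \<longlonglongrightarrow> 0"
    proof (rule AE_I2)
      fix z assume "z \<in> space (M \<Otimes>\<^sub>M M)"
      from lim(3)[OF this] have "(\<lambda>n. cmod (f z - s n z)) \<longlonglongrightarrow> cmod (f z - f z)" by (intro tendsto_intros)
      thus "(\<lambda>n. cmod (f z - s n z)) \<longlonglongrightarrow> 0" by simp
    qed
    show "AE z in M \<Otimes>\<^sub>M M. norm (cmod (f z - s n z)) \<le> 3 * cmod (f z)" for n
    proof (rule AE_I2)
      fix z assume "z \<in> space (M \<Otimes>\<^sub>M M)"
      from lim(4)[OF this, of n] norm_triangle_ineq4[of "f z" "s n z"]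
      show "norm (cmod (f z - s n z)) \<le> 3 * cmod (f z)" by simp
    qed
  qed (use lim(5) in auto)
  show ?case
  proof (rule cell_approximable_lim[OF _ lim(5)])
    fix e :: real assume "e > 0"
    hence "\<forall>\<^sub>F n in sequentially. (\<integral>z. cmod (f z - s n z) \<partial>(M \<Otimes>\<^sub>M M)) < e"
      using conv by (intro order_tendstoD(2)) auto
    then obtain n where "(\<integral>z. cmod (f z - s n z) \<partial>(M \<Otimes>\<^sub>M M)) < e"
      using eventually_happens trivial_limit_sequentially by blast
    thus "\<exists>t. cell_approximable M t \<and> integrable (M \<Otimes>\<^sub>M M) t \<and> (\<integral>z. cmod (f z - t z) \<partial>(M \<Otimes>\<^sub>M M)) < e"
      using lim(1,2) by blast
  qed
qed

section \<open>Cell averages\<close>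

definition cell :: "('a \<Rightarrow> nat) \<Rightarrow> nat \<Rightarrow> 'a set" where
  "cell \<sigma> a = {x \<in> space M. \<sigma> x = a}"

definition cell_integral :: "('a \<Rightarrow> nat) \<Rightarrow> ('a \<times> 'a \<Rightarrow> complex) \<Rightarrow> nat \<Rightarrow> nat \<Rightarrow> complex" where
  "cell_integral \<sigma> f a b = (\<integral>z. indicator (cell \<sigma> a \<times> cell \<sigma> b) z *\<^sub>R f z \<partial>(M \<Otimes>\<^sub>M M))"

lemma cell_sets: "\<sigma> \<in> measurable M (count_space UNIV) \<Longrightarrow> cell \<sigma> a \<in> sets M"
  unfolding cell_def by measurable

lemma measure_cell_times:
  assumes "\<sigma> \<in> measurable M (count_space UNIV)"
  shows "measure (M \<Otimes>\<^sub>M M) (cell \<sigma> a \<times> cell \<sigma> b) = measure M (cell \<sigma> a) * measure M (cell \<sigma> b)"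
proof -
  show ?thesis using emeasure_pair_measure_Times[OF cell_sets[OF assms] cell_sets[OF assms], of a b]
    by (simp add: measure_def enn2real_mult)
qed

lemma integral_cells:
  fixes F :: "'a \<times> 'a \<Rightarrow> real"
  assumes "\<sigma> \<in> measurable M (count_space UNIV)" "\<And>x. \<sigma> x < m" "integrable (M \<Otimes>\<^sub>M M) F"
  shows "(\<integral>z. F z \<partial>(M \<Otimes>\<^sub>M M)) = (\<Sum>a<m. \<Sum>b<m. \<integral>z. indicator (cell \<sigma> a \<times> cell \<sigma> b) z * F z \<partial>(M \<Otimes>\<^sub>M M))"
proof -
  have int: "integrable (M \<Otimes>\<^sub>M M) (\<lambda>z. indicator (cell \<sigma> a \<times> cell \<sigma> b) z * F z)" for a b
    using integrable_mult_indicator[OF _ assms(3), of "cell \<sigma> a \<times> cell \<sigma> b"] cell_sets[OF assms(1)] by simp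
  have "(\<integral>z. F z \<partial>(M \<Otimes>\<^sub>M M)) = (\<integral>z. (\<Sum>a<m. \<Sum>b<m. indicator (cell \<sigma> a \<times> cell \<sigma> b) z * F z) \<partial>(M \<Otimes>\<^sub>M M))"
  proof (intro Bochner_Integration.integral_cong refl)
    fix z assume z: "z \<in> space (M \<Otimes>\<^sub>M M)"
    have "(\<Sum>a<m. \<Sum>b<m. indicator (cell \<sigma> a \<times> cell \<sigma> b) z * F z)
       = (\<Sum>a<m. \<Sum>b<m. if b = \<sigma> (snd z) then (if a = \<sigma> (fst z) then F z else 0) else 0)"
    proof (intro sum.cong refl)
      fix a b
      obtain x y where "z = (x, y)" "x \<in> space M" "y \<in> space M" using z by (auto simp: space_pair_measure)
      thus "indicator (cell \<sigma> a \<times> cell \<sigma> b) z * F z = (if b = \<sigma> (snd z) then (if a = \<sigma> (fst z) then F z else 0) else 0)"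
        by (simp add: cell_def indicator_def)
    qed
    thus "F z = (\<Sum>a<m. \<Sum>b<m. indicator (cell \<sigma> a \<times> cell \<sigma> b) z * F z)" using assms(2) by simp
  qed
  also have "\<dots> = (\<Sum>a<m. \<integral>z. (\<Sum>b<m. indicator (cell \<sigma> a \<times> cell \<sigma> b) z * F z) \<partial>(M \<Otimes>\<^sub>M M))"
    by (intro Bochner_Integration.integral_sum Bochner_Integration.integrable_sum int)
  also have "\<dots> = (\<Sum>a<m. \<Sum>b<m. \<integral>z. indicator (cell \<sigma> a \<times> cell \<sigma> b) z * F z \<partial>(M \<Otimes>\<^sub>M M))"
    by (intro sum.cong refl Bochner_Integration.integral_sum int)
  finally show ?thesis .
qed

text \<open>Averaging over products of cells is a contraction in the mean and, up to null sets,
  fixes functions that are constant on them, so replacing an approximation k by the averages at most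
  doubles the error. Unlike k, the averages inherit Hermitian symmetry and the bounds on the
  quadratic form.\<close>

lemma cell_average_error:
  assumes \<sigma>: "\<sigma> \<in> measurable M (count_space UNIV)" "\<And>x. \<sigma> x < m" and f: "integrable (M \<Otimes>\<^sub>M M) f"
  defines "E \<equiv> cellwise \<sigma> (\<lambda>a b. cell_integral \<sigma> f a b / complex_of_real (measure M (cell \<sigma> a) * measure M (cell \<sigma> b)))"
  shows "(\<integral>z. cmod (f z - E z) \<partial>(M \<Otimes>\<^sub>M M)) \<le> 2 * (\<integral>z. cmod (f z - cellwise \<sigma> k z) \<partial>(M \<Otimes>\<^sub>M M))"
proof -
  let ?P = "M \<Otimes>\<^sub>M M"
  define w where "w a = measure M (cell \<sigma> a)" for a
  define G where "G = cell_integral \<sigma> f"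
  have iE: "integrable ?P E" unfolding E_def by (rule cellwise_integrable[OF \<sigma>])
  have ik: "integrable ?P (cellwise \<sigma> k)" by (rule cellwise_integrable[OF \<sigma>])
  have S: "cell \<sigma> a \<times> cell \<sigma> b \<in> sets ?P" for a b using cell_sets[OF \<sigma>(1)] by auto
  have m: "(\<integral>z. indicator (cell \<sigma> a \<times> cell \<sigma> b) z * c \<partial>?P) = c * (w a * w b)" for a b and c :: real
    using S measure_cell_times[OF \<sigma>(1), of a b] by (simp add: w_def mult.commute)
  have "(\<integral>z. cmod (cellwise \<sigma> k z - E z) \<partial>?P) =
      (\<Sum>a<m. \<Sum>b<m. \<integral>z. indicator (cell \<sigma> a \<times> cell \<sigma> b) z * cmod (cellwise \<sigma> k z - E z) \<partial>?P)"
    using iE ik by (intro integral_cells[OF \<sigma>]) auto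
  also have "\<dots> \<le> (\<Sum>a<m. \<Sum>b<m. \<integral>z. indicator (cell \<sigma> a \<times> cell \<sigma> b) z * cmod (f z - cellwise \<sigma> k z) \<partial>?P)"
  proof (intro sum_mono)
    fix a b
    let ?c = "cmod (k a b - G a b / complex_of_real (w a * w b))"
    have "(\<integral>z. indicator (cell \<sigma> a \<times> cell \<sigma> b) z * cmod (cellwise \<sigma> k z - E z) \<partial>?P)
       = (\<integral>z. indicator (cell \<sigma> a \<times> cell \<sigma> b) z * ?c \<partial>?P)"
      by (intro Bochner_Integration.integral_cong refl)
         (auto simp: indicator_def cellwise_def E_def cell_def G_def w_def)
    also have "\<dots> = ?c * (w a * w b)" by (rule m)
    also have "\<dots> \<le> (\<integral>z. indicator (cell \<sigma> a \<times> cell \<sigma> b) z * cmod (f z - cellwise \<sigma> k z) \<partial>?P)"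
    proof (cases "w a * w b = 0")
      case True
      thus ?thesis by (auto intro!: Bochner_Integration.integral_nonneg)
    next
      case False
      have w0: "0 \<le> w a * w b" by (simp add: w_def)
      have "?c * (w a * w b) = cmod ((k a b - G a b / complex_of_real (w a * w b)) * complex_of_real (w a * w b))"
        unfolding norm_mult norm_of_real using w0 by simp
      also have "(k a b - G a b / complex_of_real (w a * w b)) * complex_of_real (w a * w b)
          = complex_of_real (w a * w b) * k a b - G a b"
        using False by (simp add: algebra_simps)
      also have "complex_of_real (w a * w b) * k a b = (\<integral>z. indicator (cell \<sigma> a \<times> cell \<sigma> b) z *\<^sub>R k a b \<partial>?P)"
        using S measure_cell_times[OF \<sigma>(1), of a b] finite_measure.emeasure_eq_measure[OF finite_measure_pair]
        by (simp add: w_def scaleR_conv_of_real)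
      also have "\<dots> - G a b = (\<integral>z. indicator (cell \<sigma> a \<times> cell \<sigma> b) z *\<^sub>R (k a b - f z) \<partial>?P)"
        unfolding G_def cell_integral_def scaleR_diff_right
        using S f finite_measure.emeasure_eq_measure[OF finite_measure_pair]
        by (intro Bochner_Integration.integral_diff[symmetric] integrable_mult_indicator
            finite_measure.integrable_const[OF finite_measure_pair]) auto
      also have "cmod \<dots> \<le> (\<integral>z. cmod (indicator (cell \<sigma> a \<times> cell \<sigma> b) z *\<^sub>R (k a b - f z)) \<partial>?P)"
        by (rule integral_norm_bound)
      also have "\<dots> = (\<integral>z. indicator (cell \<sigma> a \<times> cell \<sigma> b) z * cmod (f z - cellwise \<sigma> k z) \<partial>?P)"
        by (intro Bochner_Integration.integral_cong refl)
           (auto simp: indicator_def cellwise_def cell_def norm_minus_commute)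
      finally show ?thesis .
    qed
    finally show "(\<integral>z. indicator (cell \<sigma> a \<times> cell \<sigma> b) z * cmod (cellwise \<sigma> k z - E z) \<partial>?P)
       \<le> (\<integral>z. indicator (cell \<sigma> a \<times> cell \<sigma> b) z * cmod (f z - cellwise \<sigma> k z) \<partial>?P)" .
  qed
  also have "\<dots> = (\<integral>z. cmod (f z - cellwise \<sigma> k z) \<partial>?P)"
    using f ik by (intro integral_cells[OF \<sigma>, symmetric]) auto
  finally have 1: "(\<integral>z. cmod (cellwise \<sigma> k z - E z) \<partial>?P) \<le> (\<integral>z. cmod (f z - cellwise \<sigma> k z) \<partial>?P)" .
  have "(\<integral>z. cmod (f z - E z) \<partial>?P) \<le> (\<integral>z. cmod (f z - cellwise \<sigma> k z) + cmod (cellwise \<sigma> k z - E z) \<partial>?P)"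
  proof (rule integral_mono)
    fix z show "cmod (f z - E z) \<le> cmod (f z - cellwise \<sigma> k z) + cmod (cellwise \<sigma> k z - E z)"
      using norm_triangle_ineq[of "f z - cellwise \<sigma> k z" "cellwise \<sigma> k z - E z"] by simp
  qed (use f iE ik in auto)
  also have "\<dots> = (\<integral>z. cmod (f z - cellwise \<sigma> k z) \<partial>?P) + (\<integral>z. cmod (cellwise \<sigma> k z - E z) \<partial>?P)"
    using f iE ik by (intro Bochner_Integration.integral_add) auto
  finally show ?thesis using 1 by simp
qed

end

section \<open>Coordinates and null sets of finite products\<close>

lemma (in product_sigma_finite) nn_integral_PiM_coordinate:
  assumes "finite J" "j \<notin> J" "g \<in> borel_measurable (M j)"
  shows "(\<integral>\<^sup>+x. g (x j) \<partial>PiM (insert j J) M) = (\<integral>\<^sup>+y. g y \<partial>M j) * emeasure (PiM J M) (space (PiM J M))"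
proof -
  have "(\<lambda>x. g (x j)) \<in> borel_measurable (PiM (insert j J) M)"
    by (rule measurable_compose[OF measurable_component_singleton[of j "insert j J" M] assms(3)]) simp
  from product_nn_integral_insert[OF assms(1,2) this] show ?thesis by simp
qed

lemma (in product_sigma_finite) nn_integral_PiM_two_coordinates:
  assumes "finite J" "i \<notin> J" "j \<notin> J" "i \<noteq> j" "F \<in> borel_measurable (M i \<Otimes>\<^sub>M M j)"
  shows "(\<integral>\<^sup>+x. F (x i, x j) \<partial>PiM (insert i (insert j J)) M) =
     (\<integral>\<^sup>+z. F z \<partial>(M i \<Otimes>\<^sub>M M j)) * emeasure (PiM J M) (space (PiM J M))"
proof -
  interpret pair_sigma_finite "M i" "M j" by (intro pair_sigma_finite.intro sigma_finite_measures)
  note [measurable] = assms(5)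
  have "(\<lambda>x. F (x i, x j)) \<in> borel_measurable (PiM (insert i (insert j J)) M)"
    by (rule measurable_compose[OF _ assms(5)]) (auto intro!: measurable_Pair measurable_component_singleton)
  from product_nn_integral_insert[OF _ _ this]
  have "(\<integral>\<^sup>+x. F (x i, x j) \<partial>PiM (insert i (insert j J)) M) =
     (\<integral>\<^sup>+x. (\<integral>\<^sup>+a. F (a, x j) \<partial>M i) \<partial>PiM (insert j J) M)"
    using assms by simp
  also have "\<dots> = (\<integral>\<^sup>+b. (\<integral>\<^sup>+a. F (a, b) \<partial>M i) \<partial>M j) * emeasure (PiM J M) (space (PiM J M))"
    by (rule nn_integral_PiM_coordinate[OF assms(1,3)]) (use assms(5) in measurable)
  also have "(\<integral>\<^sup>+b. (\<integral>\<^sup>+a. F (a, b) \<partial>M i) \<partial>M j) = (\<integral>\<^sup>+z. F z \<partial>(M i \<Otimes>\<^sub>M M j))"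
    by (rule nn_integral_snd) simp
  finally show ?thesis .
qed

text \<open>A null set of one coordinate times the mass of the others is null even if that mass is
  infinite, since zero times infinity is zero in \<open>ennreal\<close>.\<close>

lemma (in product_sigma_finite) AE_PiM_coordinate:
  assumes "finite I" "j \<in> I" "AE y in M j. P y"
  shows "AE x in PiM I M. P (x j)"
proof -
  obtain N where N: "{y \<in> space (M j). \<not> P y} \<subseteq> N" "emeasure (M j) N = 0" "N \<in> sets (M j)"
    using assms(3) by (rule AE_E)
  have I: "I = insert j (I - {j})" using assms(2) by auto
  have "(\<integral>\<^sup>+x. indicator N (x j) \<partial>PiM I M) = 0"
    using nn_integral_PiM_coordinate[of "I - {j}" j "indicator N"] I assms(1) N by simp
  moreover have "(\<lambda>x. indicator N (x j) :: ennreal) \<in> borel_measurable (PiM I M)"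
    using N(3) assms(2) by (intro measurable_compose[OF measurable_component_singleton]) auto
  ultimately have nullset: "AE x in PiM I M. indicator N (x j) = (0 :: ennreal)" by (simp add: nn_integral_0_iff_AE)
  have "x j \<in> space (M j)" if "x \<in> space (PiM I M)" for x using that assms(2) by (auto simp: space_PiM PiE_def Pi_def)
  note in_space = this
  show ?thesis using nullset AE_space
  proof eventually_elim
    case (elim x)
    thus ?case using in_space[OF elim(2)] N(1) by (auto simp: indicator_def split: if_splits)
  qed
qed

lemma (in product_sigma_finite) AE_PiM_two_coordinates:
  assumes "finite I" "i \<in> I" "j \<in> I" "i \<noteq> j" "AE z in M i \<Otimes>\<^sub>M M j. P z"
  shows "AE x in PiM I M. P (x i, x j)"
proof -
  obtain N where N: "{z \<in> space (M i \<Otimes>\<^sub>M M j). \<not> P z} \<subseteq> N" "emeasure (M i \<Otimes>\<^sub>M M j) N = 0" "N \<in> sets (M i \<Otimes>\<^sub>M M j)"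
    using assms(5) by (rule AE_E)
  have I: "I = insert i (insert j (I - {i, j}))" using assms(2,3) by auto
  have "(\<integral>\<^sup>+x. indicator N (x i, x j) \<partial>PiM I M) = 0"
    using nn_integral_PiM_two_coordinates[of "I - {i, j}" i j "indicator N"] I assms(1,4) N by simp
  moreover have "(\<lambda>x. indicator N (x i, x j) :: ennreal) \<in> borel_measurable (PiM I M)"
    using N(3) assms(2,3) by (intro measurable_compose[OF _ borel_measurable_indicator[OF N(3)]] measurable_Pair measurable_component_singleton)
  ultimately have nullset: "AE x in PiM I M. indicator N (x i, x j) = (0 :: ennreal)" by (simp add: nn_integral_0_iff_AE)
  have "(x i, x j) \<in> space (M i \<Otimes>\<^sub>M M j)" if "x \<in> space (PiM I M)" for x
    using that assms(2,3) by (auto simp: space_PiM PiE_def Pi_def space_pair_measure)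
  note in_space = this
  show ?thesis using nullset AE_space
  proof eventually_elim
    case (elim x)
    thus ?case using in_space[OF elim(2)] N(1) by (auto simp: indicator_def split: if_splits)
  qed
qed

text \<open>The integral operator does not see the diagonal of its kernel, so \<open>quad\<close> says nothing about
  \<open>K(x,x)\<close>. The diagonal dominates the kernel only through the non-negativity of \<open>\<rho>\<^sub>2\<close>, stated as \<open>minor\<close>.\<close>

locale bounded_kernel = finite_measure M for M :: "'a measure" +
  fixes K :: "'a \<Rightarrow> 'a \<Rightarrow> complex" and \<kappa> :: "'a \<Rightarrow> nat" and N :: nat and R :: real
  assumes K_meas: "(\<lambda>z. K (fst z) (snd z)) \<in> borel_measurable (M \<Otimes>\<^sub>M M)"
    and herm: "\<And>x y. K y x = cnj (K x y)"
    and \<kappa>_meas: "\<kappa> \<in> measurable M (count_space UNIV)"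
    and \<kappa>_less: "\<And>x. \<kappa> x < N"
    and R0: "0 \<le> R"
    and diag: "AE x in M. 0 \<le> Re (K x x) \<and> Re (K x x) \<le> R"
    and minor: "AE z in M \<Otimes>\<^sub>M M. (cmod (K (fst z) (snd z)))\<^sup>2 \<le> Re (K (fst z) (fst z)) * Re (K (snd z) (snd z))"
    and quad: "\<And>(m :: nat) C u. (\<And>a. a < m \<Longrightarrow> C a \<in> sets M) \<Longrightarrow> disjoint_family_on C {..<m} \<Longrightarrow>
       0 \<le> Re (\<Sum>a<m. \<Sum>b<m. cnj (u a) * (\<integral>z. indicator (C a \<times> C b) z *\<^sub>R K (fst z) (snd z) \<partial>(M \<Otimes>\<^sub>M M)) * u b) \<and>
       Re (\<Sum>a<m. \<Sum>b<m. cnj (u a) * (\<integral>z. indicator (C a \<times> C b) z *\<^sub>R K (fst z) (snd z) \<partial>(M \<Otimes>\<^sub>M M)) * u b)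
         \<le> (\<Sum>a<m. (cmod (u a))\<^sup>2 * measure M (C a))"
begin

sublocale P: finite_measure "M \<Otimes>\<^sub>M M" by (rule finite_measure_pair)
sublocale PP: pair_sigma_finite M M ..
sublocale prod: product_sigma_finite "\<lambda>_ :: nat. M" by standard

definition Kp :: "'a \<times> 'a \<Rightarrow> complex" where "Kp z = K (fst z) (snd z)"

text \<open>Truncation changes K(x,x) only on a null set, but makes the bounds hold everywhere, so
  that partitions can be built without exceptional sets.\<close>

definition r :: "'a \<Rightarrow> real" where "r x = max 0 (min R (Re (K x x)))"

lemma Kp_meas [measurable]: "Kp \<in> borel_measurable (M \<Otimes>\<^sub>M M)"
  unfolding Kp_def[abs_def] by (rule K_meas)

lemma diag_meas [measurable]: "(\<lambda>x. K x x) \<in> borel_measurable M"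
proof -
  have "(\<lambda>x. Kp (x, x)) \<in> borel_measurable M" by measurable
  thus ?thesis by (simp add: Kp_def)
qed

lemma r_meas [measurable]: "r \<in> borel_measurable M"
  unfolding r_def[abs_def] by measurable

lemma r_bounds: "0 \<le> r x" "r x \<le> R"
  using R0 by (auto simp: r_def)

lemma r_integrable: "integrable M r"
  using r_bounds by (intro integrable_const_bound[where B = R]) auto

lemma r_eq: "AE x in M. K x x = complex_of_real (r x)"
  using diag
proof eventually_elim
  case (elim x)
  have "K x x = complex_of_real (Re (K x x))" using herm[of x x] by (simp add: complex_eq_iff)
  thus ?case using elim by (simp add: r_def)
qed

text \<open>The second minor bounds the kernel by the geometric mean of two diagonal values. The
  arithmetic mean is taken because it is linear in \<open>r\<close> and integrates over the square
  of a cell to \<open>d a * w a\<close>.\<close>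

lemma Kp_bound: "AE z in M \<Otimes>\<^sub>M M. cmod (Kp z) \<le> (r (fst z) + r (snd z)) / 2"
proof -
  have 1: "AE z in M \<Otimes>\<^sub>M M. K (fst z) (fst z) = complex_of_real (r (fst z))"
    by (rule PP.AE_pair_measure) (use r_eq in auto)
  have 2: "AE z in M \<Otimes>\<^sub>M M. K (snd z) (snd z) = complex_of_real (r (snd z))"
    by (rule PP.AE_pair_measure) (use r_eq in auto)
  show ?thesis using 1 2 minor
  proof eventually_elim
    case (elim z)
    have "(cmod (Kp z))\<^sup>2 \<le> r (fst z) * r (snd z)" using elim by (simp add: Kp_def)
    also have "\<dots> \<le> ((r (fst z) + r (snd z)) / 2)\<^sup>2"
      using sum_squares_bound[of "r (fst z)" "r (snd z)"] by (simp add: power2_eq_square field_simps)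
    finally show ?case by (rule power2_le_imp_le) (use r_bounds in \<open>simp add: add_nonneg_nonneg\<close>)
  qed
qed

lemma Kp_bound': "AE z in M \<Otimes>\<^sub>M M. cmod (Kp z) \<le> R"
  using Kp_bound
proof eventually_elim
  case (elim z)
  have "r (fst z) + r (snd z) \<le> R + R" by (intro add_mono r_bounds)
  thus ?case using elim by simp
qed

lemma Kp_integrable: "integrable (M \<Otimes>\<^sub>M M) Kp"
  by (rule P.integrable_const_bound[OF Kp_bound']) simp

lemma integral_pair_flip:
  fixes f :: "'a \<times> 'a \<Rightarrow> 'b::{banach, second_countable_topology}"
  assumes "f \<in> borel_measurable (M \<Otimes>\<^sub>M M)"
  shows "(\<integral>z. f z \<partial>(M \<Otimes>\<^sub>M M)) = (\<integral>z. f (snd z, fst z) \<partial>(M \<Otimes>\<^sub>M M))"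
  using PP.integral_product_swap[OF assms] unfolding case_prod_beta' by simp

text \<open>Common refinement of three partitions: the level sets of \<open>\<kappa>\<close>, a
  partition on which K is nearly constant in the mean, and the level sets of \<open>r\<close> in
  steps of e. The first keeps cells inside a single colour; the last makes the cell means of
  \<open>r\<close> uniformly close to \<open>r\<close>.\<close>

lemma partition_exists:
  assumes "0 < e"
  shows "\<exists>\<sigma> m cl. \<sigma> \<in> measurable M (count_space UNIV) \<and> (\<forall>x. \<sigma> x < m) \<and> (\<forall>c. cl c < N) \<and> (\<forall>x. cl (\<sigma> x) = \<kappa> x)
    \<and> (\<integral>z. cmod (Kp z - cellwise \<sigma> (\<lambda>a b. cell_integral \<sigma> Kp a b /
          complex_of_real (measure M (cell \<sigma> a) * measure M (cell \<sigma> b))) z) \<partial>(M \<Otimes>\<^sub>M M)) \<le> e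
    \<and> (\<forall>x y. \<sigma> x = \<sigma> y \<longrightarrow> \<bar>r x - r y\<bar> \<le> e)"
proof -
  \<comment> \<open>Half of e, because passing to the cell averages may double the error.\<close>
  obtain \<pi> m h where 1: "\<pi> \<in> measurable M (count_space UNIV)" "\<And>x. \<pi> x < m"
    "(\<integral>z. cmod (Kp z - cellwise \<pi> h z) \<partial>(M \<Otimes>\<^sub>M M)) < e / 2"
    using cell_approximable_integrable[OF Kp_integrable] assms unfolding cell_approximable_def
    by (meson half_gt_zero)
  note [measurable] = 1(1) \<kappa>_meas
  define fl where "fl x = nat \<lfloor>r x / e\<rfloor>" for x
  define F where "F = nat \<lfloor>R / e\<rfloor> + 1"
  have flF: "fl x < F" for x
  proof -
    have "\<lfloor>r x / e\<rfloor> \<le> \<lfloor>R / e\<rfloor>" using r_bounds(2)[of x] assms by (intro floor_mono divide_right_mono) auto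
    thus ?thesis by (simp add: fl_def F_def less_Suc_eq_le nat_mono)
  qed
  have [measurable]: "fl \<in> measurable M (count_space UNIV)" unfolding fl_def[abs_def] by measurable
  \<comment> \<open>Mixed radix with \<open>\<kappa> x\<close> as the lowest digit, so that the
    colour of a cell is its number modulo \<open>N\<close>.\<close>
  define \<sigma> where "\<sigma> x = \<kappa> x + N * (\<pi> x + m * fl x)" for x
  have N: "0 < N" using \<kappa>_less[of undefined] by simp
  have m: "0 < m" using 1(2)[of undefined] by simp
  have dec: "\<sigma> x mod N = \<kappa> x" "(\<sigma> x div N) mod m = \<pi> x" "(\<sigma> x div N) div m = fl x" for x
    using \<kappa>_less[of x] 1(2)[of x] N m by (auto simp: \<sigma>_def)
  have "\<sigma> \<in> measurable M (count_space UNIV)" unfolding \<sigma>_def[abs_def] by measurable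
  moreover have "\<sigma> x < N * (m * F)" for x
  proof -
    have "\<pi> x + m * fl x < m * (fl x + 1)" using 1(2)[of x] by simp
    also have "\<dots> \<le> m * F" using flF[of x] by (intro mult_le_mono) auto
    finally have "\<pi> x + m * fl x + 1 \<le> m * F" by simp
    hence "N * (\<pi> x + m * fl x + 1) \<le> N * (m * F)" by (intro mult_le_mono) auto
    thus ?thesis using \<kappa>_less[of x] by (simp add: \<sigma>_def)
  qed
  moreover have "c mod N < N" for c using N by simp
  moreover have "(\<integral>z. cmod (Kp z - cellwise \<sigma> (\<lambda>a b. cell_integral \<sigma> Kp a b /
          complex_of_real (measure M (cell \<sigma> a) * measure M (cell \<sigma> b))) z) \<partial>(M \<Otimes>\<^sub>M M)) \<le> e"
  proof -
    have "cellwise \<sigma> (\<lambda>a b. h ((a div N) mod m) ((b div N) mod m)) z = cellwise \<pi> h z" for z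
      unfolding cellwise_def dec ..
    thus ?thesis
      using cell_average_error[OF calculation(1,2) Kp_integrable, of "\<lambda>a b. h ((a div N) mod m) ((b div N) mod m)"] 1(3)
      by simp
  qed
  moreover have "\<bar>r x - r y\<bar> \<le> e" if "\<sigma> x = \<sigma> y" for x y
  proof -
    have "fl x = fl y" using dec(3)[of x] dec(3)[of y] that by simp
    moreover have "0 \<le> r x / e" "0 \<le> r y / e" using r_bounds(1) assms by auto
    ultimately have "\<lfloor>r x / e\<rfloor> = \<lfloor>r y / e\<rfloor>"
      unfolding fl_def using eq_nat_nat_iff zero_le_floor by blast
    hence "\<bar>r x / e - r y / e\<bar> \<le> 1" by linarith
    hence "\<bar>(r x - r y) / e\<bar> \<le> 1" by (simp add: diff_divide_distrib)
    thus ?thesis using assms by (simp add: abs_divide)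
  qed
  ultimately show ?thesis using dec(1) by (intro exI[of _ \<sigma>] exI[of _ "N * (m * F)"] exI[of _ "\<lambda>c. c mod N"]) simp
qed

text \<open>The factorial moment that the determinantal formula predicts for the restricted process,
  obtained below as the limit of the moments of step kernels.\<close>

definition limit_moment :: "nat \<Rightarrow> (nat \<Rightarrow> nat) \<Rightarrow> real" where
  "limit_moment n \<gamma> = (\<integral>x. of_bool (\<forall>j<n. \<kappa> (x j) = \<gamma> j) * Re (pminor (\<lambda>i j. K (x i) (x j)) [0..<n]) \<partial>(\<Pi>\<^sub>M i\<in>{..<n}. M))"

lemma finite_PiM: "finite_measure (\<Pi>\<^sub>M i\<in>{..<n :: nat}. M)"
proof
  have "emeasure (\<Pi>\<^sub>M i\<in>{..<n}. M) (\<Pi>\<^sub>E i\<in>{..<n}. space M) = (\<Prod>i<n. emeasure M (space M))"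
    by (rule prod.emeasure_PiM) auto
  also have "\<dots> \<noteq> \<infinity>" by (simp add: emeasure_eq_measure ennreal_power)
  finally show "emeasure (\<Pi>\<^sub>M i\<in>{..<n}. M) (space (\<Pi>\<^sub>M i\<in>{..<n}. M)) \<noteq> \<infinity>" by (simp add: space_PiM)
qed

context
  fixes \<sigma> :: "'a \<Rightarrow> nat" and m :: nat and cl :: "nat \<Rightarrow> nat"
  assumes \<sigma>: "\<sigma> \<in> measurable M (count_space UNIV)" "\<And>x. \<sigma> x < m"
    and cl: "\<And>c. cl c < N" "\<And>x. cl (\<sigma> x) = \<kappa> x"
begin

definition w :: "nat \<Rightarrow> real" where "w a = measure M (cell \<sigma> a)"
definition g :: "nat \<Rightarrow> nat \<Rightarrow> complex" where "g = cell_integral \<sigma> Kp"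
definition d :: "nat \<Rightarrow> real" where "d a = (\<integral>x. indicator (cell \<sigma> a) x * r x \<partial>M)"

lemma cell_meas [measurable]: "cell \<sigma> a \<in> sets M"
  by (rule cell_sets[OF \<sigma>(1)])

lemma cell_r_integrable: "integrable M (\<lambda>x. indicator (cell \<sigma> a) x * r x)"
  using integrable_mult_indicator[OF cell_meas r_integrable] by simp

lemma d_bounds: "0 \<le> d a" "d a \<le> R * w a"
proof -
  show "0 \<le> d a" unfolding d_def using r_bounds by (intro Bochner_Integration.integral_nonneg) auto
  have "d a \<le> (\<integral>x. indicator (cell \<sigma> a) x * R \<partial>M)"
    unfolding d_def
  proof (rule integral_mono[OF cell_r_integrable])
    show "integrable M (\<lambda>x. indicator (cell \<sigma> a) x * R)"
      using integrable_mult_indicator[OF cell_meas integrable_const, of a R] by simp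
    show "indicator (cell \<sigma> a) x * r x \<le> indicator (cell \<sigma> a) x * R" for x
      using r_bounds(2) by (intro mult_left_mono) auto
  qed
  thus "d a \<le> R * w a" by (simp add: w_def mult.commute)
qed

lemma sum_d: "(\<Sum>a<m. d a) = (\<integral>x. r x \<partial>M)"
proof -
  have "(\<Sum>a<m. d a) = (\<integral>x. (\<Sum>a<m. indicator (cell \<sigma> a) x * r x) \<partial>M)"
    unfolding d_def using cell_r_integrable by (intro Bochner_Integration.integral_sum[symmetric]) auto
  also have "\<dots> = (\<integral>x. r x \<partial>M)"
  proof (intro Bochner_Integration.integral_cong refl)
    fix x assume "x \<in> space M"
    hence "(\<Sum>a<m. indicator (cell \<sigma> a) x * r x) = (\<Sum>a<m. if a = \<sigma> x then r x else 0)"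
      by (intro sum.cong refl) (auto simp: cell_def)
    thus "(\<Sum>a<m. indicator (cell \<sigma> a) x * r x) = r x" using \<sigma>(2) by simp
  qed
  finally show ?thesis .
qed

lemma Kp_cell_integrable: "integrable (M \<Otimes>\<^sub>M M) (\<lambda>z. indicator (cell \<sigma> a \<times> cell \<sigma> b) z *\<^sub>R Kp z)"
  by (rule integrable_mult_indicator[OF _ Kp_integrable]) simp

lemma g_herm: "g b a = cnj (g a b)"
proof -
  have "g b a = (\<integral>z. indicator (cell \<sigma> b \<times> cell \<sigma> a) (snd z, fst z) *\<^sub>R Kp (snd z, fst z) \<partial>(M \<Otimes>\<^sub>M M))"
    unfolding g_def cell_integral_def
    by (rule integral_pair_flip[OF borel_measurable_integrable[OF Kp_cell_integrable]])
  also have "\<dots> = (\<integral>z. cnj (indicator (cell \<sigma> a \<times> cell \<sigma> b) z *\<^sub>R Kp z) \<partial>(M \<Otimes>\<^sub>M M))"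
    by (intro Bochner_Integration.integral_cong refl) (auto simp: Kp_def indicator_def split: prod.splits intro: herm)
  also have "\<dots> = cnj (g a b)" unfolding g_def cell_integral_def by (rule integral_bounded_linear[OF bounded_linear_cnj Kp_cell_integrable])
  finally show ?thesis .
qed

lemma cell_r_product:
  "(\<integral>z. indicator (cell \<sigma> a \<times> cell \<sigma> a) z * r (fst z) \<partial>(M \<Otimes>\<^sub>M M)) = d a * w a" (is ?A)
  "(\<integral>z. indicator (cell \<sigma> a \<times> cell \<sigma> a) z * r (snd z) \<partial>(M \<Otimes>\<^sub>M M)) = d a * w a" (is ?B)
proof -
  have int: "integrable (M \<Otimes>\<^sub>M M) (\<lambda>z. indicator (cell \<sigma> a \<times> cell \<sigma> a) z * r (fst z))"
    using r_bounds by (intro P.integrable_const_bound[where B = R]) (auto simp: indicator_def R0)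
  have "(\<integral>z. indicator (cell \<sigma> a \<times> cell \<sigma> a) z * r (fst z) \<partial>(M \<Otimes>\<^sub>M M)) =
      (\<integral>x. (\<integral>y. indicator (cell \<sigma> a \<times> cell \<sigma> a) (x, y) * r x \<partial>M) \<partial>M)"
    using PP.integral_fst'[OF int] by simp
  also have "\<dots> = (\<integral>x. indicator (cell \<sigma> a) x * r x * w a \<partial>M)"
  proof (intro Bochner_Integration.integral_cong refl)
    fix x
    have "(\<integral>y. indicator (cell \<sigma> a \<times> cell \<sigma> a) (x, y) * r x \<partial>M) = (\<integral>y. indicator (cell \<sigma> a) x * r x * indicator (cell \<sigma> a) y \<partial>M)"
      by (intro Bochner_Integration.integral_cong refl) (auto simp: indicator_def)
    thus "(\<integral>y. indicator (cell \<sigma> a \<times> cell \<sigma> a) (x, y) * r x \<partial>M) = indicator (cell \<sigma> a) x * r x * w a"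
      by (simp add: w_def)
  qed
  finally show A: ?A by (simp add: d_def)
  have "(\<integral>z. indicator (cell \<sigma> a \<times> cell \<sigma> a) z * r (snd z) \<partial>(M \<Otimes>\<^sub>M M))
     = (\<integral>z. indicator (cell \<sigma> a \<times> cell \<sigma> a) z * r (fst z) \<partial>(M \<Otimes>\<^sub>M M))"
  proof -
    have "(\<integral>z. indicator (cell \<sigma> a \<times> cell \<sigma> a) z * r (fst z) \<partial>(M \<Otimes>\<^sub>M M))
      = (\<integral>z. indicator (cell \<sigma> a \<times> cell \<sigma> a) (snd z, fst z) * r (snd z) \<partial>(M \<Otimes>\<^sub>M M))"
      using integral_pair_flip[OF borel_measurable_integrable[OF int]] by simp
    also have "\<dots> = (\<integral>z. indicator (cell \<sigma> a \<times> cell \<sigma> a) z * r (snd z) \<partial>(M \<Otimes>\<^sub>M M))"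
      by (intro Bochner_Integration.integral_cong refl) (auto simp: indicator_def)
    finally show ?thesis by simp
  qed
  thus ?B using A by simp
qed

text \<open>\<open>Kp_bound\<close> is integrated over the square of a cell, where both of its
  summands give \<open>d a * w a\<close>. This yields the hypothesis \<open>diag\<close> of
  \<open>cells\<close>: the average of K over the square is at most the mean of the
  diagonal.\<close>

lemma g_diag_le: "Re (g a a) \<le> d a * w a"
proof -
  have int: "integrable (M \<Otimes>\<^sub>M M) (\<lambda>z. indicator (cell \<sigma> a \<times> cell \<sigma> a) z * r (fst z))"
    "integrable (M \<Otimes>\<^sub>M M) (\<lambda>z. indicator (cell \<sigma> a \<times> cell \<sigma> a) z * r (snd z))"
    using r_bounds by (intro P.integrable_const_bound[where B = R]; auto simp: indicator_def R0)+
  have "Re (g a a) = (\<integral>z. Re (indicator (cell \<sigma> a \<times> cell \<sigma> a) z *\<^sub>R Kp z) \<partial>(M \<Otimes>\<^sub>M M))"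
    unfolding g_def cell_integral_def by (rule integral_Re[OF Kp_cell_integrable, symmetric])
  also have "\<dots> \<le> (\<integral>z. (indicator (cell \<sigma> a \<times> cell \<sigma> a) z * r (fst z) + indicator (cell \<sigma> a \<times> cell \<sigma> a) z * r (snd z)) / 2 \<partial>(M \<Otimes>\<^sub>M M))"
  proof (rule integral_mono_AE)
    show "AE z in M \<Otimes>\<^sub>M M. Re (indicator (cell \<sigma> a \<times> cell \<sigma> a) z *\<^sub>R Kp z)
       \<le> (indicator (cell \<sigma> a \<times> cell \<sigma> a) z * r (fst z) + indicator (cell \<sigma> a \<times> cell \<sigma> a) z * r (snd z)) / 2"
      using Kp_bound
    proof eventually_elim
      case (elim z)
      thus ?case using complex_Re_le_cmod[of "Kp z"] by (auto simp: indicator_def)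
    qed
    show "integrable (M \<Otimes>\<^sub>M M) (\<lambda>z. Re (indicator (cell \<sigma> a \<times> cell \<sigma> a) z *\<^sub>R Kp z))"
      by (rule integrable_Re[OF Kp_cell_integrable])
  qed (use int in auto)
  also have "\<dots> = (d a * w a + d a * w a) / 2"
    using int by (simp add: cell_r_product)
  finally show ?thesis by (simp add: mult.commute)
qed

lemma g_bound: "cmod (g a b) \<le> R * (w a * w b)"
proof -
  have "cmod (g a b) \<le> (\<integral>z. cmod (indicator (cell \<sigma> a \<times> cell \<sigma> b) z *\<^sub>R Kp z) \<partial>(M \<Otimes>\<^sub>M M))"
    unfolding g_def cell_integral_def by (rule integral_norm_bound)
  also have "\<dots> \<le> (\<integral>z. R * indicator (cell \<sigma> a \<times> cell \<sigma> b) z \<partial>(M \<Otimes>\<^sub>M M))"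
  proof (rule integral_mono_AE)
    show "integrable (M \<Otimes>\<^sub>M M) (\<lambda>z. cmod (indicator (cell \<sigma> a \<times> cell \<sigma> b) z *\<^sub>R Kp z))"
      using Kp_cell_integrable by (rule integrable_norm)
    show "integrable (M \<Otimes>\<^sub>M M) (\<lambda>z. R * indicator (cell \<sigma> a \<times> cell \<sigma> b) z)"
      by (simp add: P.emeasure_eq_measure)
    show "AE z in M \<Otimes>\<^sub>M M. cmod (indicator (cell \<sigma> a \<times> cell \<sigma> b) z *\<^sub>R Kp z) \<le> R * indicator (cell \<sigma> a \<times> cell \<sigma> b) z"
      using Kp_bound' by eventually_elim (auto simp: indicator_def)
  qed
  also have "\<dots> = R * (w a * w b)"
    using measure_cell_times[OF \<sigma>(1), of a b] by (simp add: w_def)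
  finally show ?thesis .
qed

lemma cells_locale: "cells m N w g d cl (R * measure M (space M))"
proof
  have disj: "disjoint_family_on (cell \<sigma>) {..<m}" by (auto simp: disjoint_family_on_def cell_def)
  note q = quad[of m "cell \<sigma>", OF cell_meas disj, folded Kp_def, folded cell_integral_def]
  fix u :: "nat \<Rightarrow> complex"
  show "0 \<le> Re (\<Sum>a<m. \<Sum>b<m. cnj (u a) * g a b * u b)"
    "Re (\<Sum>a<m. \<Sum>b<m. cnj (u a) * g a b * u b) \<le> (\<Sum>a<m. (cmod (u a))\<^sup>2 * w a)"
    using q[of u] unfolding g_def w_def by auto
next
  fix c
  show "0 \<le> w c" by (simp add: w_def)
  show "0 \<le> d c" by (rule d_bounds)
  have "w c \<le> measure M (space M)" unfolding w_def by (rule bounded_measure)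
  hence "R * w c \<le> R * measure M (space M)" using R0 by (rule mult_left_mono)
  thus "d c \<le> R * measure M (space M)" using d_bounds(2)[of c] by simp
  show "d c = 0" if "w c = 0" using d_bounds[of c] that by simp
  show "Re (g c c) / w c \<le> d c"
  proof (cases "w c = 0")
    case False
    hence "0 < w c" by (simp add: w_def less_le)
    thus ?thesis using g_diag_le[of c] by (simp add: pos_divide_le_eq)
  qed (use d_bounds in auto)
  show "cl c < N" by (rule cl)
qed (rule g_herm)

text \<open>The determinant of the step kernel is constant on each box of cells, so its integral is
  a sum over the tuples of cells with the prescribed colours.\<close>

lemma cell_moment_integral:
  "cell_moment m w g d cl n \<gamma> = (\<integral>x. of_bool (\<forall>j<n. \<kappa> (x j) = \<gamma> j) *
     Re (pminor (cell_kernel w g d (\<lambda>j. \<sigma> (x j))) [0..<n]) \<partial>(\<Pi>\<^sub>M i\<in>{..<n}. M))"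
proof -
  let ?Pi = "\<Pi>\<^sub>M i\<in>{..<n}. M"
  interpret Pi: finite_measure ?Pi by (rule finite_PiM)
  let ?C = "{c \<in> {..<n} \<rightarrow>\<^sub>E {..<m}. \<forall>j<n. cl (c j) = \<gamma> j}"
  define box where "box c = (\<Pi>\<^sub>E j\<in>{..<n}. cell \<sigma> (c j))" for c :: "nat \<Rightarrow> nat"
  define D where "D c = Re (pminor (cell_kernel w g d c) [0..<n])" for c
  have finC: "finite ?C" by (rule finite_subset[OF _ finite_PiE[of "{..<n}" "\<lambda>_. {..<m}"]]) auto
  have box_sets: "box c \<in> sets ?Pi" for c unfolding box_def by (intro sets_PiM_I_finite) auto
  have box_measure: "measure ?Pi (box c) = (\<Prod>j<n. w (c j))" for c
  proof -
    have "emeasure ?Pi (box c) = (\<Prod>j<n. emeasure M (cell \<sigma> (c j)))"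
      unfolding box_def by (rule prod.emeasure_PiM) auto
    also have "\<dots> = ennreal (\<Prod>j<n. w (c j))"
      by (simp add: emeasure_eq_measure w_def prod_ennreal)
    finally show ?thesis by (simp add: measure_def w_def prod_nonneg)
  qed
  have "(\<integral>x. of_bool (\<forall>j<n. \<kappa> (x j) = \<gamma> j) * Re (pminor (cell_kernel w g d (\<lambda>j. \<sigma> (x j))) [0..<n]) \<partial>?Pi)
    = (\<integral>x. (\<Sum>c\<in>?C. D c * indicator (box c) x) \<partial>?Pi)"
  proof (intro Bochner_Integration.integral_cong refl)
    fix x assume x: "x \<in> space ?Pi"
    hence xj: "x j \<in> space M" if "j < n" for j using that by (auto simp: space_PiM PiE_def Pi_def)
    define c0 where "c0 = restrict (\<lambda>j. \<sigma> (x j)) {..<n}"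
    have ind: "indicator (box c) x = (of_bool (c = c0) :: real)" if c: "c \<in> ?C" for c
    proof -
      have "x \<in> box c \<longleftrightarrow> (\<forall>j<n. \<sigma> (x j) = c j)"
        using x xj unfolding box_def by (auto simp: PiE_def Pi_def cell_def space_PiM)
      also have "\<dots> \<longleftrightarrow> c = c0"
        using c unfolding c0_def by (auto simp: fun_eq_iff PiE_def extensional_def)
      finally show ?thesis by (simp add: indicator_def)
    qed
    have "(\<Sum>c\<in>?C. D c * indicator (box c) x) = (\<Sum>c\<in>?C. if c = c0 then D c0 else 0)"
      by (intro sum.cong refl) (auto simp: ind)
    also have "\<dots> = (if c0 \<in> ?C then D c0 else 0)" using finC by (rule sum.delta)
    also have "c0 \<in> ?C \<longleftrightarrow> (\<forall>j<n. \<kappa> (x j) = \<gamma> j)" using \<sigma>(2) cl(2) by (auto simp: c0_def)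
    also have "D c0 = Re (pminor (cell_kernel w g d (\<lambda>j. \<sigma> (x j))) [0..<n])"
      unfolding D_def by (intro arg_cong[of _ _ Re] pminor_cong) (auto simp: cell_kernel_def c0_def)
    finally show "of_bool (\<forall>j<n. \<kappa> (x j) = \<gamma> j) * Re (pminor (cell_kernel w g d (\<lambda>j. \<sigma> (x j))) [0..<n])
       = (\<Sum>c\<in>?C. D c * indicator (box c) x)" by simp
  qed
  also have "\<dots> = (\<Sum>c\<in>?C. D c * measure ?Pi (box c))"
    using box_sets by (subst Bochner_Integration.integral_sum) (auto simp: Pi.emeasure_eq_measure)
  also have "\<dots> = cell_moment m w g d cl n \<gamma>"
    unfolding cell_moment_def cell_weight_def box_measure D_def by (intro sum.cong refl) simp
  finally show ?thesis by simp
qed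

lemma cell_kernel_measurable:
  assumes "i < n" "j < n"
  shows "(\<lambda>x. cell_kernel w g d (\<lambda>j. \<sigma> (x j)) i j) \<in> borel_measurable (\<Pi>\<^sub>M i\<in>{..<n}. M)"
proof (cases "i = j")
  case True
  have "(\<lambda>x. \<sigma> (x i)) \<in> measurable (\<Pi>\<^sub>M i\<in>{..<n}. M) (count_space UNIV)"
    using assms by (intro measurable_compose[OF measurable_component_singleton[of i "{..<n}" "\<lambda>_. M"] \<sigma>(1)]) auto
  hence "(\<lambda>x. complex_of_real (d (\<sigma> (x i)) / w (\<sigma> (x i)))) \<in> borel_measurable (\<Pi>\<^sub>M i\<in>{..<n}. M)"
    by (rule measurable_compose) simp
  thus ?thesis using True by (simp add: cell_kernel_def)
next
  case False
  have "(\<lambda>x. (x i, x j)) \<in> measurable (\<Pi>\<^sub>M i\<in>{..<n}. M) (M \<Otimes>\<^sub>M M)"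
    using assms by (intro measurable_Pair measurable_component_singleton) auto
  from measurable_compose[OF this cellwise_measurable[OF \<sigma>(1)], of "\<lambda>a b. g a b / complex_of_real (w a * w b)"]
  show ?thesis using False by (simp add: cell_kernel_def cellwise_def)
qed

lemma cell_kernel_bound: "cmod (cell_kernel w g d c i j) \<le> R"
proof -
  have w0: "0 \<le> w a" for a by (simp add: w_def)
  have 1: "cmod (g a b / complex_of_real (w a * w b)) \<le> R" for a b
  proof (cases "w a * w b = 0")
    case False
    hence "0 < w a * w b" using w0[of a] w0[of b] by (simp add: less_le)
    hence "cmod (g a b) / (w a * w b) \<le> R" using g_bound[of a b] by (simp add: pos_divide_le_eq)
    thus ?thesis unfolding norm_divide norm_of_real using w0 by (simp add: abs_of_nonneg)
  qed (use R0 in \<open>auto simp del: mult_eq_0_iff\<close>)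
  have 2: "\<bar>d a / w a\<bar> \<le> R" for a
  proof (cases "w a = 0")
    case False
    hence "0 < w a" using w0[of a] by (simp add: less_le)
    thus ?thesis using d_bounds[of a] by (simp add: pos_divide_le_eq)
  qed (use R0 in auto)
  show ?thesis
  proof (cases "i = j")
    case True
    hence "cell_kernel w g d c i j = complex_of_real (d (c i) / w (c i))" by (simp add: cell_kernel_def)
    thus ?thesis using 2[of "c i"] by (simp only: norm_of_real)
  next
    case False
    thus ?thesis using 1[of "c i" "c j"] unfolding cell_kernel_def by (simp only: if_False)
  qed
qed

lemma d_average:
  assumes "\<And>x y. \<sigma> x = \<sigma> y \<Longrightarrow> \<bar>r x - r y\<bar> \<le> e" "0 < w (\<sigma> x)"
  shows "\<bar>d (\<sigma> x) / w (\<sigma> x) - r x\<bar> \<le> e"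
proof -
  let ?C = "cell \<sigma> (\<sigma> x)"
  have C: "integrable M (\<lambda>y. indicator ?C y * c)" for c :: real by (simp add: emeasure_eq_measure)
  have "d (\<sigma> x) - r x * w (\<sigma> x) = (\<integral>y. indicator ?C y * r y \<partial>M) - (\<integral>y. indicator ?C y * r x \<partial>M)"
    by (simp add: d_def w_def)
  also have "\<dots> = (\<integral>y. indicator ?C y * r y - indicator ?C y * r x \<partial>M)"
    by (rule Bochner_Integration.integral_diff[symmetric, OF cell_r_integrable C])
  finally have eq: "d (\<sigma> x) - r x * w (\<sigma> x) = (\<integral>y. indicator ?C y * r y - indicator ?C y * r x \<partial>M)" .
  have "\<bar>d (\<sigma> x) - r x * w (\<sigma> x)\<bar> \<le> (\<integral>y. \<bar>indicator ?C y * r y - indicator ?C y * r x\<bar> \<partial>M)"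
    unfolding eq by (rule integral_abs_bound)
  also have "\<dots> \<le> (\<integral>y. indicator ?C y * e \<partial>M)"
  proof (rule integral_mono)
    fix y show "\<bar>indicator ?C y * r y - indicator ?C y * r x\<bar> \<le> indicator ?C y * e"
      using assms(1)[of y x] by (auto simp: indicator_def cell_def)
  qed (use cell_r_integrable C in auto)
  also have "\<dots> = e * w (\<sigma> x)" by (simp add: w_def)
  finally have "\<bar>d (\<sigma> x) - r x * w (\<sigma> x)\<bar> / w (\<sigma> x) \<le> e" using assms(2) by (simp add: pos_divide_le_eq)
  moreover have "\<bar>d (\<sigma> x) - r x * w (\<sigma> x)\<bar> / w (\<sigma> x) = \<bar>d (\<sigma> x) / w (\<sigma> x) - r x\<bar>"
  proof -
    have "d (\<sigma> x) / w (\<sigma> x) - r x = (d (\<sigma> x) - r x * w (\<sigma> x)) / w (\<sigma> x)"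
      using assms(2) by (simp add: diff_divide_distrib)
    thus ?thesis using assms(2) by (simp add: abs_divide)
  qed
  ultimately show ?thesis by simp
qed

lemma AE_cell_pos: "AE x in M. 0 < w (\<sigma> x)"
proof -
  have "AE x in M. x \<notin> cell \<sigma> a" if "w a = 0" for a
    using that by (intro AE_not_in) (auto simp: null_sets_def emeasure_eq_measure w_def)
  hence "AE x in M. \<forall>a. w a = 0 \<longrightarrow> x \<notin> cell \<sigma> a" unfolding AE_all_countable by simp
  with AE_space show ?thesis
  proof eventually_elim
    case (elim x)
    hence "w (\<sigma> x) \<noteq> 0" by (auto simp: cell_def)
    thus ?case by (simp add: w_def less_le)
  qed
qed

end

text \<open>The step kernels converge off the diagonal by approximation in the mean, and on the
  diagonal by the small oscillation of \<open>r\<close> on cells. For fixed n the determinants are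
  bounded, so their integrals converge, and both properties are closed under such limits.\<close>

lemma limit_moment_inequality:
  "moment_bounded N (\<integral>x. r x \<partial>M) limit_moment" "orthant_dependent N limit_moment"
proof -
  have "\<forall>k. \<exists>S. (case S of (\<sigma>, m, cl) \<Rightarrow> \<sigma> \<in> measurable M (count_space UNIV) \<and> (\<forall>x. \<sigma> x < m) \<and> (\<forall>c. cl c < N) \<and> (\<forall>x. cl (\<sigma> x) = \<kappa> x)
    \<and> (\<integral>z. cmod (Kp z - cellwise \<sigma> (\<lambda>a b. cell_integral \<sigma> Kp a b /
          complex_of_real (measure M (cell \<sigma> a) * measure M (cell \<sigma> b))) z) \<partial>(M \<Otimes>\<^sub>M M)) \<le> inverse (real (Suc k))
    \<and> (\<forall>x y. \<sigma> x = \<sigma> y \<longrightarrow> \<bar>r x - r y\<bar> \<le> inverse (real (Suc k))))"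
    using partition_exists[of "inverse (real (Suc k))" for k] by (simp add: split_paired_Ex)
  then obtain S where S: "\<And>k. (case S k of (\<sigma>, m, cl) \<Rightarrow> \<sigma> \<in> measurable M (count_space UNIV) \<and> (\<forall>x. \<sigma> x < m) \<and> (\<forall>c. cl c < N) \<and> (\<forall>x. cl (\<sigma> x) = \<kappa> x)
    \<and> (\<integral>z. cmod (Kp z - cellwise \<sigma> (\<lambda>a b. cell_integral \<sigma> Kp a b /
          complex_of_real (measure M (cell \<sigma> a) * measure M (cell \<sigma> b))) z) \<partial>(M \<Otimes>\<^sub>M M)) \<le> inverse (real (Suc k))
    \<and> (\<forall>x y. \<sigma> x = \<sigma> y \<longrightarrow> \<bar>r x - r y\<bar> \<le> inverse (real (Suc k))))"
    by (drule_tac choice) blast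
  define \<sigma> where "\<sigma> k = fst (S k)" for k
  define m where "m k = fst (snd (S k))" for k
  define cl where "cl k = snd (snd (S k))" for k
  define E where "E k = cellwise (\<sigma> k) (\<lambda>a b. g (\<sigma> k) a b / complex_of_real (w (\<sigma> k) a * w (\<sigma> k) b))" for k
  have \<sigma>: "\<sigma> k \<in> measurable M (count_space UNIV)" "\<sigma> k x < m k" "cl k c < N" "cl k (\<sigma> k x) = \<kappa> x" for k x c
    using S[of k] by (auto simp: \<sigma>_def m_def cl_def split: prod.splits)
  have err: "(\<integral>z. cmod (Kp z - E k z) \<partial>(M \<Otimes>\<^sub>M M)) \<le> inverse (real (Suc k))" for k
    using S[of k] unfolding E_def w_def[OF \<sigma>] g_def[OF \<sigma>] by (auto simp: \<sigma>_def m_def cl_def split: prod.splits)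
  have osc: "\<bar>r x - r y\<bar> \<le> inverse (real (Suc k))" if "\<sigma> k x = \<sigma> k y" for k x y
    using S[of k] that by (auto simp: \<sigma>_def m_def cl_def split: prod.splits)
  have iE: "integrable (M \<Otimes>\<^sub>M M) (\<lambda>z. Kp z - E k z)" for k
    unfolding E_def using Kp_integrable cellwise_integrable[OF \<sigma>(1,2)] by auto
  have "(\<lambda>k. \<integral>z. cmod (Kp z - E k z) \<partial>(M \<Otimes>\<^sub>M M)) \<longlonglongrightarrow> 0"
    by (rule tendsto_sandwich[OF _ _ tendsto_const LIMSEQ_inverse_real_of_nat])
       (use err in \<open>auto intro!: always_eventually Bochner_Integration.integral_nonneg\<close>)
  \<comment> \<open>Convergence in the mean yields convergence almost everywhere only along a
    subsequence.\<close>
  then obtain s where s: "strict_mono s" and conv: "AE z in M \<Otimes>\<^sub>M M. (\<lambda>k. Kp z - E (s k) z) \<longlonglongrightarrow> 0"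
    using tendsto_L1_AE_subseq[of "M \<Otimes>\<^sub>M M" "\<lambda>k z. Kp z - E k z", OF iE] by blast
  define wt where "wt k = w (\<sigma> (s k))" for k
  define gt where "gt k = g (\<sigma> (s k))" for k
  define dt where "dt k = d (\<sigma> (s k))" for k
  let ?mom = "\<lambda>k. cell_moment (m (s k)) (wt k) (gt k) (dt k) (cl (s k))"
  have loc: "cells (m (s k)) N (wt k) (gt k) (dt k) (cl (s k)) (R * measure M (space M))" for k
    unfolding wt_def gt_def dt_def by (rule cells_locale[OF \<sigma>])
  have mb: "moment_bounded N (\<integral>x. r x \<partial>M) (?mom k)" for k
  proof -
    have "moment_bounded N (\<Sum>c<m (s k). dt k c) (?mom k)" by (rule cells.cell_moment_inequality(1)[OF loc])
    thus ?thesis unfolding dt_def sum_d[OF \<sigma>] .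
  qed
  have od: "orthant_dependent N (?mom k)" for k by (rule cells.cell_moment_inequality(2)[OF loc])
  have lim: "(\<lambda>k. ?mom k n \<gamma>) \<longlonglongrightarrow> limit_moment n \<gamma>" for n \<gamma>
  proof -
    let ?Pi = "\<Pi>\<^sub>M i\<in>{..<n}. M"
    interpret Pi: finite_measure ?Pi by (rule finite_PiM)
    define ck where "ck k x = cell_kernel (wt k) (gt k) (dt k) (\<lambda>j. \<sigma> (s k) (x j))" for k and x :: "nat \<Rightarrow> 'a"
    have eq: "?mom k n \<gamma> = (\<integral>x. of_bool (\<forall>j<n. \<kappa> (x j) = \<gamma> j) * Re (pminor (ck k x) [0..<n]) \<partial>?Pi)" for k
      unfolding ck_def wt_def gt_def dt_def by (rule cell_moment_integral[OF \<sigma>])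
    have ind_meas: "(\<lambda>x. of_bool (\<forall>j<n. \<kappa> (x j) = \<gamma> j) :: real) \<in> borel_measurable ?Pi"
    proof -
      have [measurable]: "(\<lambda>x. \<kappa> (x j)) \<in> measurable ?Pi (count_space UNIV)" if "j < n" for j
        using that by (intro measurable_compose[OF measurable_component_singleton[of j "{..<n}" "\<lambda>_. M"] \<kappa>_meas]) auto
      have "(\<lambda>x. \<Prod>j<n. of_bool (\<kappa> (x j) = \<gamma> j) :: real) \<in> borel_measurable ?Pi"
        by (intro borel_measurable_prod) (auto intro!: measurable_compose[OF _ measurable_count_space[of "\<lambda>a. of_bool (a = _)"]])
      moreover have "(\<Prod>j<n. of_bool (\<kappa> (x j) = \<gamma> j) :: real) = of_bool (\<forall>j<n. \<kappa> (x j) = \<gamma> j)" for x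
        by (induction n) (auto simp: less_Suc_eq)
      ultimately show ?thesis by simp
    qed
    have K_entry: "(\<lambda>x. K (x i) (x j)) \<in> borel_measurable ?Pi" if "i < n" "j < n" for i j
    proof -
      have "(\<lambda>x. (x i, x j)) \<in> measurable ?Pi (M \<Otimes>\<^sub>M M)"
        using that by (intro measurable_Pair measurable_component_singleton) auto
      from measurable_compose[OF this Kp_meas] show ?thesis by (simp add: Kp_def)
    qed
    \<comment> \<open>For two distinct positions an exceptional null set of pairs stays null in the
      n-fold product. Equal positions are covered by \<open>A2\<close> and \<open>A3\<close>, where
      positive measure of the cell makes the quotient of \<open>dt\<close> by \<open>wt\<close> a
      genuine mean.\<close>
    have A1: "AE x in ?Pi. \<forall>i<n. \<forall>j<n. i \<noteq> j \<longrightarrow> (\<lambda>k. Kp (x i, x j) - E (s k) (x i, x j)) \<longlonglongrightarrow> 0"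
      unfolding AE_all_countable
      by (auto intro!: prod.AE_PiM_two_coordinates[OF _ _ _ _ conv] simp: imp_conjL AE_all_countable)
    have A2: "AE x in ?Pi. \<forall>i<n. K (x i) (x i) = complex_of_real (r (x i))"
      by (auto intro!: prod.AE_PiM_coordinate[OF _ _ r_eq] simp: AE_all_countable)
    have "AE x in M. \<forall>k. 0 < wt k (\<sigma> (s k) x)"
      unfolding AE_all_countable wt_def by (intro allI AE_cell_pos[OF \<sigma>])
    hence A3: "AE x in ?Pi. \<forall>i<n. \<forall>k. 0 < wt k (\<sigma> (s k) (x i))"
      by (auto intro!: prod.AE_PiM_coordinate simp: AE_all_countable)
    have "(\<lambda>k. \<integral>x. of_bool (\<forall>j<n. \<kappa> (x j) = \<gamma> j) * Re (pminor (ck k x) [0..<n]) \<partial>?Pi) \<longlonglongrightarrow>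
      (\<integral>x. of_bool (\<forall>j<n. \<kappa> (x j) = \<gamma> j) * Re (pminor (\<lambda>i j. K (x i) (x j)) [0..<n]) \<partial>?Pi)"
    proof (rule integral_dominated_convergence[where w = "\<lambda>_. fact n * R ^ n"])
      show "(\<lambda>x. of_bool (\<forall>j<n. \<kappa> (x j) = \<gamma> j) * Re (pminor (\<lambda>i j. K (x i) (x j)) [0..<n])) \<in> borel_measurable ?Pi"
        by (intro borel_measurable_times ind_meas measurable_compose[OF pminor_upt_measurable borel_measurable_Re] K_entry)
      show "(\<lambda>x. of_bool (\<forall>j<n. \<kappa> (x j) = \<gamma> j) * Re (pminor (ck k x) [0..<n])) \<in> borel_measurable ?Pi" for k
        unfolding ck_def wt_def gt_def dt_def
        by (intro borel_measurable_times ind_meas measurable_compose[OF pminor_upt_measurable borel_measurable_Re] cell_kernel_measurable[OF \<sigma>])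
      show "integrable ?Pi (\<lambda>_. fact n * R ^ n :: real)" by simp
      show "AE x in ?Pi. norm (of_bool (\<forall>j<n. \<kappa> (x j) = \<gamma> j) * Re (pminor (ck k x) [0..<n])) \<le> fact n * R ^ n" for k
      proof (rule AE_I2)
        fix x
        have "\<bar>Re (pminor (ck k x) [0..<n])\<bar> \<le> cmod (pminor (ck k x) [0..<n])" by (rule abs_Re_le_cmod)
        also have "\<dots> \<le> fact n * R ^ n"
          unfolding ck_def wt_def gt_def dt_def by (intro pminor_upt_bound cell_kernel_bound[OF \<sigma>])
        finally show "norm (of_bool (\<forall>j<n. \<kappa> (x j) = \<gamma> j) * Re (pminor (ck k x) [0..<n])) \<le> fact n * R ^ n"
          using R0 by auto
      qed
      show "AE x in ?Pi. (\<lambda>k. of_bool (\<forall>j<n. \<kappa> (x j) = \<gamma> j) * Re (pminor (ck k x) [0..<n]))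
          \<longlonglongrightarrow> of_bool (\<forall>j<n. \<kappa> (x j) = \<gamma> j) * Re (pminor (\<lambda>i j. K (x i) (x j)) [0..<n])"
        using A1 A2 A3
      proof eventually_elim
        case (elim x)
        show ?case
        proof (intro tendsto_mult tendsto_const tendsto_Re pminor_upt_tendsto)
          fix i j assume ij: "i < n" "j < n"
          show "(\<lambda>k. ck k x i j) \<longlonglongrightarrow> K (x i) (x j)"
          proof (cases "i = j")
            case True
            have bd: "\<bar>dt k (\<sigma> (s k) (x i)) / wt k (\<sigma> (s k) (x i)) - r (x i)\<bar> \<le> inverse (real (Suc (s k)))" for k
              unfolding dt_def wt_def using elim(3) ij(1)
              by (intro d_average[OF \<sigma>] osc) (auto simp: wt_def)
            have "(\<lambda>k. inverse (real (Suc (s k)))) \<longlonglongrightarrow> 0"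
              using LIMSEQ_subseq_LIMSEQ[OF LIMSEQ_inverse_real_of_nat s] by (simp add: o_def)
            hence "(\<lambda>k. \<bar>dt k (\<sigma> (s k) (x i)) / wt k (\<sigma> (s k) (x i)) - r (x i)\<bar>) \<longlonglongrightarrow> 0"
              by (rule tendsto_sandwich[OF _ _ tendsto_const, rotated 2]) (use bd in auto)
            hence "(\<lambda>k. dt k (\<sigma> (s k) (x i)) / wt k (\<sigma> (s k) (x i))) \<longlonglongrightarrow> r (x i)"
              by (simp add: tendsto_rabs_zero_iff LIM_zero_iff)
            hence "(\<lambda>k. complex_of_real (dt k (\<sigma> (s k) (x i)) / wt k (\<sigma> (s k) (x i)))) \<longlonglongrightarrow> complex_of_real (r (x i))"
              by (rule tendsto_of_real)
            thus ?thesis using True elim(2) ij by (simp add: ck_def cell_kernel_def)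
          next
            case False
            hence "(\<lambda>k. Kp (x i, x j) - E (s k) (x i, x j)) \<longlonglongrightarrow> 0" using elim(1) ij by blast
            hence "(\<lambda>k. Kp (x i, x j) - (Kp (x i, x j) - E (s k) (x i, x j))) \<longlonglongrightarrow> Kp (x i, x j) - 0"
              by (intro tendsto_intros)
            thus ?thesis using False
              by (simp add: ck_def cell_kernel_def E_def cellwise_def gt_def wt_def Kp_def)
          qed
        qed
      qed
    qed
    thus ?thesis unfolding eq limit_moment_def .
  qed
  show "moment_bounded N (\<integral>x. r x \<partial>M) limit_moment" by (rule moment_bounded_lim[OF mb lim])
  show "orthant_dependent N limit_moment" by (rule orthant_dependent_lim[OF mb od lim])
qed

end

subsection \<open>Restriction to a set of finite measure\<close>

lemma indicator_prod_measurable: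
  assumes "D \<in> sets \<mu>"
  shows "(\<lambda>x. \<Prod>i\<in>I. indicator D (x i) :: ennreal) \<in> borel_measurable (PiM I (\<lambda>_. \<mu>))"
proof (rule borel_measurable_prod_ennreal)
  fix i assume "i \<in> I"
  thus "(\<lambda>x. indicator D (x i) :: ennreal) \<in> borel_measurable (PiM I (\<lambda>_. \<mu>))"
    by (rule measurable_compose[OF measurable_component_singleton[of i I "\<lambda>_. \<mu>"] borel_measurable_indicator[OF assms]])
qed

lemma PiM_density_indicator:
  fixes \<mu> :: "'a measure"
  assumes "sigma_finite_measure \<mu>" "D \<in> sets \<mu>" "emeasure \<mu> D < \<infinity>" "finite I"
  shows "PiM I (\<lambda>_. density \<mu> (indicator D)) = density (PiM I (\<lambda>_. \<mu>)) (\<lambda>x. \<Prod>i\<in>I. indicator D (x i))"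
proof -
  let ?\<nu> = "density \<mu> (indicator D)"
  interpret \<mu>: product_sigma_finite "\<lambda>_. \<mu>" by (rule product_sigma_finite.intro) (rule assms(1))
  have "finite_measure ?\<nu>"
    by standard (use assms in \<open>simp add: emeasure_density\<close>)
  then interpret \<nu>f: finite_measure ?\<nu> .
  interpret \<nu>: product_sigma_finite "\<lambda>_. ?\<nu>" by standard
  have f: "(\<lambda>x. \<Prod>i\<in>I. indicator D (x i) :: ennreal) \<in> borel_measurable (PiM I (\<lambda>_. \<mu>))"
    by (rule indicator_prod_measurable[OF assms(2)])
  show ?thesis
  proof (rule \<nu>.PiM_eqI[symmetric, OF assms(4)])
    show "sets (density (PiM I (\<lambda>_. \<mu>)) (\<lambda>x. \<Prod>i\<in>I. indicator D (x i))) = sets (PiM I (\<lambda>_. ?\<nu>))"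
      by (simp cong: sets_PiM_cong)
    fix A assume "\<And>i. i \<in> I \<Longrightarrow> A i \<in> sets ?\<nu>"
    hence A: "\<And>i. i \<in> I \<Longrightarrow> A i \<in> sets \<mu>" by simp
    have "emeasure (density (PiM I (\<lambda>_. \<mu>)) (\<lambda>x. \<Prod>i\<in>I. indicator D (x i))) (Pi\<^sub>E I A)
      = (\<integral>\<^sup>+x. (\<Prod>i\<in>I. indicator D (x i)) * indicator (Pi\<^sub>E I A) x \<partial>PiM I (\<lambda>_. \<mu>))"
      using A assms(4) by (intro emeasure_density f sets_PiM_I_finite) auto
    also have "\<dots> = (\<integral>\<^sup>+x. (\<Prod>i\<in>I. indicator D (x i) * indicator (A i) (x i)) \<partial>PiM I (\<lambda>_. \<mu>))"
    proof (rule nn_integral_cong)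
      fix x assume "x \<in> space (PiM I (\<lambda>_. \<mu>))"
      hence "x \<in> Pi\<^sub>E I A \<longleftrightarrow> (\<forall>i\<in>I. x i \<in> A i)" by (auto simp: space_PiM PiE_def)
      hence "indicator (Pi\<^sub>E I A) x = (\<Prod>i\<in>I. indicator (A i) (x i) :: ennreal)"
        using assms(4) by (auto simp: indicator_def prod_zero_iff)
      thus "(\<Prod>i\<in>I. indicator D (x i)) * indicator (Pi\<^sub>E I A) x = (\<Prod>i\<in>I. indicator D (x i) * indicator (A i) (x i) :: ennreal)"
        by (simp add: prod.distrib)
    qed
    also have "\<dots> = (\<Prod>i\<in>I. \<integral>\<^sup>+y. indicator D y * indicator (A i) y \<partial>\<mu>)"
      using A assms(2) by (intro \<mu>.product_nn_integral_prod[OF assms(4)]) auto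
    also have "\<dots> = (\<Prod>i\<in>I. emeasure ?\<nu> (A i))"
      using A assms(2) by (intro prod.cong refl) (simp add: emeasure_density)
    finally show "emeasure (density (PiM I (\<lambda>_. \<mu>)) (\<lambda>x. \<Prod>i\<in>I. indicator D (x i))) (Pi\<^sub>E I A) = (\<Prod>i\<in>I. emeasure ?\<nu> (A i))" .
  qed
qed

lemma AE_PiM_density_indicator:
  assumes "sigma_finite_measure \<mu>" "D \<in> sets \<mu>" "emeasure \<mu> D < \<infinity>" "finite I" "AE x in PiM I (\<lambda>_. \<mu>). P x"
  shows "AE x in PiM I (\<lambda>_. density \<mu> (indicator D)). P x"
proof -
  have f: "(\<lambda>x. \<Prod>i\<in>I. indicator D (x i) :: ennreal) \<in> borel_measurable (PiM I (\<lambda>_. \<mu>))"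
    by (rule indicator_prod_measurable[OF assms(2)])
  show ?thesis
    unfolding PiM_density_indicator[OF assms(1-4)] AE_density[OF f] using assms(5) by auto
qed

text \<open>Together with \<open>AE_PiM_pairD\<close> this brings statements about intensities,
  which live on spaces of tuples, back to points and pairs.\<close>

lemma (in product_sigma_finite) AE_PiM_singletonD:
  assumes "AE x in PiM {j} M. P (x j)" "{y \<in> space (M j). \<not> P y} \<in> sets (M j)"
  shows "AE y in M j. P y"
proof -
  let ?N = "{y \<in> space (M j). \<not> P y}"
  have "(\<integral>\<^sup>+x. indicator ?N (x j) \<partial>PiM {j} M) = (\<integral>\<^sup>+x. 0 \<partial>PiM {j} M)"
    using assms(1) by (intro nn_integral_cong_AE) (auto elim!: AE_mp)
  moreover have "(\<integral>\<^sup>+x. indicator ?N (x j) \<partial>PiM {j} M) = emeasure (M j) ?N"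
    using product_nn_integral_singleton[of "indicator ?N" j] assms(2) by simp
  ultimately have "emeasure (M j) ?N = 0" by simp
  thus ?thesis using assms(2) by (intro AE_I[of _ _ ?N]) auto
qed

lemma (in product_sigma_finite) AE_PiM_pairD:
  assumes "AE x in PiM {i, j} M. P (x i, x j)" "i \<noteq> j" "{z \<in> space (M i \<Otimes>\<^sub>M M j). \<not> P z} \<in> sets (M i \<Otimes>\<^sub>M M j)"
  shows "AE z in M i \<Otimes>\<^sub>M M j. P z"
proof -
  let ?N = "{z \<in> space (M i \<Otimes>\<^sub>M M j). \<not> P z}"
  have "(\<integral>\<^sup>+x. indicator ?N (x i, x j) \<partial>PiM {i, j} M) = (\<integral>\<^sup>+x. 0 \<partial>PiM {i, j} M)"
    using assms(1) by (intro nn_integral_cong_AE) (auto elim!: AE_mp)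
  moreover have "(\<integral>\<^sup>+x. indicator ?N (x i, x j) \<partial>PiM {i, j} M) = emeasure (M i \<Otimes>\<^sub>M M j) ?N"
    using nn_integral_PiM_two_coordinates[of "{}" i j "indicator ?N"] assms(2,3)
    by (simp add: space_PiM_empty emeasure_PiM_empty PiM_empty)
  ultimately have "emeasure (M i \<Otimes>\<^sub>M M j) ?N = 0" by simp
  thus ?thesis using assms(3) by (intro AE_I[of _ _ ?N]) auto
qed

text \<open>Only the measure is cut down to \<open>D\<close>; the operator stays on the functions
  over \<open>\<mu>\<close>, and functions on \<open>D\<close> enter it after extension by
  zero.\<close>

locale dpp_on_set = sigma_finite_measure \<mu> for \<mu> :: "'a::t2_space measure" +
  fixes K :: "'a \<Rightarrow> 'a \<Rightarrow> complex" and D :: "'a set" and R :: real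
  assumes sets_\<mu>: "sets \<mu> = sets borel"
    and hK: "hermitian_kernel K"
    and iK: "induces_operator \<mu> K"
    and nonneg: "nonneg_operator \<mu> (integral_operator \<mu> K)"
    and contr: "contraction \<mu> (integral_operator \<mu> K)"
    and D: "D \<in> sets \<mu>" "emeasure \<mu> D < \<infinity>"
    and R: "0 \<le> R" "\<And>x. x \<in> D \<Longrightarrow> Re (K x x) \<le> R"
    and diag_nonneg: "AE x in \<mu>. 0 \<le> Re (K x x)"
    and minor_nonneg: "AE z in \<mu> \<Otimes>\<^sub>M \<mu>. (cmod (K (fst z) (snd z)))\<^sup>2 \<le> Re (K (fst z) (fst z)) * Re (K (snd z) (snd z))"
begin

abbreviation "\<nu> \<equiv> density \<mu> (indicator D)"

lemma finite_\<nu>: "finite_measure \<nu>"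
  by standard (use D in \<open>simp add: emeasure_density\<close>)

sublocale \<nu>: finite_measure \<nu> by (rule finite_\<nu>)
sublocale \<nu>P: finite_measure "\<nu> \<Otimes>\<^sub>M \<nu>" by (rule \<nu>.finite_measure_pair)
sublocale \<nu>2: pair_sigma_finite \<nu> \<nu> ..
sublocale \<mu>2: pair_sigma_finite \<mu> \<mu> ..

lemma K_herm: "K y x = cnj (K x y)"
  using hK unfolding hermitian_kernel_def by blast

lemma K_meas: "(\<lambda>z. K (fst z) (snd z)) \<in> borel_measurable (\<mu> \<Otimes>\<^sub>M \<mu>)"
  using iK unfolding induces_operator_def by (simp add: split_beta')

lemma sets_\<nu>P: "sets (\<nu> \<Otimes>\<^sub>M \<nu>) = sets (\<mu> \<Otimes>\<^sub>M \<mu>)"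
  by (intro sets_pair_measure_cong) auto

lemma K_meas': "(\<lambda>z. K (fst z) (snd z)) \<in> borel_measurable (\<nu> \<Otimes>\<^sub>M \<nu>)"
  using K_meas by (simp add: measurable_cong_sets[OF sets_\<nu>P refl])

lemma K_section: "K x \<in> borel_measurable \<mu>"
proof -
  have "x \<in> space \<mu>" using sets_eq_imp_space_eq[OF sets_\<mu>] by simp
  hence "(\<lambda>y. (x, y)) \<in> measurable \<mu> (\<mu> \<Otimes>\<^sub>M \<mu>)" by (intro measurable_Pair1') simp
  from measurable_compose[OF this K_meas] show ?thesis by simp
qed

lemma AE_pair_density:
  assumes "AE z in \<mu> \<Otimes>\<^sub>M \<mu>. P z"
  shows "AE z in \<nu> \<Otimes>\<^sub>M \<nu>. P z"
proof -
  have eq: "\<nu> \<Otimes>\<^sub>M \<nu> = density (\<mu> \<Otimes>\<^sub>M \<mu>) (\<lambda>(x, y). indicator D x * indicator D y)"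
    using D by (intro pair_measure_density \<nu>.sigma_finite_measure_axioms sigma_finite_measure_axioms) auto
  have "(\<lambda>(x, y). indicator D x * indicator D y :: ennreal) \<in> borel_measurable (\<mu> \<Otimes>\<^sub>M \<mu>)"
    using D by measurable
  note dens = this
  have "AE z in \<mu> \<Otimes>\<^sub>M \<mu>. 0 < (\<lambda>(x, y). indicator D x * indicator D y :: ennreal) z \<longrightarrow> P z"
    using assms by eventually_elim simp
  thus ?thesis unfolding eq AE_density[OF dens] .
qed

lemma diag_\<nu>: "AE x in \<nu>. 0 \<le> Re (K x x) \<and> Re (K x x) \<le> R"
proof -
  have "AE x in \<mu>. 0 < (indicator D x :: ennreal) \<longrightarrow> 0 \<le> Re (K x x) \<and> Re (K x x) \<le> R"
    using diag_nonneg by eventually_elim (auto simp: indicator_def R split: if_splits)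
  thus ?thesis using D by (subst AE_density) auto
qed

lemma K_bound_\<nu>: "AE z in \<nu> \<Otimes>\<^sub>M \<nu>. cmod (K (fst z) (snd z)) \<le> R"
proof -
  have [measurable]: "(\<lambda>x. K x x) \<in> borel_measurable \<nu>"
  proof -
    have "(\<lambda>x. (x, x)) \<in> measurable \<nu> (\<nu> \<Otimes>\<^sub>M \<nu>)" by measurable
    from measurable_compose[OF this K_meas'] show ?thesis by simp
  qed
  have 1: "AE z in \<nu> \<Otimes>\<^sub>M \<nu>. 0 \<le> Re (K (fst z) (fst z)) \<and> Re (K (fst z) (fst z)) \<le> R"
  proof (rule \<nu>2.AE_pair_measure)
    show "{z \<in> space (\<nu> \<Otimes>\<^sub>M \<nu>). 0 \<le> Re (K (fst z) (fst z)) \<and> Re (K (fst z) (fst z)) \<le> R} \<in> sets (\<nu> \<Otimes>\<^sub>M \<nu>)"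
      by measurable
    show "AE x in \<nu>. AE y in \<nu>. 0 \<le> Re (K (fst (x, y)) (fst (x, y))) \<and> Re (K (fst (x, y)) (fst (x, y))) \<le> R"
      using diag_\<nu> by eventually_elim simp
  qed
  have 2: "AE z in \<nu> \<Otimes>\<^sub>M \<nu>. 0 \<le> Re (K (snd z) (snd z)) \<and> Re (K (snd z) (snd z)) \<le> R"
  proof (rule \<nu>2.AE_pair_measure)
    show "{z \<in> space (\<nu> \<Otimes>\<^sub>M \<nu>). 0 \<le> Re (K (snd z) (snd z)) \<and> Re (K (snd z) (snd z)) \<le> R} \<in> sets (\<nu> \<Otimes>\<^sub>M \<nu>)"
      by measurable
    show "AE x in \<nu>. AE y in \<nu>. 0 \<le> Re (K (snd (x, y)) (snd (x, y))) \<and> Re (K (snd (x, y)) (snd (x, y))) \<le> R"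
      using diag_\<nu> by simp
  qed
  show ?thesis using 1 2 AE_pair_density[OF minor_nonneg]
  proof eventually_elim
    case (elim z)
    have "(cmod (K (fst z) (snd z)))\<^sup>2 \<le> Re (K (fst z) (fst z)) * Re (K (snd z) (snd z))" using elim by blast
    also have "\<dots> \<le> R * R" using elim R(1) by (intro mult_mono) auto
    also have "\<dots> = R\<^sup>2" by (rule power2_eq_square[symmetric])
    finally show ?case using R(1) by (rule power2_le_imp_le)
  qed
qed

lemma K_integrable_\<nu>: "integrable (\<nu> \<Otimes>\<^sub>M \<nu>) (\<lambda>z. K (fst z) (snd z))"
  by (rule \<nu>P.integrable_const_bound[OF K_bound_\<nu> K_meas'])

text \<open>The step function with values u, cut off outside \<open>D\<close>, is a test function
  \<open>\<phi>\<close>, and q is the inner product of its image with \<open>\<phi>\<close>. The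
  first bound is non-negativity of the operator. For the second, the inner product is at most half
  the sum of the two squared norms, and by contraction neither exceeds that of
  \<open>\<phi>\<close>.\<close>

lemma quad_form:
  fixes C :: "nat \<Rightarrow> 'a set" and u :: "nat \<Rightarrow> complex"
  assumes C: "\<And>a. a < m \<Longrightarrow> C a \<in> sets \<nu>" and disj: "disjoint_family_on C {..<m}"
  defines "q \<equiv> (\<Sum>a<m. \<Sum>b<m. cnj (u a) * (\<integral>z. indicator (C a \<times> C b) z *\<^sub>R K (fst z) (snd z) \<partial>(\<nu> \<Otimes>\<^sub>M \<nu>)) * u b)"
  shows "0 \<le> Re q" "Re q \<le> (\<Sum>a<m. (cmod (u a))\<^sup>2 * measure \<nu> (C a))"
proof -
  let ?T = "integral_operator \<mu> K"
  define f where "f x = (\<Sum>a<m. u a * indicator (C a) x)" for x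
  define \<phi> where "\<phi> x = indicator D x *\<^sub>R f x" for x
  define B where "B = (\<Sum>a<m. cmod (u a))"
  have C\<mu>: "C a \<in> sets \<mu>" if "a < m" for a using C[OF that] by simp
  have f_meas [measurable]: "f \<in> borel_measurable \<mu>"
    unfolding f_def[abs_def] using C\<mu> by (intro borel_measurable_sum borel_measurable_times borel_measurable_const) auto
  have f_meas' [measurable]: "f \<in> borel_measurable \<nu>" using f_meas by simp
  have \<phi>_meas [measurable]: "\<phi> \<in> borel_measurable \<mu>" unfolding \<phi>_def[abs_def] using D by measurable
  have f_bound: "cmod (f x) \<le> B" for x
    unfolding f_def B_def by (rule order_trans[OF norm_sum]) (auto intro!: sum_mono simp: norm_mult indicator_def)
  have B0: "0 \<le> B" unfolding B_def by (intro sum_nonneg) auto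
  have int_density: "(\<integral>x. h x \<partial>\<nu>) = (\<integral>x. indicator D x *\<^sub>R h x \<partial>\<mu>)" if "h \<in> borel_measurable \<mu>"
    for h :: "'a \<Rightarrow> 'b::{banach, second_countable_topology}"
    using integral_density[OF that, of "indicator D"] D by (simp add: ennreal_indicator)
  have \<phi>2: "(cmod (\<phi> x))\<^sup>2 = indicator D x * (cmod (f x))\<^sup>2" for x by (simp add: \<phi>_def indicator_def)
  have \<phi>L2: "\<phi> \<in> L2 \<mu>"
    unfolding L2_def
  proof (intro CollectI conjI \<phi>_meas)
    have 1: "integrable \<mu> (\<lambda>x. B\<^sup>2 * indicator D x)" using D by simp
    show "integrable \<mu> (\<lambda>x. (cmod (\<phi> x))\<^sup>2)"
    proof (rule Bochner_Integration.integrable_bound[OF 1])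
      show "(\<lambda>x. (cmod (\<phi> x))\<^sup>2) \<in> borel_measurable \<mu>" by measurable
      show "AE x in \<mu>. norm ((cmod (\<phi> x))\<^sup>2) \<le> norm (B\<^sup>2 * indicator D x)"
        using f_bound B0 by (auto intro!: AE_I2 power_mono simp: \<phi>2 indicator_def)
    qed
  qed
  \<comment> \<open>Disjointness leaves at most one non-zero summand at each point.\<close>
  have f_sq: "(cmod (f x))\<^sup>2 = (\<Sum>a<m. (cmod (u a))\<^sup>2 * indicator (C a) x)" for x
  proof (cases "\<exists>a<m. x \<in> C a")
    case True
    then obtain a where a: "a < m" "x \<in> C a" by auto
    have ind: "indicator (C b) x = (if b = a then 1 else 0 :: 'c::zero_neq_one)" if "b < m" for b
      using a that disj by (auto simp: disjoint_family_on_def indicator_def)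
    have "f x = (\<Sum>b<m. if b = a then u b else 0)" unfolding f_def by (intro sum.cong refl) (simp add: ind)
    moreover have "(\<Sum>b<m. (cmod (u b))\<^sup>2 * indicator (C b) x) = (\<Sum>b<m. if b = a then (cmod (u b))\<^sup>2 else 0)"
      by (intro sum.cong refl) (simp add: ind)
    ultimately show ?thesis using a(1) by simp
  next
    case False
    thus ?thesis by (simp add: f_def indicator_def)
  qed
  have norm_\<phi>: "(\<integral>x. (cmod (\<phi> x))\<^sup>2 \<partial>\<mu>) = (\<Sum>a<m. (cmod (u a))\<^sup>2 * measure \<nu> (C a))"
  proof -
    have "(\<integral>x. (cmod (\<phi> x))\<^sup>2 \<partial>\<mu>) = (\<integral>x. (cmod (f x))\<^sup>2 \<partial>\<nu>)"
      unfolding \<phi>2 by (subst int_density) auto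
    also have "\<dots> = (\<Sum>a<m. (cmod (u a))\<^sup>2 * measure \<nu> (C a))"
      unfolding f_sq using C\<mu> by (subst Bochner_Integration.integral_sum) (auto simp: \<nu>.emeasure_eq_measure)
    finally show ?thesis .
  qed
  have T\<phi>: "?T \<phi> \<in> L2 \<mu>" using nonneg \<phi>L2 unfolding nonneg_operator_def bounded_operator_def by blast
  hence T_meas [measurable]: "?T \<phi> \<in> borel_measurable \<mu>" by (simp add: L2_def)
  have T_eq: "?T \<phi> x = (\<integral>y. K x y * f y \<partial>\<nu>)" for x
    unfolding integral_operator_def \<phi>_def using K_section[of x] by (subst int_density) auto
  define F where "F z = K (fst z) (snd z) * f (snd z) * cnj (f (fst z))" for z
  have F_int: "integrable (\<nu> \<Otimes>\<^sub>M \<nu>) F"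
  proof (rule \<nu>P.integrable_const_bound[where B = "R * B * B"])
    show "AE z in \<nu> \<Otimes>\<^sub>M \<nu>. norm (F z) \<le> R * B * B"
      using K_bound_\<nu>
    proof eventually_elim
      case (elim z)
      thus ?case unfolding F_def norm_mult complex_mod_cnj
        using f_bound B0 R by (intro mult_mono mult_nonneg_nonneg) auto
    qed
    have [measurable]: "(\<lambda>x. cnj (f x)) \<in> borel_measurable \<nu>"
      by (rule measurable_compose[OF f_meas' borel_measurable_continuous_onI]) (intro continuous_intros)
    show "F \<in> borel_measurable (\<nu> \<Otimes>\<^sub>M \<nu>)" unfolding F_def[abs_def] using K_meas' by measurable
  qed
  have cnj_meas: "(\<lambda>x. cnj (f x)) \<in> borel_measurable \<mu>"
    by (rule measurable_compose[OF f_meas borel_measurable_continuous_onI]) (intro continuous_intros)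
  have "L2_inner \<mu> (?T \<phi>) \<phi> = (\<integral>x. indicator D x *\<^sub>R (?T \<phi> x * cnj (f x)) \<partial>\<mu>)"
    unfolding L2_inner_def by (intro Bochner_Integration.integral_cong refl) (simp add: \<phi>_def)
  also have "\<dots> = (\<integral>x. ?T \<phi> x * cnj (f x) \<partial>\<nu>)"
    by (rule int_density[OF borel_measurable_times[OF T_meas cnj_meas], symmetric])
  also have "\<dots> = (\<integral>x. (\<integral>y. F (x, y) \<partial>\<nu>) \<partial>\<nu>)"
    unfolding T_eq F_def by (intro Bochner_Integration.integral_cong refl) simp
  also have "\<dots> = (\<integral>z. F z \<partial>(\<nu> \<Otimes>\<^sub>M \<nu>))" by (rule \<nu>2.integral_fst'[OF F_int])
  also have "\<dots> = (\<integral>z. (\<Sum>a<m. \<Sum>b<m. cnj (u a) * (indicator (C a \<times> C b) z *\<^sub>R K (fst z) (snd z)) * u b) \<partial>(\<nu> \<Otimes>\<^sub>M \<nu>))"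
  proof (intro Bochner_Integration.integral_cong refl)
    fix z
    have "F z = (\<Sum>a<m. cnj (u a) * indicator (C a) (fst z)) * K (fst z) (snd z) * (\<Sum>b<m. u b * indicator (C b) (snd z))"
    proof -
      have "cnj (f (fst z)) = (\<Sum>a<m. cnj (u a) * indicator (C a) (fst z))"
        unfolding f_def cnj_sum by (intro sum.cong refl) (auto simp: indicator_def)
      thus ?thesis unfolding F_def by (simp add: f_def mult_ac)
    qed
    also have "\<dots> = (\<Sum>a<m. \<Sum>b<m. (cnj (u a) * indicator (C a) (fst z)) * K (fst z) (snd z) * (u b * indicator (C b) (snd z)))"
      by (simp only: sum_distrib_left sum_distrib_right)
         (rule sum.swap)
    also have "\<dots> = (\<Sum>a<m. \<Sum>b<m. cnj (u a) * (indicator (C a \<times> C b) z *\<^sub>R K (fst z) (snd z)) * u b)"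
      by (intro sum.cong refl) (auto simp: indicator_def mem_Times_iff)
    finally show "F z = (\<Sum>a<m. \<Sum>b<m. cnj (u a) * (indicator (C a \<times> C b) z *\<^sub>R K (fst z) (snd z)) * u b)" .
  qed
  also have "\<dots> = q"
  proof -
    have i: "integrable (\<nu> \<Otimes>\<^sub>M \<nu>) (\<lambda>z. indicator (C a \<times> C b) z *\<^sub>R K (fst z) (snd z))" if "a < m" "b < m" for a b
      using C that by (intro integrable_mult_indicator K_integrable_\<nu>) auto
    have i': "integrable (\<nu> \<Otimes>\<^sub>M \<nu>) (\<lambda>z. cnj (u a) * (indicator (C a \<times> C b) z *\<^sub>R K (fst z) (snd z)) * u b)" if "a < m" "b < m" for a b
      by (intro integrable_mult_left integrable_mult_right i that)
    have "(\<integral>z. (\<Sum>a<m. \<Sum>b<m. cnj (u a) * (indicator (C a \<times> C b) z *\<^sub>R K (fst z) (snd z)) * u b) \<partial>(\<nu> \<Otimes>\<^sub>M \<nu>))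
      = (\<Sum>a<m. \<integral>z. (\<Sum>b<m. cnj (u a) * (indicator (C a \<times> C b) z *\<^sub>R K (fst z) (snd z)) * u b) \<partial>(\<nu> \<Otimes>\<^sub>M \<nu>))"
      using i' by (intro Bochner_Integration.integral_sum Bochner_Integration.integrable_sum) auto
    also have "\<dots> = (\<Sum>a<m. \<Sum>b<m. \<integral>z. cnj (u a) * (indicator (C a \<times> C b) z *\<^sub>R K (fst z) (snd z)) * u b \<partial>(\<nu> \<Otimes>\<^sub>M \<nu>))"
      using i' by (intro sum.cong refl Bochner_Integration.integral_sum) auto
    also have "\<dots> = q"
      unfolding q_def by (simp only: integral_mult_left_zero integral_mult_right_zero)
    finally show ?thesis .
  qed
  finally have inner: "L2_inner \<mu> (?T \<phi>) \<phi> = q" .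
  have "L2_inner \<mu> (?T \<phi>) \<phi> \<in> \<real>\<^sub>\<ge>\<^sub>0" using nonneg \<phi>L2 unfolding nonneg_operator_def by blast
  thus "0 \<le> Re q" unfolding inner by (simp add: complex_nonneg_Reals_iff)
  have "L2_norm \<mu> (?T \<phi>) \<le> L2_norm \<mu> \<phi>" using contr \<phi>L2 unfolding contraction_def by blast
  hence norm_le: "(\<integral>x. (cmod (?T \<phi> x))\<^sup>2 \<partial>\<mu>) \<le> (\<integral>x. (cmod (\<phi> x))\<^sup>2 \<partial>\<mu>)" by (simp add: L2_norm_def)
  have iT: "integrable \<mu> (\<lambda>x. (cmod (?T \<phi> x))\<^sup>2)" and i\<phi>: "integrable \<mu> (\<lambda>x. (cmod (\<phi> x))\<^sup>2)"
    using T\<phi> \<phi>L2 by (auto simp: L2_def)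
  have prod_le: "cmod (?T \<phi> x * cnj (\<phi> x)) \<le> ((cmod (?T \<phi> x))\<^sup>2 + (cmod (\<phi> x))\<^sup>2) / 2" for x
    using sum_squares_bound[of "cmod (?T \<phi> x)" "cmod (\<phi> x)"] by (simp add: norm_mult)
  have "integrable \<mu> (\<lambda>x. ((cmod (?T \<phi> x))\<^sup>2 + (cmod (\<phi> x))\<^sup>2) / 2)" using iT i\<phi> by auto
  hence ip: "integrable \<mu> (\<lambda>x. ?T \<phi> x * cnj (\<phi> x))"
  proof (rule Bochner_Integration.integrable_bound)
    have "(\<lambda>x. cnj (\<phi> x)) \<in> borel_measurable \<mu>"
      by (rule measurable_compose[OF \<phi>_meas borel_measurable_continuous_onI]) (intro continuous_intros)
    thus "(\<lambda>x. ?T \<phi> x * cnj (\<phi> x)) \<in> borel_measurable \<mu>" by measurable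
    show "AE x in \<mu>. norm (?T \<phi> x * cnj (\<phi> x)) \<le> norm (((cmod (?T \<phi> x))\<^sup>2 + (cmod (\<phi> x))\<^sup>2) / 2)"
      by (intro AE_I2 order_trans[OF prod_le]) simp
  qed
  have "Re q = (\<integral>x. Re (?T \<phi> x * cnj (\<phi> x)) \<partial>\<mu>)"
    unfolding inner[symmetric] L2_inner_def by (rule integral_Re[OF ip, symmetric])
  also have "\<dots> \<le> (\<integral>x. ((cmod (?T \<phi> x))\<^sup>2 + (cmod (\<phi> x))\<^sup>2) / 2 \<partial>\<mu>)"
  proof (rule integral_mono)
    show "integrable \<mu> (\<lambda>x. Re (?T \<phi> x * cnj (\<phi> x)))" by (rule integrable_Re[OF ip])
    show "Re (?T \<phi> x * cnj (\<phi> x)) \<le> ((cmod (?T \<phi> x))\<^sup>2 + (cmod (\<phi> x))\<^sup>2) / 2" for x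
      by (rule order_trans[OF complex_Re_le_cmod prod_le])
  qed (use iT i\<phi> in auto)
  also have "\<dots> = ((\<integral>x. (cmod (?T \<phi> x))\<^sup>2 \<partial>\<mu>) + (\<integral>x. (cmod (\<phi> x))\<^sup>2 \<partial>\<mu>)) / 2"
    using iT i\<phi> by simp
  also have "\<dots> \<le> (\<integral>x. (cmod (\<phi> x))\<^sup>2 \<partial>\<mu>)" using norm_le by simp
  finally show "Re q \<le> (\<Sum>a<m. (cmod (u a))\<^sup>2 * measure \<nu> (C a))" unfolding norm_\<phi> .
qed

lemma bounded_kernel_\<nu>:
  assumes "\<kappa> \<in> measurable \<mu> (count_space UNIV)" "\<And>x. \<kappa> x < N"
  shows "bounded_kernel \<nu> K \<kappa> N R"
proof (intro bounded_kernel.intro bounded_kernel_axioms.intro)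
  show "finite_measure \<nu>" by (rule finite_\<nu>)
  show "\<And>x y. K y x = cnj (K x y)" by (rule K_herm)
  show "\<And>x. \<kappa> x < N" by (rule assms(2))
  show "0 \<le> R" by (rule R(1))
  show "AE x in \<nu>. 0 \<le> Re (K x x) \<and> Re (K x x) \<le> R" by (rule diag_\<nu>)
  show "(\<lambda>z. K (fst z) (snd z)) \<in> borel_measurable (\<nu> \<Otimes>\<^sub>M \<nu>)" by (rule K_meas')
  show "\<kappa> \<in> measurable \<nu> (count_space UNIV)" using assms(1) by simp
  show "AE z in \<nu> \<Otimes>\<^sub>M \<nu>. (cmod (K (fst z) (snd z)))\<^sup>2 \<le> Re (K (fst z) (fst z)) * Re (K (snd z) (snd z))"
    by (rule AE_pair_density[OF minor_nonneg])
  fix m :: nat and C u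
  assume "\<And>a. a < m \<Longrightarrow> C a \<in> sets \<nu>" "disjoint_family_on C {..<m}"
  from quad_form[OF this]
  show "0 \<le> Re (\<Sum>a<m. \<Sum>b<m. cnj (u a) * (\<integral>z. indicator (C a \<times> C b) z *\<^sub>R K (fst z) (snd z) \<partial>(\<nu> \<Otimes>\<^sub>M \<nu>)) * u b) \<and>
       Re (\<Sum>a<m. \<Sum>b<m. cnj (u a) * (\<integral>z. indicator (C a \<times> C b) z *\<^sub>R K (fst z) (snd z) \<partial>(\<nu> \<Otimes>\<^sub>M \<nu>)) * u b)
         \<le> (\<Sum>a<m. (cmod (u a))\<^sup>2 * measure \<nu> (C a))" by blast
qed

text \<open>On tuples from \<open>D\<close>, lying in the box of the sets
  \<open>A (\<gamma> j)\<close> is the colour condition alone, and the product of the indicators of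
  \<open>D\<close> is the density of the restricted product measure. The bound on determinants makes
  the integrand integrable.\<close>

lemma limit_moment_nn_integral:
  assumes \<kappa>: "\<kappa> \<in> measurable \<mu> (count_space UNIV)" "\<And>x. \<kappa> x < N"
    and A: "\<And>i. i < N \<Longrightarrow> A i \<in> sets \<mu>" "\<And>i x. i < N \<Longrightarrow> x \<in> A i \<longleftrightarrow> x \<in> D \<and> \<kappa> x = i"
    and \<gamma>: "\<gamma> \<in> {..<n} \<rightarrow>\<^sub>E {..<N}"
    and \<rho>: "\<rho> \<in> borel_measurable (\<Pi>\<^sub>M i\<in>{..<n}. \<mu>)" "\<And>x. x \<in> space (\<Pi>\<^sub>M i\<in>{..<n}. \<mu>) \<Longrightarrow> 0 \<le> \<rho> x"
      "AE x in (\<Pi>\<^sub>M i\<in>{..<n}. \<mu>). complex_of_real (\<rho> x) = pminor (\<lambda>i j. K (x i) (x j)) [0..<n]"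
  shows "(\<integral>\<^sup>+x\<in>(\<Pi>\<^sub>E j\<in>{..<n}. A (\<gamma> j)). ennreal (\<rho> x) \<partial>(\<Pi>\<^sub>M i\<in>{..<n}. \<mu>)) =
    ennreal (bounded_kernel.limit_moment \<nu> K \<kappa> n \<gamma>)"
proof -
  interpret bk: bounded_kernel \<nu> K \<kappa> N R by (rule bounded_kernel_\<nu>[OF \<kappa>])
  let ?P = "\<Pi>\<^sub>M i\<in>{..<n}. \<mu>" and ?Q = "\<Pi>\<^sub>M i\<in>{..<n}. \<nu>"
  let ?e = "\<lambda>x. of_bool (\<forall>j<n. \<kappa> (x j) = \<gamma> j) :: real"
  have Q: "?Q = density ?P (\<lambda>x. \<Prod>i<n. indicator D (x i))"
    by (rule PiM_density_indicator[OF sigma_finite_measure_axioms D]) simp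
  have setsQ: "sets ?Q = sets ?P" by (intro sets_PiM_cong) auto
  have dens: "(\<lambda>x. \<Prod>i<n. indicator D (x i) :: ennreal) \<in> borel_measurable ?P"
    by (rule indicator_prod_measurable[OF D(1)])
  have e_meas: "?e \<in> borel_measurable ?P"
  proof -
    have [measurable]: "(\<lambda>x. \<kappa> (x j)) \<in> measurable ?P (count_space UNIV)" if "j < n" for j
      using that by (intro measurable_compose[OF measurable_component_singleton[of j "{..<n}" "\<lambda>_. \<mu>"] \<kappa>(1)]) auto
    have "(\<lambda>x. \<Prod>j<n. of_bool (\<kappa> (x j) = \<gamma> j) :: real) \<in> borel_measurable ?P"
      by (intro borel_measurable_prod) (auto intro!: measurable_compose[OF _ measurable_count_space[of "\<lambda>a. of_bool (a = _)"]])
    moreover have "(\<Prod>j<n. of_bool (\<kappa> (x j) = \<gamma> j) :: real) = ?e x" for x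
      by (induction n) (auto simp: less_Suc_eq)
    ultimately show ?thesis by simp
  qed
  have "(\<integral>\<^sup>+x\<in>(\<Pi>\<^sub>E j\<in>{..<n}. A (\<gamma> j)). ennreal (\<rho> x) \<partial>?P)
    = (\<integral>\<^sup>+x. (\<Prod>i<n. indicator D (x i)) * ennreal (?e x * \<rho> x) \<partial>?P)"
  proof (rule nn_integral_cong)
    fix x assume x: "x \<in> space ?P"
    have "x \<in> (\<Pi>\<^sub>E j\<in>{..<n}. A (\<gamma> j)) \<longleftrightarrow> (\<forall>j<n. x j \<in> A (\<gamma> j))"
      using x by (auto simp: space_PiM PiE_def)
    also have "\<dots> \<longleftrightarrow> (\<forall>j<n. x j \<in> D) \<and> (\<forall>j<n. \<kappa> (x j) = \<gamma> j)"
      using A(2) \<gamma> by (auto simp: PiE_def Pi_def)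
    finally have "indicator (\<Pi>\<^sub>E j\<in>{..<n}. A (\<gamma> j)) x = (of_bool (\<forall>j<n. x j \<in> D) * of_bool (\<forall>j<n. \<kappa> (x j) = \<gamma> j) :: ennreal)"
      by (simp add: indicator_def)
    moreover have "(\<Prod>i<n. indicator D (x i)) = (of_bool (\<forall>j<n. x j \<in> D) :: ennreal)"
      by (induction n) (auto simp: less_Suc_eq indicator_def)
    ultimately show "ennreal (\<rho> x) * indicator (\<Pi>\<^sub>E j\<in>{..<n}. A (\<gamma> j)) x
       = (\<Prod>i<n. indicator D (x i)) * ennreal (?e x * \<rho> x)" by auto
  qed
  also have "\<dots> = (\<integral>\<^sup>+x. ennreal (?e x * \<rho> x) \<partial>?Q)"
    unfolding Q by (intro nn_integral_density[symmetric] dens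
      measurable_compose[OF borel_measurable_times[OF e_meas \<rho>(1)] measurable_ennreal])
  also have "\<dots> = (\<integral>\<^sup>+x. ennreal (?e x * Re (pminor (\<lambda>i j. K (x i) (x j)) [0..<n])) \<partial>?Q)"
  proof (rule nn_integral_cong_AE)
    show "AE x in ?Q. ennreal (?e x * \<rho> x) = ennreal (?e x * Re (pminor (\<lambda>i j. K (x i) (x j)) [0..<n]))"
    proof -
      have "AE x in ?Q. complex_of_real (\<rho> x) = pminor (\<lambda>i j. K (x i) (x j)) [0..<n]"
        by (rule AE_PiM_density_indicator[OF sigma_finite_measure_axioms D _ \<rho>(3)]) simp
      thus ?thesis by eventually_elim (metis Re_complex_of_real)
    qed
  qed
  also have "\<dots> = ennreal (bk.limit_moment n \<gamma>)"
    unfolding bk.limit_moment_def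
  proof (rule nn_integral_eq_integral)
    interpret Qf: finite_measure ?Q by (rule bk.finite_PiM)
    have "AE x in ?Q. 0 \<le> \<rho> x" using \<rho>(2) setsQ by (intro AE_I2) (auto dest: sets_eq_imp_space_eq)
    moreover have "AE x in ?Q. complex_of_real (\<rho> x) = pminor (\<lambda>i j. K (x i) (x j)) [0..<n]"
      by (rule AE_PiM_density_indicator[OF sigma_finite_measure_axioms D _ \<rho>(3)]) simp
    ultimately show "AE x in ?Q. 0 \<le> ?e x * Re (pminor (\<lambda>i j. K (x i) (x j)) [0..<n])"
    proof eventually_elim
      case (elim x)
      hence "0 \<le> Re (pminor (\<lambda>i j. K (x i) (x j)) [0..<n])" by (metis Re_complex_of_real)
      thus ?case by simp
    qed
    have entry: "(\<lambda>x. K (x i) (x j)) \<in> borel_measurable ?Q" if "i < n" "j < n" for i j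
    proof -
      have "(\<lambda>x. (x i, x j)) \<in> measurable ?Q (\<nu> \<Otimes>\<^sub>M \<nu>)"
        using that by (intro measurable_Pair measurable_component_singleton) auto
      from measurable_compose[OF this K_meas'] show ?thesis by simp
    qed
    have A1: "AE x in ?Q. \<forall>i<n. \<forall>j<n. i \<noteq> j \<longrightarrow> cmod (K (x i) (x j)) \<le> R"
      using bk.prod.AE_PiM_two_coordinates[OF _ _ _ _ K_bound_\<nu>] by (simp add: imp_conjL AE_all_countable)
    have A2: "AE x in ?Q. \<forall>i<n. cmod (K (x i) (x i)) \<le> R"
    proof -
      have "AE x in \<nu>. cmod (K x x) \<le> R"
        using diag_\<nu>
      proof eventually_elim
        case (elim x)
        have "K x x = complex_of_real (Re (K x x))" using K_herm[of x x] by (simp add: complex_eq_iff)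
        hence "cmod (K x x) = \<bar>Re (K x x)\<bar>" by (metis norm_of_real)
        thus ?case using elim by simp
      qed
      hence "AE x in ?Q. cmod (K (x i) (x i)) \<le> R" if "i < n" for i
        using bk.prod.AE_PiM_coordinate[of "{..<n}" i "\<lambda>x. cmod (K x x) \<le> R"] that by simp
      thus ?thesis by (simp add: AE_all_countable)
    qed
    show "integrable ?Q (\<lambda>x. ?e x * Re (pminor (\<lambda>i j. K (x i) (x j)) [0..<n]))"
    proof (rule Qf.integrable_const_bound)
      show "AE x in ?Q. norm (?e x * Re (pminor (\<lambda>i j. K (x i) (x j)) [0..<n])) \<le> fact n * R ^ n"
        using A1 A2
      proof eventually_elim
        case (elim x)
        have "\<bar>Re (pminor (\<lambda>i j. K (x i) (x j)) [0..<n])\<bar> \<le> cmod (pminor (\<lambda>i j. K (x i) (x j)) [0..<n])" by (rule abs_Re_le_cmod)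
        also have "\<dots> \<le> fact n * R ^ n" using elim by (intro pminor_upt_bound) metis
        finally show ?case using R(1) by auto
      qed
      have e_Q: "?e \<in> borel_measurable ?Q" unfolding measurable_cong_sets[OF setsQ refl] by (rule e_meas)
      show "(\<lambda>x. ?e x * Re (pminor (\<lambda>i j. K (x i) (x j)) [0..<n])) \<in> borel_measurable ?Q"
        by (intro borel_measurable_times e_Q measurable_compose[OF pminor_upt_measurable borel_measurable_Re] entry)
    qed
  qed
  finally show ?thesis .
qed

end

text \<open>Intensities are non-negative. For n = 1 the determinant is K(x,x), and for n = 2, by
  Hermitian symmetry, it is K(x,x) K(y,y) minus the squared modulus of K(x,y).\<close>

lemma determinantal_minors:
  fixes K :: "'a::topological_space \<Rightarrow> 'a \<Rightarrow> complex"
  assumes sf: "sigma_finite_measure M" and det: "determinantal P \<Xi> M K" and herm: "hermitian_kernel K"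
    and meas: "(\<lambda>z. K (fst z) (snd z)) \<in> borel_measurable (M \<Otimes>\<^sub>M M)"
  shows "AE x in M. 0 \<le> Re (K x x)"
    and "AE z in M \<Otimes>\<^sub>M M. (cmod (K (fst z) (snd z)))\<^sup>2 \<le> Re (K (fst z) (fst z)) * Re (K (snd z) (snd z))"
proof -
  interpret prod: product_sigma_finite "\<lambda>_. M" by (rule product_sigma_finite.intro) (rule sf)
  have hK: "K y x = cnj (K x y)" for x y using herm unfolding hermitian_kernel_def by blast
  have diag_real: "K x x = complex_of_real (Re (K x x))" for x using hK[of x x] by (simp add: complex_eq_iff)
  have [measurable]: "(\<lambda>x. K x x) \<in> borel_measurable M"
  proof -
    have "(\<lambda>x. (x, x)) \<in> measurable M (M \<Otimes>\<^sub>M M)" by measurable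
    from measurable_compose[OF this meas] show ?thesis by simp
  qed
  have rho: "AE x in PiM {..<n} (\<lambda>_. M). 0 \<le> Re (pminor (\<lambda>i j. K (x i) (x j)) [0..<n])" if "1 \<le> n" for n
  proof -
    obtain \<rho> where \<rho>: "is_intensity P \<Xi> M n \<rho>"
      "AE x in PiM {..<n} (\<lambda>_. M). complex_of_real (\<rho> x) = Determinant.det (Matrix.mat n n (\<lambda>(i, j). K (x i) (x j)))"
      using det \<open>1 \<le> n\<close> unfolding determinantal_def by blast
    have "pminor (\<lambda>i j. K (x i) (x j)) [0..<n] = Determinant.det (Matrix.mat n n (\<lambda>(i, j). K (x i) (x j)))" for x
      unfolding pminor_def by (intro arg_cong[of _ _ Determinant.det] eq_matI) auto
    hence "AE x in PiM {..<n} (\<lambda>_. M). complex_of_real (\<rho> x) = pminor (\<lambda>i j. K (x i) (x j)) [0..<n]" using \<rho>(2) by simp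
    moreover have "AE x in PiM {..<n} (\<lambda>_. M). 0 \<le> \<rho> x" using \<rho>(1) unfolding is_intensity_def by (intro AE_I2) auto
    ultimately show ?thesis by eventually_elim (metis Re_complex_of_real)
  qed
  have s1: "{..<1} = {0 :: nat}" and s2: "{..<2} = {0, 1 :: nat}" by auto
  have "AE x in PiM {0 :: nat} (\<lambda>_. M). 0 \<le> Re (K (x 0) (x 0))"
    using rho[of 1] unfolding s1 by (simp add: pminor_one)
  thus "AE x in M. 0 \<le> Re (K x x)" by (rule prod.AE_PiM_singletonD) measurable
  have u2: "[0..<2] = [0, 1 :: nat]" by (simp add: upt_rec)
  have "AE x in PiM {0, 1 :: nat} (\<lambda>_. M). 0 \<le> Re (K (x 0) (x 0) * K (x 1) (x 1) - K (x 0) (x 1) * K (x 1) (x 0))"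
    using rho[of 2] unfolding s2 u2 pminor_two by simp
  hence "AE x in PiM {0, 1 :: nat} (\<lambda>_. M). (cmod (K (fst (x 0, x 1)) (snd (x 0, x 1))))\<^sup>2
     \<le> Re (K (fst (x 0, x 1)) (fst (x 0, x 1))) * Re (K (snd (x 0, x 1)) (snd (x 0, x 1)))"
  proof eventually_elim
    case (elim x)
    have "K (x 0) (x 1) * K (x 1) (x 0) = complex_of_real ((cmod (K (x 0) (x 1)))\<^sup>2)"
      unfolding hK[of "x 1" "x 0"] by (rule complex_norm_square[symmetric])
    moreover have "K (x 0) (x 0) * K (x 1) (x 1) = complex_of_real (Re (K (x 0) (x 0)) * Re (K (x 1) (x 1)))"
      using diag_real[of "x 0"] diag_real[of "x 1"] by (metis of_real_mult)
    ultimately show ?case using elim by simp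
  qed
  thus "AE z in M \<Otimes>\<^sub>M M. (cmod (K (fst z) (snd z)))\<^sup>2 \<le> Re (K (fst z) (fst z)) * Re (K (snd z) (snd z))"
  proof (rule prod.AE_PiM_pairD)
    show "{z \<in> space (M \<Otimes>\<^sub>M M). \<not> (cmod (K (fst z) (snd z)))\<^sup>2 \<le> Re (K (fst z) (fst z)) * Re (K (snd z) (snd z))}
       \<in> sets (M \<Otimes>\<^sub>M M)"
    proof -
      have [measurable]: "(\<lambda>z. K (fst z) (fst z)) \<in> borel_measurable (M \<Otimes>\<^sub>M M)"
        "(\<lambda>z. K (snd z) (snd z)) \<in> borel_measurable (M \<Otimes>\<^sub>M M)" by measurable
      have m1: "(\<lambda>z. (cmod (K (fst z) (snd z)))\<^sup>2) \<in> borel_measurable (M \<Otimes>\<^sub>M M)"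
        by (rule measurable_compose[OF meas borel_measurable_continuous_onI]) (intro continuous_intros)
      have m2: "(\<lambda>z. Re (K (fst z) (fst z)) * Re (K (snd z) (snd z))) \<in> borel_measurable (M \<Otimes>\<^sub>M M)"
        by measurable
      show ?thesis unfolding not_le by (rule borel_measurable_less[OF m2 m1])
    qed
  qed simp
qed

subsection \<open>Determinantal point processes\<close>

text \<open>Positions are filled from left to right: the earlier positions of the same colour have
  used up that many of its points. The formula makes tuple counts measurable, as functions of the
  colour counts.\<close>

lemma card_tuples:
  assumes "finite X"
  shows "card (tuples n X c \<gamma>) = (\<Prod>j<n. colour_count X c (\<gamma> j) - card {i. i < j \<and> \<gamma> i = \<gamma> j})"
proof (induction n)
  case 0
  have "tuples 0 X c \<gamma> = {\<lambda>_. undefined}" by (auto simp: tuples_def)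
  thus ?case by simp
next
  case (Suc n)
  define Y where "Y s = {x \<in> X. c x = \<gamma> n} - s ` {..<n}" for s :: "nat \<Rightarrow> 'a"
  have bij: "bij_betw (\<lambda>(s, x). s(n := x)) (SIGMA s:tuples n X c \<gamma>. Y s) (tuples (Suc n) X c \<gamma>)"
  proof (rule bij_betwI[where g = "\<lambda>t. (restrict t {..<n}, t n)"])
    show "(\<lambda>(s, x). s(n := x)) \<in> (SIGMA s:tuples n X c \<gamma>. Y s) \<rightarrow> tuples (Suc n) X c \<gamma>"
    proof (rule funcsetI, clarify)
      fix s x assume s: "s \<in> tuples n X c \<gamma>" and x: "x \<in> Y s"
      have "s(n := x) \<in> {..<Suc n} \<rightarrow>\<^sub>E X"
        using s x by (auto simp: tuples_def Y_def PiE_def Pi_def extensional_def)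
      moreover have "inj_on (s(n := x)) {..<Suc n}"
        using s x by (auto simp: tuples_def Y_def inj_on_def lessThan_Suc)
      moreover have "\<forall>j<Suc n. c ((s(n := x)) j) = \<gamma> j" using s x by (auto simp: tuples_def Y_def)
      ultimately show "s(n := x) \<in> tuples (Suc n) X c \<gamma>" by (simp add: tuples_def)
    qed
    show "(\<lambda>t. (restrict t {..<n}, t n)) \<in> tuples (Suc n) X c \<gamma> \<rightarrow> (SIGMA s:tuples n X c \<gamma>. Y s)"
    proof (rule funcsetI)
      fix t assume t: "t \<in> tuples (Suc n) X c \<gamma>"
      hence tX: "t j \<in> X" if "j < Suc n" for j using that by (auto simp: tuples_def PiE_def Pi_def)
      have inj: "inj_on t {..<Suc n}" and col: "\<forall>j<Suc n. c (t j) = \<gamma> j" using t by (auto simp: tuples_def)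
      have "inj_on (restrict t {..<n}) {..<n}" using inj by (auto simp: inj_on_def)
      hence "restrict t {..<n} \<in> tuples n X c \<gamma>" using tX col by (auto simp: tuples_def)
      moreover have "t n \<noteq> t j" if "j < n" for j
        using inj_onD[OF inj, of n j] that by auto
      hence "t n \<in> Y (restrict t {..<n})" using tX[of n] col by (auto simp: Y_def)
      ultimately show "(restrict t {..<n}, t n) \<in> (SIGMA s:tuples n X c \<gamma>. Y s)" by simp
    qed
    show "(\<lambda>t. (restrict t {..<n}, t n)) ((\<lambda>(s, x). s(n := x)) p) = p"
      if p: "p \<in> (SIGMA s:tuples n X c \<gamma>. Y s)" for p
    proof -
      obtain s x where sx: "p = (s, x)" "s \<in> tuples n X c \<gamma>" using p by auto
      have "restrict (s(n := x)) {..<n} = s"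
        using sx(2) by (auto simp: tuples_def fun_eq_iff PiE_def extensional_def)
      thus ?thesis using sx(1) by simp
    qed
    show "(\<lambda>(s, x). s(n := x)) (restrict t {..<n}, t n) = t" if "t \<in> tuples (Suc n) X c \<gamma>" for t
      using that by (auto simp: tuples_def fun_eq_iff PiE_def extensional_def less_Suc_eq)
  qed
  have "card (Y s) = colour_count X c (\<gamma> n) - card {i. i < n \<and> \<gamma> i = \<gamma> n}" if s: "s \<in> tuples n X c \<gamma>" for s
  proof -
    have inj: "inj_on s {i. i < n \<and> \<gamma> i = \<gamma> n}" using s by (auto simp: tuples_def inj_on_def)
    have "Y s = {x \<in> X. c x = \<gamma> n} - s ` {i. i < n \<and> \<gamma> i = \<gamma> n}"
      using s by (auto simp: Y_def tuples_def)
    moreover have "s ` {i. i < n \<and> \<gamma> i = \<gamma> n} \<subseteq> {x \<in> X. c x = \<gamma> n}"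
      using s by (auto simp: tuples_def PiE_def Pi_def)
    ultimately show ?thesis
      using card_image[OF inj] by (simp add: card_Diff_subset colour_count_def)
  qed
  moreover have "card (tuples (Suc n) X c \<gamma>) = (\<Sum>s\<in>tuples n X c \<gamma>. card (Y s))"
    using bij_betw_same_card[OF bij] finite_tuples[OF assms] assms by (simp add: Y_def)
  ultimately show ?case using Suc by simp
qed

text \<open>At each configuration the series is finite, but its length is not bounded. Expectation
  and series may be exchanged because the expected absolute terms are at most
  \<open>(2 * C) ^ n / fact n\<close>.\<close>

lemma expectation_newton:
  assumes "prob_space P"
    and fin: "\<And>\<omega>. \<omega> \<in> space P \<Longrightarrow> finite (X \<omega>)"
    and col: "\<And>p. c p < N"
    and meas: "\<And>i. i < N \<Longrightarrow> (\<lambda>\<omega>. real (colour_count (X \<omega>) c i)) \<in> borel_measurable P"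
    and mb: "moment_bounded N C m"
    and mom: "\<And>n \<gamma>. \<gamma> \<in> {..<n} \<rightarrow>\<^sub>E {..<N} \<Longrightarrow> (\<integral>\<^sup>+\<omega>. ennreal (real (card (tuples n (X \<omega>) c \<gamma>))) \<partial>P) = ennreal (m n \<gamma>)"
    and F: "\<And>u. \<bar>F u\<bar> \<le> 1"
  shows "(\<integral>\<omega>. F (colour_count (X \<omega>) c) \<partial>P) = newton N F m"
proof -
  interpret prob_space P by fact
  have m0: "0 \<le> m n \<gamma>" if "\<gamma> \<in> {..<n} \<rightarrow>\<^sub>E {..<N}" for n \<gamma> using mb that unfolding moment_bounded_def by blast
  have t_meas: "(\<lambda>\<omega>. real (card (tuples n (X \<omega>) c \<gamma>))) \<in> borel_measurable P" if \<gamma>: "\<gamma> \<in> {..<n} \<rightarrow>\<^sub>E {..<N}" for n \<gamma>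
  proof -
    have "(\<lambda>\<omega>. \<Prod>j<n. max 0 (real (colour_count (X \<omega>) c (\<gamma> j)) - real (card {i. i < j \<and> \<gamma> i = \<gamma> j}))) \<in> borel_measurable P"
      using \<gamma> by (intro borel_measurable_prod borel_measurable_max borel_measurable_diff borel_measurable_const meas)
        (auto simp: PiE_def Pi_def)
    moreover have "real (card (tuples n (X \<omega>) c \<gamma>)) = (\<Prod>j<n. max 0 (real (colour_count (X \<omega>) c (\<gamma> j)) - real (card {i. i < j \<and> \<gamma> i = \<gamma> j})))"
      if "\<omega> \<in> space P" for \<omega>
      unfolding card_tuples[OF fin[OF that]] of_nat_prod by (intro prod.cong refl) (simp add: of_nat_diff_real max_def of_nat_diff)
    ultimately show ?thesis by (simp cong: measurable_cong)
  qed
  have t_int: "integrable P (\<lambda>\<omega>. real (card (tuples n (X \<omega>) c \<gamma>)))"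
    and t_eq: "(\<integral>\<omega>. real (card (tuples n (X \<omega>) c \<gamma>)) \<partial>P) = m n \<gamma>" if \<gamma>: "\<gamma> \<in> {..<n} \<rightarrow>\<^sub>E {..<N}" for n \<gamma>
  proof -
    show "integrable P (\<lambda>\<omega>. real (card (tuples n (X \<omega>) c \<gamma>)))"
      by (rule integrableI_nonneg[OF t_meas[OF \<gamma>]]) (use mom[OF \<gamma>] in auto)
    show "(\<integral>\<omega>. real (card (tuples n (X \<omega>) c \<gamma>)) \<partial>P) = m n \<gamma>"
      by (rule integral_eq_nn_integral[THEN trans, OF t_meas[OF \<gamma>]]) (use mom[OF \<gamma>] m0[OF \<gamma>] in auto)
  qed
  define h where "h \<omega> = newton_term N F (\<lambda>n \<gamma>. real (card (tuples n (X \<omega>) c \<gamma>)))" for \<omega>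
  have h_int: "integrable P (\<lambda>\<omega>. h \<omega> n)" for n
    unfolding h_def newton_term_def using t_int by auto
  have h_eq: "(\<integral>\<omega>. h \<omega> n \<partial>P) = newton_term N F m n" for n
    unfolding h_def newton_term_def using t_int t_eq by (simp add: Bochner_Integration.integral_sum cong: sum.cong)
  have h_sums: "h \<omega> sums F (colour_count (X \<omega>) c)" if "\<omega> \<in> space P" for \<omega>
    unfolding h_def using col by (intro newton_tuples_sums fin that) auto
  have norm_bound: "(\<integral>\<omega>. norm (h \<omega> n) \<partial>P) \<le> (2 * C) ^ n / fact n" for n
  proof -
    let ?Q = "{..<n} \<rightarrow>\<^sub>E {..<N}"
    have "(\<integral>\<omega>. norm (h \<omega> n) \<partial>P) \<le> (\<integral>\<omega>. (\<Sum>\<gamma>\<in>?Q. 2 ^ n * real (card (tuples n (X \<omega>) c \<gamma>))) / fact n \<partial>P)"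
    proof (rule integral_mono)
      show "integrable P (\<lambda>\<omega>. norm (h \<omega> n))" using h_int by auto
      show "integrable P (\<lambda>\<omega>. (\<Sum>\<gamma>\<in>?Q. 2 ^ n * real (card (tuples n (X \<omega>) c \<gamma>))) / fact n)" using t_int by auto
      fix \<omega>
      have "\<bar>\<Sum>\<gamma>\<in>?Q. moebius_sum F {..<n} \<gamma> * real (card (tuples n (X \<omega>) c \<gamma>))\<bar>
        \<le> (\<Sum>\<gamma>\<in>?Q. \<bar>moebius_sum F {..<n} \<gamma> * real (card (tuples n (X \<omega>) c \<gamma>))\<bar>)" by (rule sum_abs)
      also have "\<dots> \<le> (\<Sum>\<gamma>\<in>?Q. 2 ^ n * real (card (tuples n (X \<omega>) c \<gamma>)))"
        using moebius_sum_bound[of F "{..<n}", OF F] by (intro sum_mono) (auto simp: abs_mult intro!: mult_right_mono)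
      finally show "norm (h \<omega> n) \<le> (\<Sum>\<gamma>\<in>?Q. 2 ^ n * real (card (tuples n (X \<omega>) c \<gamma>))) / fact n"
        unfolding h_def newton_term_def by (simp add: divide_right_mono)
    qed
    also have "\<dots> = 2 ^ n * (\<Sum>\<gamma>\<in>?Q. m n \<gamma>) / fact n"
      using t_int t_eq by (simp add: Bochner_Integration.integral_sum sum_distrib_left cong: sum.cong)
    also have "\<dots> \<le> 2 ^ n * C ^ n / fact n"
      using mb unfolding moment_bounded_def by (intro divide_right_mono mult_left_mono) auto
    finally show ?thesis by (simp add: power_mult_distrib)
  qed
  have "(\<integral>\<omega>. F (colour_count (X \<omega>) c) \<partial>P) = (\<integral>\<omega>. (\<Sum>n. h \<omega> n) \<partial>P)"
    using h_sums by (intro Bochner_Integration.integral_cong refl) (auto simp: sums_iff)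
  also have "\<dots> = (\<Sum>n. \<integral>\<omega>. h \<omega> n \<partial>P)"
  proof (rule integral_suminf[OF h_int])
    show "AE \<omega> in P. summable (\<lambda>n. norm (h \<omega> n))"
    proof (rule AE_I2)
      fix \<omega> assume \<omega>: "\<omega> \<in> space P"
      have "h \<omega> n = 0" if "n \<notin> {..card (X \<omega>)}" for n
        using that by (simp add: h_def newton_term_def tuples_empty[OF fin[OF \<omega>]])
      thus "summable (\<lambda>n. norm (h \<omega> n))" by (intro summable_finite[of "{..card (X \<omega>)}"]) auto
    qed
    show "summable (\<lambda>n. \<integral>\<omega>. norm (h \<omega> n) \<partial>P)"
      by (rule summable_comparison_test'[OF summable_power_fact[of C], of 0])
         (use norm_bound in \<open>auto simp: abs_of_nonneg Bochner_Integration.integral_nonneg\<close>)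
  qed
  also have "\<dots> = newton N F m" unfolding newton_def by (simp add: h_eq)
  finally show ?thesis .
qed

lemma num_points_finite:
  assumes "finite {p \<in> points c. fst p \<in> A}"
  shows "num_points c A = ennreal (real (card {p \<in> points c. fst p \<in> A}))"
  unfolding num_points_def using assms by (simp add: emeasure_count_space_finite ennreal_of_nat_eq_real_of_nat)

lemma num_points_le_iff:
  assumes "finite {p \<in> points c. fst p \<in> A}" "0 \<le> m"
  shows "enn2ereal (num_points c A) \<le> ereal (of_int m) \<longleftrightarrow> card {p \<in> points c. fst p \<in> A} \<le> nat m"
  unfolding num_points_finite[OF assms(1)] using assms(2) by (simp add: enn2ereal_ennreal) linarith

lemma num_points_mono: "A \<subseteq> B \<Longrightarrow> num_points c A \<le> num_points c B"
  unfolding num_points_def by (intro emeasure_mono) auto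

lemma num_points_SUP:
  assumes "incseq D" "(\<Union>k. D k) = UNIV"
  shows "num_points c A = (SUP k. num_points c (A \<inter> D k))"
proof -
  have "(\<Union>k. {p \<in> points c. fst p \<in> A \<inter> D k}) = {p \<in> points c. fst p \<in> A}"
    using assms(2) by auto
  moreover have "incseq (\<lambda>k. {p \<in> points c. fst p \<in> A \<inter> D k})"
    using assms(1) by (auto simp: incseq_def)
  ultimately show ?thesis
    unfolding num_points_def by (subst SUP_emeasure_incseq) auto
qed

text \<open>Finite measure and a bounded diagonal provide a \<open>bounded_kernel\<close>, and
  compactness of \<open>C\<close> provides finite configurations. The probabilities on both sides
  are then Newton series in the same moments, which \<open>limit_moment_inequality\<close>
  compares.\<close>

lemma bounded_set_inequality:
  fixes \<mu> :: "'a::t2_space measure" and A :: "nat \<Rightarrow> 'a set"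
  assumes sf: "sigma_finite_measure \<mu>" and sets: "sets \<mu> = sets borel"
    and hK: "hermitian_kernel K" and iK: "induces_operator \<mu> K"
    and nonneg: "nonneg_operator \<mu> (integral_operator \<mu> K)"
    and contr: "contraction \<mu> (integral_operator \<mu> K)"
    and det: "determinantal P \<Xi> \<mu> K"
    and A: "\<And>i. i < N \<Longrightarrow> A i \<in> sets borel" "disjoint_family_on A {..<N}"
    and D: "\<And>i. i < N \<Longrightarrow> A i \<subseteq> D" "D \<in> sets borel" "emeasure \<mu> D < \<infinity>" "D \<subseteq> C" "compact C"
    and R: "0 \<le> R" "\<And>x. x \<in> D \<Longrightarrow> Re (K x x) \<le> R"
    and N: "0 < N"
    and m: "\<And>i. i < N \<Longrightarrow> 0 \<le> m i"
  shows "measure P {\<omega> \<in> space P. \<forall>i<N. enn2ereal (num_points (\<Xi> \<omega>) (A i)) \<le> ereal (of_int (m i))}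
     \<le> (\<Prod>i<N. measure P {\<omega> \<in> space P. enn2ereal (num_points (\<Xi> \<omega>) (A i)) \<le> ereal (of_int (m i))})"
proof -
  have pp: "point_process P \<Xi>" using det unfolding determinantal_def by blast
  interpret prob_space P using pp unfolding point_process_def by blast
  \<comment> \<open>The union of the sets replaces \<open>D\<close>, so that each of its points has
    a genuine colour and \<open>A i\<close> is its part of colour i.\<close>
  define D' where "D' = (\<Union>i<N. A i)"
  have D': "D' \<in> sets \<mu>" "D' \<subseteq> D" using A D(1) by (auto simp: D'_def sets)
  have D'fin: "emeasure \<mu> D' < \<infinity>" using emeasure_mono[OF D'(2), of \<mu>] D(2,3) sets by (auto intro: le_less_trans)
  have K_meas: "(\<lambda>z. K (fst z) (snd z)) \<in> borel_measurable (\<mu> \<Otimes>\<^sub>M \<mu>)"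
    using iK unfolding induces_operator_def by (simp add: split_beta')
  interpret ds: dpp_on_set \<mu> K D' R
    using determinantal_minors[OF sf det hK K_meas] D' D'fin R
    by (intro dpp_on_set.intro dpp_on_set_axioms.intro sf sets hK iK nonneg contr) auto
  \<comment> \<open>Outside the union the value is 0; only points of \<open>D'\<close> are ever
    counted.\<close>
  define \<kappa> where "\<kappa> x = (\<Sum>i<N. if x \<in> A i then i else 0)" for x
  have \<kappa>A: "\<kappa> x = i" if "i < N" "x \<in> A i" for i x
  proof -
    have "(\<Sum>j<N. if x \<in> A j then j else 0) = (\<Sum>j<N. if j = i then i else 0)"
      using that A(2) by (intro sum.cong refl) (auto simp: disjoint_family_on_def)
    thus ?thesis using that by (simp add: \<kappa>_def)
  qed
  have \<kappa>_less: "\<kappa> x < N" for x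
  proof (cases "\<exists>i<N. x \<in> A i")
    case True
    thus ?thesis using \<kappa>A by auto
  next
    case False
    hence "\<kappa> x = 0" by (simp add: \<kappa>_def)
    thus ?thesis using N by simp
  qed
  have \<kappa>_meas: "\<kappa> \<in> measurable \<mu> (count_space UNIV)"
  proof -
    have "(\<lambda>x. \<Sum>i<n. if x \<in> A i then i else 0) \<in> measurable \<mu> (count_space UNIV)" if "n \<le> N" for n
      using that
    proof (induction n)
      case (Suc n)
      have An: "A n \<in> sets \<mu>" using A(1)[of n] Suc.prems by (simp add: sets)
      have add: "(\<lambda>x. f x + (if x \<in> A n then n else 0)) \<in> measurable \<mu> (count_space UNIV)"
        if [measurable]: "f \<in> measurable \<mu> (count_space UNIV)" for f :: "'a \<Rightarrow> nat"
        using An by measurable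
      show ?case unfolding sum.lessThan_Suc using Suc by (intro add) simp
    qed simp
    thus ?thesis unfolding \<kappa>_def[abs_def] by blast
  qed
  have A_iff: "x \<in> A i \<longleftrightarrow> x \<in> D' \<and> \<kappa> x = i" if "i < N" for i x
    using \<kappa>A that by (auto simp: D'_def)
  interpret bk: bounded_kernel "density \<mu> (indicator D')" K \<kappa> N R
    by (rule ds.bounded_kernel_\<nu>[OF \<kappa>_meas \<kappa>_less])
  define X where "X \<omega> = {p \<in> points (\<Xi> \<omega>). fst p \<in> D'}" for \<omega>
  define c where "c p = \<kappa> (fst p)" for p :: "'a \<times> nat"
  have fin: "finite (X \<omega>)" if "\<omega> \<in> space P" for \<omega>
  proof -
    have "num_points (\<Xi> \<omega>) C < \<infinity>"
      using pp that D(5) unfolding point_process_def locally_finite_config_def by blast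
    hence "num_points (\<Xi> \<omega>) D' < \<infinity>" using num_points_mono[of D' C] D'(2) D(4) by (meson le_less_trans order_trans)
    thus ?thesis unfolding num_points_def X_def by (auto simp: emeasure_count_space split: if_splits)
  qed
  have XA: "{p \<in> X \<omega>. c p = i} = {p \<in> points (\<Xi> \<omega>). fst p \<in> A i}" if "i < N" for i \<omega>
    using A_iff[OF that] by (auto simp: X_def c_def)
  have finA: "finite {p \<in> points (\<Xi> \<omega>). fst p \<in> A i}" if "\<omega> \<in> space P" "i < N" for \<omega> i
    using finite_subset[OF _ fin[OF that(1)]] XA[OF that(2), of \<omega>] by (metis (no_types, lifting) mem_Collect_eq subsetI)
  have colour_count_meas: "(\<lambda>\<omega>. real (colour_count (X \<omega>) c i)) \<in> borel_measurable P" if i: "i < N" for i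
  proof -
    have [measurable]: "(\<lambda>\<omega>. num_points (\<Xi> \<omega>) (A i)) \<in> borel_measurable P"
      using pp A(1)[OF i] unfolding point_process_def by blast
    have "(\<lambda>\<omega>. enn2real (num_points (\<Xi> \<omega>) (A i))) \<in> borel_measurable P" by measurable
    moreover have "enn2real (num_points (\<Xi> \<omega>) (A i)) = real (colour_count (X \<omega>) c i)" if "\<omega> \<in> space P" for \<omega>
      unfolding num_points_finite[OF finA[OF that i]] colour_count_def XA[OF i] by simp
    ultimately show ?thesis by (simp cong: measurable_cong)
  qed
  have mom: "(\<integral>\<^sup>+\<omega>. ennreal (real (card (tuples n (X \<omega>) c \<gamma>))) \<partial>P) = ennreal (bk.limit_moment n \<gamma>)"
    if \<gamma>: "\<gamma> \<in> {..<n} \<rightarrow>\<^sub>E {..<N}" for n \<gamma>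
  proof (cases "n = 0")
    \<comment> \<open>\<open>determinantal\<close> speaks of n at least 1 only; for n = 0 both sides
      are 1, the number of empty tuples.\<close>
    case True
    have "tuples 0 (X \<omega>) c \<gamma> = {\<lambda>_. undefined}" for \<omega> by (auto simp: tuples_def)
    hence "(\<integral>\<^sup>+\<omega>. ennreal (real (card (tuples n (X \<omega>) c \<gamma>))) \<partial>P) = 1"
      using True by (simp add: emeasure_space_1)
    moreover have "bk.limit_moment n \<gamma> = 1"
      unfolding bk.limit_moment_def using True
      by (simp add: PiM_empty measure_def emeasure_count_space_finite)
    ultimately show ?thesis by simp
  next
    case False
    hence n1: "1 \<le> n" by simp
    obtain \<rho> where \<rho>: "is_intensity P \<Xi> \<mu> n \<rho>"
      "AE x in PiM {..<n} (\<lambda>_. \<mu>). complex_of_real (\<rho> x) = Determinant.det (Matrix.mat n n (\<lambda>(i, j). K (x i) (x j)))"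
      using det n1 unfolding determinantal_def by blast
    have minor_eq: "pminor (\<lambda>i j. K (x i) (x j)) [0..<n] = Determinant.det (Matrix.mat n n (\<lambda>(i, j). K (x i) (x j)))" for x
      unfolding pminor_def by (intro arg_cong[of _ _ Determinant.det] eq_matI) auto
    let ?B = "\<Pi>\<^sub>E j\<in>{..<n}. A (\<gamma> j)"
    have B: "?B \<in> sets (PiM {..<n} (\<lambda>_. \<mu>))"
      using \<gamma> A(1) sets by (intro sets_PiM_I_finite) (auto simp: PiE_def Pi_def)
    have "(\<integral>\<^sup>+\<omega>. ennreal (real (card (tuples n (X \<omega>) c \<gamma>))) \<partial>P) = (\<integral>\<^sup>+\<omega>. num_tuples n (\<Xi> \<omega>) ?B \<partial>P)"
    proof (rule nn_integral_cong)
      fix \<omega> assume \<omega>: "\<omega> \<in> space P"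
      have "{t \<in> {..<n} \<rightarrow>\<^sub>E points (\<Xi> \<omega>). inj_on t {..<n} \<and> (\<lambda>i\<in>{..<n}. fst (t i)) \<in> ?B} = tuples n (X \<omega>) c \<gamma>"
      proof (rule Set.set_eqI, rule iffI)
        fix t assume t: "t \<in> {t \<in> {..<n} \<rightarrow>\<^sub>E points (\<Xi> \<omega>). inj_on t {..<n} \<and> (\<lambda>i\<in>{..<n}. fst (t i)) \<in> ?B}"
        hence fA: "fst (t j) \<in> A (\<gamma> j)" if "j < n" for j using that by (auto simp: PiE_def Pi_def)
        have gN: "\<gamma> j < N" if "j < n" for j using \<gamma> that by (auto simp: PiE_def Pi_def)
        have "fst (t j) \<in> D' \<and> \<kappa> (fst (t j)) = \<gamma> j" if "j < n" for j
          using fA[OF that] A_iff[OF gN[OF that]] by blast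
        thus "t \<in> tuples n (X \<omega>) c \<gamma>" using t by (auto simp: tuples_def X_def c_def PiE_def Pi_def)
      next
        fix t assume t: "t \<in> tuples n (X \<omega>) c \<gamma>"
        have gN: "\<gamma> j < N" if "j < n" for j using \<gamma> that by (auto simp: PiE_def Pi_def)
        have "fst (t j) \<in> D' \<and> \<kappa> (fst (t j)) = \<gamma> j" if "j < n" for j
          using t that by (auto simp: tuples_def X_def c_def PiE_def Pi_def)
        hence "fst (t j) \<in> A (\<gamma> j)" if "j < n" for j
          using that A_iff[OF gN[OF that]] by blast
        thus "t \<in> {t \<in> {..<n} \<rightarrow>\<^sub>E points (\<Xi> \<omega>). inj_on t {..<n} \<and> (\<lambda>i\<in>{..<n}. fst (t i)) \<in> ?B}"
          using t by (auto simp: tuples_def X_def PiE_def Pi_def)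
      qed
      thus "ennreal (real (card (tuples n (X \<omega>) c \<gamma>))) = num_tuples n (\<Xi> \<omega>) ?B"
        unfolding num_tuples_def using finite_tuples[OF fin[OF \<omega>], of n c \<gamma>]
        by (simp add: emeasure_count_space_finite ennreal_of_nat_eq_real_of_nat)
    qed
    also have "\<dots> = (\<integral>\<^sup>+x\<in>?B. ennreal (\<rho> x) \<partial>(\<Pi>\<^sub>M i\<in>{..<n}. \<mu>))"
      using \<rho>(1) B unfolding is_intensity_def by blast
    also have "\<dots> = ennreal (bk.limit_moment n \<gamma>)"
    proof (rule ds.limit_moment_nn_integral[OF \<kappa>_meas \<kappa>_less _ A_iff \<gamma>])
      show "A i \<in> sets \<mu>" if "i < N" for i using A(1)[OF that] by (simp add: sets)
      show "AE x in PiM {..<n} (\<lambda>_. \<mu>). complex_of_real (\<rho> x) = pminor (\<lambda>i j. K (x i) (x j)) [0..<n]"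
        using \<rho>(2) by (simp add: minor_eq)
    qed (use \<rho>(1) in \<open>auto simp: is_intensity_def\<close>)
    finally show ?thesis .
  qed
  have E: "(\<integral>\<omega>. F (colour_count (X \<omega>) c) \<partial>P) = newton N F bk.limit_moment" if "\<And>u. \<bar>F u\<bar> \<le> 1" for F
    by (rule expectation_newton[OF prob_space_axioms fin _ colour_count_meas bk.limit_moment_inequality(1) mom that])
       (auto simp: c_def \<kappa>_less)
  have le_iff: "enn2ereal (num_points (\<Xi> \<omega>) (A i)) \<le> ereal (of_int (m i)) \<longleftrightarrow> colour_count (X \<omega>) c i \<le> nat (m i)"
    if "\<omega> \<in> space P" "i < N" for \<omega> i
    unfolding num_points_le_iff[OF finA[OF that] m[OF that(2)]] colour_count_def XA[OF that(2)] ..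
  have prob_eq: "measure P {\<omega> \<in> space P. Q \<omega>} = (\<integral>\<omega>. of_bool (Q \<omega>) \<partial>P)" for Q
  proof -
    have "(\<integral>\<omega>. of_bool (Q \<omega>) \<partial>P) = (\<integral>\<omega>. indicator {\<omega> \<in> space P. Q \<omega>} \<omega> \<partial>P)"
      by (intro Bochner_Integration.integral_cong refl) (auto simp: indicator_def)
    also have "\<dots> = measure P {\<omega> \<in> space P. Q \<omega>}"
      using Bochner_Integration.integral_indicator[of P "{\<omega> \<in> space P. Q \<omega>}"]
      by (simp add: Int_absorb2 Collect_subset)
    finally show ?thesis by simp
  qed
  have "measure P {\<omega> \<in> space P. \<forall>i<N. enn2ereal (num_points (\<Xi> \<omega>) (A i)) \<le> ereal (of_int (m i))}
     = measure P {\<omega> \<in> space P. \<forall>i<N. colour_count (X \<omega>) c i \<le> nat (m i)}"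
    using le_iff by (intro arg_cong[of _ _ "measure P"]) auto
  also have "\<dots> = newton N (lower_orthant N (\<lambda>i. nat (m i))) bk.limit_moment"
    unfolding prob_eq lower_orthant_def[symmetric] by (rule E) (simp add: lower_orthant_def)
  also have "\<dots> \<le> (\<Prod>i<N. newton N (\<lambda>u. of_bool (u i \<le> nat (m i))) bk.limit_moment)"
    using bk.limit_moment_inequality(2) unfolding orthant_dependent_def by blast
  also have "\<dots> = (\<Prod>i<N. measure P {\<omega> \<in> space P. enn2ereal (num_points (\<Xi> \<omega>) (A i)) \<le> ereal (of_int (m i))})"
  proof (intro prod.cong refl)
    fix i assume "i \<in> {..<N}"
    hence i: "i < N" by simp
    have "measure P {\<omega> \<in> space P. enn2ereal (num_points (\<Xi> \<omega>) (A i)) \<le> ereal (of_int (m i))}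
      = measure P {\<omega> \<in> space P. colour_count (X \<omega>) c i \<le> nat (m i)}"
      using le_iff i by (intro arg_cong[of _ _ "measure P"]) auto
    also have "\<dots> = newton N (\<lambda>u. of_bool (u i \<le> nat (m i))) bk.limit_moment"
      unfolding prob_eq by (rule E) simp
    finally show "newton N (\<lambda>u. of_bool (u i \<le> nat (m i))) bk.limit_moment =
      measure P {\<omega> \<in> space P. enn2ereal (num_points (\<Xi> \<omega>) (A i)) \<le> ereal (of_int (m i))}" by simp
  qed
  finally show ?thesis .
qed

text \<open>By Lindelof, countably many open sets with compact supersets cover the space; the finite
  unions of these supersets increase to it.\<close>

lemma compact_exhaustion:
  assumes "locally_compact_space (euclidean :: 'a::{t2_space, second_countable_topology} topology)"
  shows "\<exists>C :: nat \<Rightarrow> 'a set. incseq C \<and> (\<forall>k. compact (C k)) \<and> (\<Union>k. C k) = UNIV"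
proof -
  have "\<forall>x::'a. \<exists>U K. open U \<and> compact K \<and> x \<in> U \<and> U \<subseteq> K"
    using assms unfolding locally_compact_space_def by (simp add: compactin_euclidean_iff)
  then obtain U K where UK: "\<And>x::'a. open (U x)" "\<And>x. compact (K x)" "\<And>x. x \<in> U x" "\<And>x. U x \<subseteq> K x"
    by metis
  obtain F where F: "F \<subseteq> range U" "countable F" "\<Union>F = \<Union>(range U)"
    using Lindelof[of "range U"] UK(1) by blast
  have cover: "\<Union>F = UNIV" using F(3) UK(3) by auto
  hence "F \<noteq> {}" by auto
  have "\<forall>S\<in>F. \<exists>x. S = U x" using F(1) by auto
  then obtain y where y: "\<And>S. S \<in> F \<Longrightarrow> S = U (y S)" by metis
  define C where "C k = (\<Union>i\<le>k. K (y (from_nat_into F i)))" for k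
  have "incseq C" unfolding C_def incseq_def by (auto intro: order_trans)
  moreover have "compact (C k)" for k unfolding C_def using UK(2) by (intro compact_UN) auto
  moreover have "(\<Union>k. C k) = UNIV"
  proof -
    have "x \<in> (\<Union>k. C k)" for x
    proof -
      obtain S where S: "S \<in> F" "x \<in> S" using cover by auto
      then obtain i where i: "from_nat_into F i = S"
        using from_nat_into_surj[OF F(2)] by blast
      have "x \<in> K (y S)" using S y[OF S(1)] UK(4) by blast
      thus ?thesis using i by (auto simp: C_def)
    qed
    thus ?thesis by auto
  qed
  ultimately show ?thesis by blast
qed

theorem theorem1p4:
  fixes \<mu> :: "'a::{t2_space, second_countable_topology} measure"
    and K :: "'a \<Rightarrow> 'a \<Rightarrow> complex"
    and M :: "'w measure"
    and \<Xi> :: "'w \<Rightarrow> 'a \<Rightarrow> nat"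
  assumes "locally_compact_space (euclidean :: 'a topology)"
    and "regular_borel_measure \<mu>"
    and "hermitian_kernel K"
    and "induces_operator \<mu> K"
    and "locally_trace_class \<mu> K"
    and "nonneg_operator \<mu> (integral_operator \<mu> K)"
    and "contraction \<mu> (integral_operator \<mu> K)"
    and "determinantal M \<Xi> \<mu> K"
  shows "(\<forall>(n::nat) (A :: nat \<Rightarrow> 'a set) (m :: nat \<Rightarrow> int).
            (\<forall>i<n. A i \<in> sets borel) \<and> disjoint_family_on A {..<n} \<longrightarrow>
            measure M {\<omega> \<in> space M. \<forall>i<n. enn2ereal (num_points (\<Xi> \<omega>) (A i)) \<le> ereal (of_int (m i))}
            \<le> (\<Prod>i<n. measure M {\<omega> \<in> space M. enn2ereal (num_points (\<Xi> \<omega>) (A i)) \<le> ereal (of_int (m i))}))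
       \<and> (\<forall>A B :: 'a set. A \<in> sets borel \<and> B \<in> sets borel \<and> A \<inter> B = {} \<longrightarrow>
            negatively_associated M (\<lambda>\<omega>. num_points (\<Xi> \<omega>) A) (\<lambda>\<omega>. num_points (\<Xi> \<omega>) B))"
proof -
  have pp: "point_process M \<Xi>" using assms(8) unfolding determinantal_def by blast
  interpret prob_space M using pp unfolding point_process_def by blast
  note reg = assms(2)[unfolded regular_borel_measure_def]
  have sets: "sets \<mu> = sets borel" by (rule reg[THEN conjunct1])
  obtain C :: "nat \<Rightarrow> 'a set" where C: "incseq C" "\<And>k. compact (C k)" "(\<Union>k. C k) = UNIV"
    using compact_exhaustion[OF assms(1)] by blast
  have C_sets: "C k \<in> sets borel" for k using C(2) by (intro borel_closed compact_imp_closed)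
  have C_fin: "emeasure \<mu> (C k) < \<infinity>" for k by (rule reg[THEN conjunct2, THEN conjunct1, rule_format, OF C(2)])
  have sf: "sigma_finite_measure \<mu>"
  proof (unfold sigma_finite_measure_def, intro exI[of _ "range C"] conjI ballI)
    show "range C \<subseteq> sets \<mu>" using C_sets by (auto simp: sets)
    show "\<Union>(range C) = space \<mu>" using C(3) sets_eq_imp_space_eq[OF sets] by simp
  qed (use C_fin in \<open>auto simp: less_top[symmetric]\<close>)
  have diag_meas: "(\<lambda>x. K x x) \<in> borel_measurable borel"
  proof -
    have K: "(\<lambda>z. K (fst z) (snd z)) \<in> borel_measurable (\<mu> \<Otimes>\<^sub>M \<mu>)"
      using assms(4) unfolding induces_operator_def by (simp add: split_beta')
    have "(\<lambda>x. (x, x)) \<in> measurable \<mu> (\<mu> \<Otimes>\<^sub>M \<mu>)" by measurable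
    from measurable_compose[OF this K] show ?thesis by (simp add: measurable_cong_sets[OF sets refl])
  qed
  define D where "D k = {x \<in> C k. Re (K x x) \<le> real k}" for k
  have D_sets: "D k \<in> sets borel" for k
  proof -
    have "{x \<in> space borel. Re (K x x) \<le> real k} \<in> sets borel" using diag_meas by measurable
    moreover have "D k = C k \<inter> {x \<in> space borel. Re (K x x) \<le> real k}" by (auto simp: D_def)
    ultimately show ?thesis using C_sets by auto
  qed
  have D_inc: "incseq D"
    unfolding incseq_def
  proof (intro allI impI)
    fix i j :: nat assume "i \<le> j"
    hence "C i \<subseteq> C j" "real i \<le> real j" using C(1) by (auto simp: incseq_def)
    thus "D i \<subseteq> D j" by (auto simp: D_def)
  qed
  have D_cover: "(\<Union>k. D k) = UNIV"
  proof -
    have "x \<in> (\<Union>k. D k)" for x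
    proof -
      obtain i where i: "x \<in> C i" using C(3) by auto
      obtain j :: nat where j: "Re (K x x) \<le> real j" using real_arch_simple by blast
      have "C i \<subseteq> C (max i j)" "real j \<le> real (max i j)" using C(1) by (auto simp: incseq_def)
      hence "x \<in> D (max i j)" using i j by (auto simp: D_def)
      thus ?thesis by blast
    qed
    thus ?thesis by auto
  qed
  have np_meas: "(\<lambda>\<omega>. num_points (\<Xi> \<omega>) S) \<in> borel_measurable M" if "S \<in> sets borel" for S
    using pp that unfolding point_process_def by blast
  have ev: "{\<omega> \<in> space M. enn2ereal (num_points (\<Xi> \<omega>) S) \<le> r} \<in> sets M" if "S \<in> sets borel" for S r
    using np_meas[OF that] by measurable
  have main: "measure M {\<omega> \<in> space M. \<forall>i<n. enn2ereal (num_points (\<Xi> \<omega>) (A i)) \<le> ereal (of_int (m i))}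
     \<le> (\<Prod>i<n. measure M {\<omega> \<in> space M. enn2ereal (num_points (\<Xi> \<omega>) (A i)) \<le> ereal (of_int (m i))})"
    if A: "\<forall>i<n. A i \<in> sets borel" "disjoint_family_on A {..<n}" for n :: nat and A and m :: "nat \<Rightarrow> int"
  \<comment> \<open>A negative bound makes the event on the left impossible, and without sets both
    sides are 1. In the other case the bounds can be read as natural numbers.\<close>
  proof (cases "n = 0 \<or> (\<exists>i<n. m i < 0)")
    case True
    show ?thesis
    proof (cases "n = 0")
      case False
      then obtain i where i: "i < n" "m i < 0" using True by blast
      have "\<not> enn2ereal x \<le> ereal (of_int (m i))" for x
      proof
        assume "enn2ereal x \<le> ereal (of_int (m i))"
        hence "0 \<le> ereal (of_int (m i))" using enn2ereal_nonneg[of x] by (rule order_trans[rotated])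
        thus False using i(2) by simp
      qed
      hence "{\<omega> \<in> space M. \<forall>i<n. enn2ereal (num_points (\<Xi> \<omega>) (A i)) \<le> ereal (of_int (m i))} = {}"
        using i(1) by blast
      thus ?thesis by (simp only: measure_empty) (simp add: prod_nonneg)
    qed (simp add: prob_space)
  next
    case False
    define EV where "EV S i = {\<omega> \<in> space M. enn2ereal (num_points (\<Xi> \<omega>) S) \<le> ereal (of_int (m i))}" for S i
    have anti: "EV T i \<subseteq> EV S i" if "S \<subseteq> T" for S T i
    proof
      fix \<omega> assume "\<omega> \<in> EV T i"
      moreover have "enn2ereal (num_points (\<Xi> \<omega>) S) \<le> enn2ereal (num_points (\<Xi> \<omega>) T)"
        using num_points_mono[OF that] by (simp add: less_eq_ennreal.rep_eq)
      ultimately show "\<omega> \<in> EV S i" by (auto simp: EV_def intro: order_trans)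
    qed
    \<comment> \<open>The counts on \<open>S \<inter> D k\<close> increase to the count on
      \<open>S\<close>, so the events decrease to that of \<open>S\<close>, and their probabilities
      converge. Infinite counts are included.\<close>
    have INT: "(\<Inter>k. EV (S \<inter> D k) i) = EV S i" for S i
    proof
      show "EV S i \<subseteq> (\<Inter>k. EV (S \<inter> D k) i)" using anti by blast
      show "(\<Inter>k. EV (S \<inter> D k) i) \<subseteq> EV S i"
      proof
        fix \<omega> assume "\<omega> \<in> (\<Inter>k. EV (S \<inter> D k) i)"
        hence \<omega>: "\<omega> \<in> space M" "\<And>k. enn2ereal (num_points (\<Xi> \<omega>) (S \<inter> D k)) \<le> ereal (of_int (m i))"
          by (auto simp: EV_def)
        have m0: "0 \<le> ereal (of_int (m i))" using \<omega>(2)[of 0] enn2ereal_nonneg by (rule order_trans[rotated])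
        have "num_points (\<Xi> \<omega>) (S \<inter> D k) \<le> e2ennreal (ereal (of_int (m i)))" for k
          using \<omega>(2)[of k] by (metis e2ennreal_enn2ereal e2ennreal_mono)
        hence "num_points (\<Xi> \<omega>) S \<le> e2ennreal (ereal (of_int (m i)))"
          unfolding num_points_SUP[OF D_inc D_cover, of _ S] by (intro SUP_least)
        hence "enn2ereal (num_points (\<Xi> \<omega>) S) \<le> ereal (of_int (m i))"
          using m0 by (metis enn2ereal_e2ennreal less_eq_ennreal.rep_eq)
        thus "\<omega> \<in> EV S i" using \<omega>(1) by (simp add: EV_def)
      qed
    qed
    have EV_sets: "EV S i \<in> sets M" if "S \<in> sets borel" for S i unfolding EV_def by (rule ev[OF that])
    have AD: "A i \<inter> D k \<in> sets borel" if "i < n" for i k using A(1) D_sets that by auto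
    have dec: "decseq (\<lambda>k. EV (S \<inter> D k) i)" for S i
      using D_inc by (auto simp: decseq_def incseq_def intro!: anti)
    have lim1: "(\<lambda>k. measure M (EV (A i \<inter> D k) i)) \<longlonglongrightarrow> measure M (EV (A i) i)" if "i < n" for i
      using finite_Lim_measure_decseq[OF _ dec, of "A i" i] EV_sets[OF AD[OF that]] by (auto simp: INT)
    have n0: "0 < n" using False by simp
    have lim2: "(\<lambda>k. measure M (\<Inter>i<n. EV (A i \<inter> D k) i)) \<longlonglongrightarrow> measure M (\<Inter>i<n. EV (A i) i)"
    proof -
      have 1: "decseq (\<lambda>k. \<Inter>i<n. EV (A i \<inter> D k) i)"
        using dec unfolding decseq_def by (meson INF_mono' order_refl INT_anti_mono)
      have 2: "range (\<lambda>k. \<Inter>i<n. EV (A i \<inter> D k) i) \<subseteq> sets M"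
        using n0 EV_sets AD by (auto intro!: sets.finite_INT)
      have "(\<Inter>k. \<Inter>i<n. EV (A i \<inter> D k) i) = (\<Inter>i<n. \<Inter>k. EV (A i \<inter> D k) i)" by auto
      also have "\<dots> = (\<Inter>i<n. EV (A i) i)" by (simp only: INT)
      finally show ?thesis using finite_Lim_measure_decseq[OF 2 1] by simp
    qed
    have ev_eq: "{\<omega> \<in> space M. \<forall>i<n. enn2ereal (num_points (\<Xi> \<omega>) (S i)) \<le> ereal (of_int (m i))} = (\<Inter>i<n. EV (S i) i)" for S
      using n0 by (auto simp: EV_def)
    have "measure M (\<Inter>i<n. EV (A i \<inter> D k) i) \<le> (\<Prod>i<n. measure M (EV (A i \<inter> D k) i))" for k
    proof -
      have disj: "disjoint_family_on (\<lambda>i. A i \<inter> D k) {..<n}" using A(2) by (auto simp: disjoint_family_on_def)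
      have DC: "D k \<subseteq> C k" by (auto simp: D_def)
      have Dfin: "emeasure \<mu> (D k) < \<infinity>"
        using emeasure_mono[OF DC, of \<mu>] C_sets C_fin by (auto simp: sets intro: le_less_trans)
      have "measure M {\<omega> \<in> space M. \<forall>i<n. enn2ereal (num_points (\<Xi> \<omega>) (A i \<inter> D k)) \<le> ereal (of_int (m i))}
        \<le> (\<Prod>i<n. measure M {\<omega> \<in> space M. enn2ereal (num_points (\<Xi> \<omega>) (A i \<inter> D k)) \<le> ereal (of_int (m i))})"
        by (rule bounded_set_inequality[OF sf sets assms(3,4,6,7,8) AD disj _ D_sets Dfin DC C(2), where R = "real k"])
           (use False in \<open>auto simp: D_def\<close>)
      thus ?thesis unfolding ev_eq[of "\<lambda>i. A i \<inter> D k"] by (simp add: EV_def)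
    qed
    hence "measure M (\<Inter>i<n. EV (A i) i) \<le> (\<Prod>i<n. measure M (EV (A i) i))"
      by (intro LIMSEQ_le[OF lim2 tendsto_prod[OF lim1]]) auto
    thus ?thesis unfolding ev_eq[of A] by (simp add: EV_def)
  qed
  have neg: "negatively_associated M (\<lambda>\<omega>. num_points (\<Xi> \<omega>) A) (\<lambda>\<omega>. num_points (\<Xi> \<omega>) B)"
    if AB: "A \<in> sets borel" "B \<in> sets borel" "A \<inter> B = {}" for A B
    unfolding negatively_associated_def
  proof (intro allI)
    fix r s :: real
    \<comment> \<open>Counts are integers or infinite, so a real threshold may be rounded
      down.\<close>
    have fl: "enn2ereal (num_points (\<Xi> \<omega>) S) \<le> ereal t \<longleftrightarrow> enn2ereal (num_points (\<Xi> \<omega>) S) \<le> ereal (of_int \<lfloor>t\<rfloor>)" for \<omega> S t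
    proof (cases "finite {p \<in> points (\<Xi> \<omega>). fst p \<in> S}")
      case True
      let ?k = "card {p \<in> points (\<Xi> \<omega>). fst p \<in> S}"
      have "real ?k \<le> t \<longleftrightarrow> real ?k \<le> of_int \<lfloor>t\<rfloor>"
      proof -
        have "int ?k \<le> \<lfloor>t\<rfloor> \<longleftrightarrow> real ?k \<le> t" by (simp add: le_floor_iff)
        thus ?thesis by linarith
      qed
      moreover have "enn2ereal (ennreal (real ?k)) = ereal (real ?k)" by (simp add: enn2ereal_ennreal)
      ultimately show ?thesis unfolding num_points_finite[OF True] by (simp only: ereal_less_eq)
    next
      case False
      hence "num_points (\<Xi> \<omega>) S = \<infinity>" by (simp add: num_points_def)
      thus ?thesis by simp
    qed
    define U where "U = {\<omega> \<in> space M. enn2ereal (num_points (\<Xi> \<omega>) A) \<le> ereal r}"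
    define V where "V = {\<omega> \<in> space M. enn2ereal (num_points (\<Xi> \<omega>) B) \<le> ereal s}"
    have UV: "U \<in> sets M" "V \<in> sets M" unfolding U_def V_def using ev AB by auto
    define S where "S i = (if i = 0 then A else B)" for i :: nat
    define t where "t i = (if i = 0 then \<lfloor>r\<rfloor> else \<lfloor>s\<rfloor>)" for i :: nat
    have two: "(\<forall>i<2. Q i) \<longleftrightarrow> Q 0 \<and> Q (Suc 0)" for Q :: "nat \<Rightarrow> bool"
      by (auto simp: numeral_2_eq_2 less_Suc_eq)
    have "measure M {\<omega> \<in> space M. \<forall>i<2. enn2ereal (num_points (\<Xi> \<omega>) (S i)) \<le> ereal (of_int (t i))}
       \<le> (\<Prod>i<2. measure M {\<omega> \<in> space M. enn2ereal (num_points (\<Xi> \<omega>) (S i)) \<le> ereal (of_int (t i))})"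
      using AB by (intro main) (auto simp: S_def disjoint_family_on_def)
    moreover have "{\<omega> \<in> space M. \<forall>i<2. enn2ereal (num_points (\<Xi> \<omega>) (S i)) \<le> ereal (of_int (t i))} = U \<inter> V"
      unfolding two U_def V_def fl[of _ A r] fl[of _ B s] by (auto simp: S_def t_def)
    moreover have "(\<Prod>i<2. measure M {\<omega> \<in> space M. enn2ereal (num_points (\<Xi> \<omega>) (S i)) \<le> ereal (of_int (t i))}) = measure M U * measure M V"
      unfolding U_def V_def fl[of _ A r] fl[of _ B s] by (simp add: numeral_2_eq_2 S_def t_def)
    ultimately have le: "measure M (U \<inter> V) \<le> measure M U * measure M V" by simp
    \<comment> \<open>The joint probability of two events minus the product of their probabilities
      does not change when both are replaced by their complements; this turns the inequality for
      counts below thresholds into the one for counts above them.\<close>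
    have 1: "measure M (space M - U) = 1 - measure M U" "measure M (space M - V) = 1 - measure M V"
      using UV by (auto simp: prob_compl)
    have "measure M (U \<union> V) = measure M U + measure M V - measure M (U \<inter> V)"
      using UV by (subst finite_measure_Union') (auto simp: finite_measure_Diff' Int_commute)
    hence 2: "measure M (space M - (U \<union> V)) = 1 - measure M U - measure M V + measure M (U \<inter> V)"
      using UV by (subst prob_compl) auto
    have 3: "{\<omega> \<in> space M. enn2ereal (num_points (\<Xi> \<omega>) A) > ereal r \<and> enn2ereal (num_points (\<Xi> \<omega>) B) > ereal s} = space M - (U \<union> V)"
      "{\<omega> \<in> space M. enn2ereal (num_points (\<Xi> \<omega>) A) > ereal r} = space M - U"
      "{\<omega> \<in> space M. enn2ereal (num_points (\<Xi> \<omega>) B) > ereal s} = space M - V"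
      by (auto simp: U_def V_def not_le)
    show "measure M {\<omega> \<in> space M. enn2ereal (num_points (\<Xi> \<omega>) A) > ereal r \<and> enn2ereal (num_points (\<Xi> \<omega>) B) > ereal s}
        \<le> measure M {\<omega> \<in> space M. enn2ereal (num_points (\<Xi> \<omega>) A) > ereal r}
           * measure M {\<omega> \<in> space M. enn2ereal (num_points (\<Xi> \<omega>) B) > ereal s}"
      unfolding 3 1 2 using le by (simp add: algebra_simps)
  qed
  show ?thesis using main neg by blast
qed

end
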